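(* Let $K$ be a field, $n\ge 2$ a positive integer, and $R_n$ the rose with $n$ petals. Let $p, q\in A_{R_n}(e_1, e_2)$ be two arbitrary elements, $c, d\in C_s(R_n)$, and $f, g\in \mathrm{Irr}(K[x])$. Then the following holds: (1) $S^{f,\, p}_{c}$ is a simple left $L_K(R_n)$-module; (2) $S^{f,\, p}_{c} \cong S^{g,\, q}_{d}$ as left $L_K(R_n)$-modules if and only if $f = g$, $c=d$, and $p-q = rf(c)$ for some $r\in L_K(R_n)$; (3) for any simple closed path $\alpha$ in $R_n$, $S^{f,\, p}_{c} \cong S^f_{\Pi_{\alpha}}$ as left $L_K(R_n)$-modules if and only if $\alpha \in \Pi_c$ and $p = rf(c)$ for some $r\in L_K(R_n)$; (4) $\mathrm{End}_{L_K(R_n)}(S^{f,\, p}_{c}) \cong K[x]/K[x]f(x)$; (5) $S^{f,\, p}_{c} \cong L_K(R_n)/L_K(R_n)f(\sigma_p^{-1}(c))$ as left $L_K(R_n)$-modules.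
   Context: $R_n$ is the directed graph with one vertex $v$ and $n$ loops $e_1,\ldots,e_n$. Its Leavitt path algebra $L_K(R_n)$ is the unital associative $K$-algebra generated by $v,e_1,\ldots,e_n,e_1^*,\ldots,e_n^*$ subject to $v=1$, $e_i^*e_j=\delta_{i,j}v$ for all $1\le i,j\le n$, and $\sum_{i=1}^n e_ie_i^*=v$. $A_{R_n}(e_1,e_2)$ is the $K$-subalgebra of $L_K(R_n)$ generated by $v,e_1,e_3,\ldots,e_n,e_2^*,\ldots,e_n^*$. For $p\in A_{R_n}(e_1,e_2)$, $\sigma_p$ is the unique $K$-algebra automorphism of $L_K(R_n)$ with $\sigma_p(e_2)=e_2+e_1p$, $\sigma_p(e_1^* )=e_1^*-pe_2^*$, and $\sigma_p(a)=a$ for all $a\in A_{R_n}(e_1,e_2)$; its inverse satisfies $\sigma_p^{-1}(e_2)=e_2-e_1p$, $\sigma_p^{-1}(e_1^* )=e_1^*+pe_2^*$ and fixes $A_{R_n}(e_1,e_2)$ elementwise. A closed path in $R_n$ is a nonempty word $e_{k_1}\cdots e_{k_m}$ in the edges; it is simple if it is not of the form $d^k$ with $d$ a closed path and $k\ge 2$. For a simple closed path $c=e_{k_1}\cdots e_{k_m}$, $\Pi_c$ is the set of all its cyclic rotations $e_{k_i}\cdots e_{k_m}e_{k_1}\cdots e_{k_{i-1}}$, $1\le i\le m$. $C_s(R_n)$ is the set of simple closed paths $e_{k_1}\cdots e_{k_m}$ ($m\ge1$) in $R_n$ with $k_i\in\{1,3,\ldots,n\}$ for $1\le i\le m-1$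 and $k_m=2$. $\mathrm{Irr}(K[x])$ is the set of irreducible polynomials in $K[x]$ of the form $f(x)=1-a_1x-\cdots-a_sx^s$, and $f(c)=v-a_1c-\cdots-a_sc^s\in L_K(R_n)$ (similarly $f$ is evaluated at other elements of $L_K(R_n)$, with constant term $1=v$). For a simple closed path $c$ in $R_n$ and $f(x)=1-a_1x-\cdots-a_sx^s\in\mathrm{Irr}(K[x])$, $S^f_c$ is the cyclic left $L_K(R_n)$-module generated by an element $z$ subject to the relation $z=(a_1c+\cdots+a_sc^s)z$; equivalently $S^f_c\cong L_K(R_n)/L_K(R_n)f(c)$ via $z\mapsto 1+L_K(R_n)f(c)$. It is known that for a simple closed path $d$, $S^f_d\cong S^f_c$ if and only if $d\in\Pi_c$; $S^f_{\Pi_c}$ denotes a module representing this common isomorphism class. For $c\in C_s(R_n)$, $p\in A_{R_n}(e_1,e_2)$ and $f\in \mathrm{Irr}(K[x])$, $S^{f,\,p}_c$ is the twisted module $(S^f_c)^{\sigma_p}$: the same abelian group as $S^f_c$ with the action $r\ast y=\sigma_p(r)y$ for $r\in L_K(R_n)$, $y\in S^f_c$. *)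

theory Defs
  imports
    "HOL-Library.Poly_Mapping"
    "HOL-Computational_Algebra.Polynomial"
    "HOL-Algebra.Generated_Rings"
    "HOL-Algebra.Module"
begin

section \<open>The Leavitt path algebra of the rose with \<open>n\<close> petals\<close>

datatype gen = Vertex | Edge nat | Ghost nat

text \<open>
  Words in the generators are wrapped in a type of their own so that they form a monoid under
  concatenation, written additively; the convolution product on finitely supported functions
  then makes \<open>word \<Rightarrow>\<^sub>0 'k\<close> the free unital associative \<open>'k\<close>-algebra on all of \<open>gen\<close>.
\<close>

datatype word = Word (letters: "gen list")

instantiation word :: monoid_add
begin

definition zero_word_def: "0 = Word []"

definition plus_word_def: "u + w = Word (letters u @ letters w)"

instance
  by standard (simp_all add: zero_word_def plus_word_def)

end

type_synonym 'k free_alg = "word \<Rightarrow>\<^sub>0 'k"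

definition gens :: "nat \<Rightarrow> gen set" where
  "gens n = {Vertex} \<union> Edge ` {1..n} \<union> Ghost ` {1..n}"

definition free_algebra :: "nat \<Rightarrow> 'k::field free_alg ring" where
  "free_algebra n =
    \<lparr>carrier = {x. \<forall>w\<in>Poly_Mapping.keys x. set (letters w) \<subseteq> gens n},
     mult = (*), one = 1, zero = 0, add = (+)\<rparr>"

definition free_gen :: "gen \<Rightarrow> 'k::field free_alg" where
  "free_gen a = Poly_Mapping.single (Word [a]) 1"

definition lpa_relations :: "nat \<Rightarrow> 'k::field free_alg set" where
  "lpa_relations n =
     {free_gen Vertex - 1}
     \<union> {free_gen (Ghost i) * free_gen (Edge j) - (if i = j then free_gen Vertex else 0) | i j.
          i \<in> {1..n} \<and> j \<in> {1..n}}
     \<union> {(\<Sum>i\<in>{1..n}. free_gen (Edge i) * free_gen (Ghost i)) - free_gen Vertex}"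

definition lpa_ideal :: "nat \<Rightarrow> 'k::field free_alg set" where
  "lpa_ideal n = Idl\<^bsub>free_algebra n\<^esub> (lpa_relations n)"

type_synonym 'k lpa = "'k free_alg set"

definition LPA :: "nat \<Rightarrow> 'k::field lpa ring" where
  "LPA n = free_algebra n Quot lpa_ideal n"

definition lpa_class :: "nat \<Rightarrow> 'k::field free_alg \<Rightarrow> 'k lpa" where
  "lpa_class n x = lpa_ideal n +>\<^bsub>free_algebra n\<^esub> x"

definition vtx :: "nat \<Rightarrow> 'k::field lpa" where
  "vtx n = lpa_class n (free_gen Vertex)"

definition edge :: "nat \<Rightarrow> nat \<Rightarrow> 'k::field lpa" where
  "edge n i = lpa_class n (free_gen (Edge i))"

definition ghost :: "nat \<Rightarrow> nat \<Rightarrow> 'k::field lpa" where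
  "ghost n i = lpa_class n (free_gen (Ghost i))"

text \<open>
  The structure map \<open>k \<mapsto> k \<cdot> 1\<close>. The \<open>'k\<close>-algebra structure of \<open>LPA n\<close> is carried by it: a unital
  subring is a subalgebra iff it contains all \<open>scal n k\<close>, and a unital ring homomorphism is
  \<open>'k\<close>-linear iff it is compatible with the structure maps.
\<close>

definition scal :: "nat \<Rightarrow> 'k::field \<Rightarrow> 'k lpa" where
  "scal n k = lpa_class n (Poly_Mapping.single 0 k)"

definition alg_iso :: "('a, 'c) ring_scheme \<Rightarrow> ('k \<Rightarrow> 'a) \<Rightarrow> ('b, 'd) ring_scheme \<Rightarrow> ('k \<Rightarrow> 'b)
    \<Rightarrow> ('a \<Rightarrow> 'b) set" where
  "alg_iso R \<iota> S \<kappa> = {h \<in> ring_iso R S. \<forall>k. h (\<iota> k) = \<kappa> k}"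


section \<open>The subalgebra \<open>A\<close> and the automorphisms \<open>\<sigma>\<^sub>p\<close>\<close>

definition subalg_A :: "nat \<Rightarrow> 'k::field lpa set" where
  "subalg_A n = generate_ring (LPA n)
     (range (scal n) \<union> {vtx n} \<union> edge n ` ({1} \<union> {3..n}) \<union> ghost n ` {2..n})"

text \<open>
  Maps on carriers are made extensional (\<open>undefined\<close> outside the carrier), as otherwise the
  automorphism would not be unique as a HOL function.
\<close>

definition sigma :: "nat \<Rightarrow> 'k::field lpa \<Rightarrow> 'k lpa \<Rightarrow> 'k lpa" where
  "sigma n p = (THE \<sigma>.
     \<sigma> \<in> extensional (carrier (LPA n)) \<and>
     \<sigma> \<in> alg_iso (LPA n) (scal n) (LPA n) (scal n) \<and>
     \<sigma> (edge n 2) = edge n 2 \<oplus>\<^bsub>LPA n\<^esub> edge n 1 \<otimes>\<^bsub>LPA n\<^esub> p \<and>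
     \<sigma> (ghost n 1) = ghost n 1 \<ominus>\<^bsub>LPA n\<^esub> p \<otimes>\<^bsub>LPA n\<^esub> ghost n 2 \<and>
     (\<forall>a\<in>subalg_A n. \<sigma> a = a))"

definition sigma_inv :: "nat \<Rightarrow> 'k::field lpa \<Rightarrow> 'k lpa \<Rightarrow> 'k lpa" where
  "sigma_inv n p = inv_into (carrier (LPA n)) (sigma n p)"


section \<open>Closed paths and irreducible polynomials\<close>

text \<open>The path \<open>e\<^bsub>k\<^sub>1\<^esub> \<cdots> e\<^bsub>k\<^sub>m\<^esub>\<close> is represented by the list \<open>[k\<^sub>1, \<dots>, k\<^sub>m]\<close>.\<close>

definition closed_path :: "nat \<Rightarrow> nat list \<Rightarrow> bool" where
  "closed_path n c \<longleftrightarrow> c \<noteq> [] \<and> set c \<subseteq> {1..n}"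

definition simple_closed_path :: "nat \<Rightarrow> nat list \<Rightarrow> bool" where
  "simple_closed_path n c \<longleftrightarrow> closed_path n c \<and>
     \<not> (\<exists>d k. closed_path n d \<and> k \<ge> 2 \<and> c = concat (replicate k d))"

definition rotations :: "nat list \<Rightarrow> nat list set" where
  "rotations c = {rotate i c | i. i < length c}"

definition C_s :: "nat \<Rightarrow> nat list set" where
  "C_s n = {c. simple_closed_path n c \<and> set (butlast c) \<subseteq> {1} \<union> {3..n} \<and> last c = 2}"

definition path_elem :: "nat \<Rightarrow> nat list \<Rightarrow> 'k::field lpa" where
  "path_elem n c = foldr (\<lambda>i x. edge n i \<otimes>\<^bsub>LPA n\<^esub> x) c \<one>\<^bsub>LPA n\<^esub>"

text \<open>Irreducibility is the type-class notion here, not the one of HOL-Algebra.\<close>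

definition Irr :: "'k::field poly set" where
  "Irr = {f. comm_semiring_1_class.irreducible f \<and> poly.coeff f 0 = 1}"

definition lpa_eval :: "nat \<Rightarrow> 'k::field poly \<Rightarrow> 'k lpa \<Rightarrow> 'k lpa" where
  "lpa_eval n f x =
     (\<Oplus>\<^bsub>LPA n\<^esub>i\<in>{..Polynomial.degree f}. scal n (poly.coeff f i) \<otimes>\<^bsub>LPA n\<^esub> (x [^]\<^bsub>LPA n\<^esub> i))"


section \<open>Left modules over a not necessarily commutative ring\<close>

locale left_module = R?: ring R + M?: abelian_group M
  for R :: "('a, 'c) ring_scheme" (structure) and M :: "('a, 'b, 'd) module_scheme" (structure) +
  assumes smult_closed: "\<lbrakk>a \<in> carrier R; x \<in> carrier M\<rbrakk> \<Longrightarrow> a \<odot>\<^bsub>M\<^esub> x \<in> carrier M"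
    and smult_l_distr: "\<lbrakk>a \<in> carrier R; b \<in> carrier R; x \<in> carrier M\<rbrakk> \<Longrightarrow>
      (a \<oplus> b) \<odot>\<^bsub>M\<^esub> x = a \<odot>\<^bsub>M\<^esub> x \<oplus>\<^bsub>M\<^esub> b \<odot>\<^bsub>M\<^esub> x"
    and smult_r_distr: "\<lbrakk>a \<in> carrier R; x \<in> carrier M; y \<in> carrier M\<rbrakk> \<Longrightarrow>
      a \<odot>\<^bsub>M\<^esub> (x \<oplus>\<^bsub>M\<^esub> y) = a \<odot>\<^bsub>M\<^esub> x \<oplus>\<^bsub>M\<^esub> a \<odot>\<^bsub>M\<^esub> y"
    and smult_assoc1: "\<lbrakk>a \<in> carrier R; b \<in> carrier R; x \<in> carrier M\<rbrakk> \<Longrightarrow>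
      (a \<otimes> b) \<odot>\<^bsub>M\<^esub> x = a \<odot>\<^bsub>M\<^esub> (b \<odot>\<^bsub>M\<^esub> x)"
    and smult_one: "x \<in> carrier M \<Longrightarrow> \<one> \<odot>\<^bsub>M\<^esub> x = x"

definition simple_left_module :: "('a, 'c) ring_scheme \<Rightarrow> ('a, 'b, 'd) module_scheme \<Rightarrow> bool" where
  "simple_left_module R M \<longleftrightarrow> left_module R M \<and> carrier M \<noteq> {\<zero>\<^bsub>M\<^esub>} \<and>
     (\<forall>N. submodule N R M \<longrightarrow> N = {\<zero>\<^bsub>M\<^esub>} \<or> N = carrier M)"

definition mod_hom :: "('a, 'c) ring_scheme \<Rightarrow> ('a, 'b, 'd) module_scheme
    \<Rightarrow> ('a, 'e, 'f) module_scheme \<Rightarrow> ('b \<Rightarrow> 'e) set" where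
  "mod_hom R M N = {h \<in> carrier M \<rightarrow> carrier N.
     (\<forall>x\<in>carrier M. \<forall>y\<in>carrier M. h (x \<oplus>\<^bsub>M\<^esub> y) = h x \<oplus>\<^bsub>N\<^esub> h y) \<and>
     (\<forall>r\<in>carrier R. \<forall>x\<in>carrier M. h (r \<odot>\<^bsub>M\<^esub> x) = r \<odot>\<^bsub>N\<^esub> h x)}"

definition mod_isomorphic :: "('a, 'c) ring_scheme \<Rightarrow> ('a, 'b, 'd) module_scheme
    \<Rightarrow> ('a, 'e, 'f) module_scheme \<Rightarrow> bool" where
  "mod_isomorphic R M N \<longleftrightarrow> (\<exists>h\<in>mod_hom R M N. bij_betw h (carrier M) (carrier N))"

definition End_ring :: "('a, 'c) ring_scheme \<Rightarrow> ('a, 'b, 'd) module_scheme \<Rightarrow> ('b \<Rightarrow> 'b) ring" where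
  "End_ring R M =
    \<lparr>carrier = mod_hom R M M \<inter> extensional (carrier M),
     mult = (\<lambda>g h. compose (carrier M) g h), one = (\<lambda>x\<in>carrier M. x),
     zero = (\<lambda>x\<in>carrier M. \<zero>\<^bsub>M\<^esub>), add = (\<lambda>g h. \<lambda>x\<in>carrier M. g x \<oplus>\<^bsub>M\<^esub> h x)\<rparr>"

text \<open>
  The left module \<open>R / Ra\<close>. The library's \<open>PIdl\<^bsub>R\<^esub> a = {r \<otimes> a | r. r \<in> carrier R}\<close> is the
  left ideal \<open>Ra\<close> also for noncommutative \<open>R\<close>. The fields \<open>mult\<close> and \<open>one\<close> of the record carry no
  meaning for modules.
\<close>

definition cyclic_module :: "('a, 'c) ring_scheme \<Rightarrow> 'a \<Rightarrow> ('a, 'a set) module" where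
  "cyclic_module R a =
    \<lparr>carrier = a_rcosets\<^bsub>R\<^esub> (PIdl\<^bsub>R\<^esub> a), mult = undefined, one = undefined,
     zero = PIdl\<^bsub>R\<^esub> a, add = set_add R,
     smult = (\<lambda>r X. \<Union>x\<in>X. PIdl\<^bsub>R\<^esub> a +>\<^bsub>R\<^esub> (r \<otimes>\<^bsub>R\<^esub> x))\<rparr>"

definition twist :: "('a \<Rightarrow> 'a) \<Rightarrow> ('a, 'b) module \<Rightarrow> ('a, 'b) module" where
  "twist \<sigma> M = M\<lparr>smult := (\<lambda>r y. \<sigma> r \<odot>\<^bsub>M\<^esub> y)\<rparr>"

definition S_mod :: "nat \<Rightarrow> 'k::field poly \<Rightarrow> nat list \<Rightarrow> ('k lpa, 'k lpa set) module" where
  "S_mod n f c = cyclic_module (LPA n) (lpa_eval n f (path_elem n c))"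

definition S_twist :: "nat \<Rightarrow> 'k::field poly \<Rightarrow> 'k lpa \<Rightarrow> nat list
    \<Rightarrow> ('k lpa, 'k lpa set) module" where
  "S_twist n f p c = twist (sigma n p) (S_mod n f c)"

text \<open>The scalar \<open>k \<in> 'k\<close> as an endomorphism of a left \<open>LPA n\<close>-module.\<close>

definition End_scal :: "nat \<Rightarrow> ('k::field lpa, 'b) module \<Rightarrow> 'k \<Rightarrow> 'b \<Rightarrow> 'b" where
  "End_scal n M k = (\<lambda>x\<in>carrier M. scal n k \<odot>\<^bsub>M\<^esub> x)"


section \<open>The quotient algebra \<open>K[x] / K[x]f\<close>\<close>

definition poly_alg :: "'k::field poly ring" where
  "poly_alg = \<lparr>carrier = UNIV, mult = (*), one = 1, zero = 0, add = (+)\<rparr>"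

definition poly_quot :: "'k::field poly \<Rightarrow> 'k poly set ring" where
  "poly_quot f = poly_alg Quot (PIdl\<^bsub>poly_alg\<^esub> f)"

definition poly_quot_scal :: "'k::field poly \<Rightarrow> 'k \<Rightarrow> 'k poly set" where
  "poly_quot_scal f k = PIdl\<^bsub>poly_alg\<^esub> f +>\<^bsub>poly_alg\<^esub> [:k:]"

end

theory Submission
  imports Defs "HOL-Algebra.Algebraic_Closure_Type" "HOL-Library.Function_Algebras"
begin

text \<open>
  Write \<open>c = v e\<^sub>2\<close>, where \<open>v\<close> avoids \<open>e\<^sub>2\<close>, and let \<open>\<theta>\<close> be a root of \<open>f\<close> in the algebraic closure
  of \<open>K\<close>. The algebra acts on functions on infinite paths, each \<open>e\<^sub>2\<close> being weighted by \<open>\<theta>\<close>, so that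
  the indicator \<open>z\<close> of the periodic path \<open>c c c \<cdots>\<close> satisfies \<open>c z = \<theta> z\<close>. Its annihilator is exactly
  the left ideal generated by \<open>f(c)\<close>, and stripping initial segments shows that this left ideal is
  maximal; thus \<open>S\<^sup>f\<^sub>c\<close> is the simple module generated by \<open>z\<close>.

  Isomorphisms and endomorphisms are governed by the solutions \<open>y\<close> of \<open>g(\<sigma>\<^sub>p(d)) y = 0\<close>. Cut
  infinite paths into blocks, one for each \<open>e\<^sub>2\<close>, and let the degree of a path be the number of blocks
  after which it agrees with \<open>c c c \<cdots>\<close>. The subalgebra \<open>A\<close> never raises a degree that is at least \<open>1\<close>,
  whereas \<open>\<sigma>\<^sub>p(w e\<^sub>2) = w e\<^sub>2 + w e\<^sub>1 p\<close> raises it by exactly \<open>1\<close>. A solution \<open>y \<noteq> 0\<close> must therefore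
  have degree \<open>0\<close>, i.e. be a multiple of \<open>z\<close>, and so must \<open>\<sigma>\<^sub>p(d) y\<close>; comparing coefficients
  gives \<open>d = c\<close>, \<open>p z = 0\<close> and \<open>g(\<theta>) = 0\<close>.
\<close>

text \<open>The weight \<theta> lets one representation serve every f: with weight 1 the periodic
  path would be fixed by c, which covers only 1 - x. As \<theta> need not lie in K, functions take
  values in the algebraic closure, and the price is a descent: a coefficient must be recognised as
  h(\<theta>) with h over K before h(c) can realise it in the algebra. No normal form for elements
  of the algebra is used; membership in the left ideal of f(c) is tested on z. Twists enter through
  differences: since \<sigma>_p \<sigma>_q = \<sigma>_{p+q}, comparing the twists by p and q is a
  question about p - q, and the decisive condition is that p - q kills z. The degree argument needs
  an e_2 in the path; a closed path \<alpha> without e_2 is fixed by every \<sigma>_p and is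
  excluded by the length of the first block, while any other \<alpha> is rotated to end in e_2 and
  may then consist of several blocks.\<close>

declare One_nat_def [simp del]

section \<open>The free algebra and its quotient\<close>

text \<open>Keeping \<open>w \<in> Poly_Mapping.keys x\<close> in the case \<open>single\<close>
  lets an induction over an element of the carrier see only words in \<open>gens n\<close>.\<close>

lemma free_alg_induct [case_names zero single add]:
  fixes x :: "'k::field free_alg"
  assumes "P 0"
    and "\<And>w k. w \<in> Poly_Mapping.keys x \<Longrightarrow> P (Poly_Mapping.single w k)"
    and "\<And>a b. P a \<Longrightarrow> P b \<Longrightarrow> P (a + b)"
  shows "P x"
proof -
  have *: "P (\<Sum>w\<in>S. Poly_Mapping.single w (Poly_Mapping.lookup x w))"
    if "finite S" "S \<subseteq> Poly_Mapping.keys x" for S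
    using that by (induction S rule: finite_induct) (auto intro: assms)
  have "(\<Sum>w\<in>Poly_Mapping.keys x. Poly_Mapping.single w (Poly_Mapping.lookup x w)) = x"
    by (rule poly_mapping_eqI)
      (auto simp: lookup_sum lookup_single when_def in_keys_iff)
  with *[of "Poly_Mapping.keys x"] show ?thesis by simp
qed

lemma single_zero_commute:
  "Poly_Mapping.single 0 k * x = x * (Poly_Mapping.single 0 k :: 'k::field free_alg)"
  by (induction x rule: free_alg_induct) (auto simp: mult_single algebra_simps)

lemma single_Word_Cons:
  "Poly_Mapping.single (Word (a # as)) k =
    free_gen a * (Poly_Mapping.single (Word as) k :: 'k::field free_alg)"
  by (simp add: free_gen_def mult_single plus_word_def)

lemma letters_zero [simp]: "letters 0 = []"
  by (simp add: zero_word_def)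

lemma letters_plus [simp]: "letters (u + w) = letters u @ letters w"
  by (simp add: plus_word_def)

lemma carrier_free_algebra:
  "x \<in> carrier (free_algebra n) \<longleftrightarrow>
    (\<forall>w\<in>Poly_Mapping.keys x. set (letters w) \<subseteq> gens n)"
  by (simp add: free_algebra_def)

lemma free_algebra_simps [simp]:
  "x \<otimes>\<^bsub>free_algebra n\<^esub> y = x * y"
  "\<one>\<^bsub>free_algebra n\<^esub> = 1"
  "\<zero>\<^bsub>free_algebra n\<^esub> = 0"
  "x \<oplus>\<^bsub>free_algebra n\<^esub> y = x + y"
  by (simp_all add: free_algebra_def)

lemma free_algebra_closed [intro, simp]:
  fixes x y :: "'k::field free_alg"
  shows "x \<in> carrier (free_algebra n) \<Longrightarrow> y \<in> carrier (free_algebra n) \<Longrightarrow> x + y \<in> carrier (free_algebra n)"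
    and "x \<in> carrier (free_algebra n) \<Longrightarrow> y \<in> carrier (free_algebra n) \<Longrightarrow> x * y \<in> carrier (free_algebra n)"
    and "x \<in> carrier (free_algebra n) \<Longrightarrow> - x \<in> carrier (free_algebra n)"
    and "0 \<in> carrier (free_algebra n)"
    and "1 \<in> carrier (free_algebra n)"
    and "Poly_Mapping.single 0 k \<in> carrier (free_algebra n)"
    and "a \<in> gens n \<Longrightarrow> free_gen a \<in> carrier (free_algebra n)"
proof -
  show "x + y \<in> carrier (free_algebra n)"
    if "x \<in> carrier (free_algebra n)" "y \<in> carrier (free_algebra n)"
    unfolding carrier_free_algebra
  proof
    fix w assume "w \<in> Poly_Mapping.keys (x + y)"
    then have "w \<in> Poly_Mapping.keys x \<union> Poly_Mapping.keys y" using keys_add[of x y] by blast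
    then show "set (letters w) \<subseteq> gens n" using that unfolding carrier_free_algebra by blast
  qed
  show "x * y \<in> carrier (free_algebra n)"
    if "x \<in> carrier (free_algebra n)" "y \<in> carrier (free_algebra n)"
    unfolding carrier_free_algebra
  proof
    fix w assume "w \<in> Poly_Mapping.keys (x * y)"
    then obtain a b where "w = a + b" "a \<in> Poly_Mapping.keys x" "b \<in> Poly_Mapping.keys y"
      using keys_mult[of x y] by blast
    then show "set (letters w) \<subseteq> gens n" using that unfolding carrier_free_algebra by auto
  qed
qed (auto simp: carrier_free_algebra in_keys_iff lookup_one when_def lookup_single free_gen_def
    split: if_splits)

lemma free_algebra_diff [intro, simp]:
  fixes x y :: "'k::field free_alg"
  shows "x \<in> carrier (free_algebra n) \<Longrightarrow> y \<in> carrier (free_algebra n) \<Longrightarrow> x - y \<in> carrier (free_algebra n)"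
  using free_algebra_closed(1)[of x n "- y"] by auto

lemma ring_free_algebra: "ring (free_algebra n :: 'k::field free_alg ring)"
proof (rule ringI)
  show "abelian_group (free_algebra n :: 'k free_alg ring)"
  proof (rule abelian_groupI)
    show "\<exists>y\<in>carrier (free_algebra n). y \<oplus>\<^bsub>free_algebra n\<^esub> x = \<zero>\<^bsub>free_algebra n\<^esub>"
      if "x \<in> carrier (free_algebra n)" for x :: "'k free_alg"
      using that by (intro bexI[of _ "- x"]) auto
  qed (auto simp: algebra_simps)
  show "Group.monoid (free_algebra n :: 'k free_alg ring)"
    by (rule Group.monoid.intro) (auto simp: algebra_simps)
qed (auto simp: algebra_simps)

lemma free_algebra_a_inv:
  fixes x :: "'k::field free_alg"
  assumes "x \<in> carrier (free_algebra n)"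
  shows "\<ominus>\<^bsub>free_algebra n\<^esub> x = - x"
proof -
  interpret ring "free_algebra n :: 'k free_alg ring" by (rule ring_free_algebra)
  show ?thesis using assms by (intro minus_equality) auto
qed

lemma free_algebra_a_minus:
  fixes x y :: "'k::field free_alg"
  assumes "y \<in> carrier (free_algebra n)"
  shows "x \<ominus>\<^bsub>free_algebra n\<^esub> y = x - y"
  using assms by (simp add: a_minus_def free_algebra_a_inv)

lemma gens_simps [simp]:
  "Vertex \<in> gens n" "Edge i \<in> gens n \<longleftrightarrow> i \<in> {1..n}" "Ghost i \<in> gens n \<longleftrightarrow> i \<in> {1..n}"
  by (auto simp: gens_def)

lemma free_algebra_sum:
  fixes g :: "'i \<Rightarrow> 'k::field free_alg"
  assumes "\<And>i. i \<in> S \<Longrightarrow> g i \<in> carrier (free_algebra n)"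
  shows "sum g S \<in> carrier (free_algebra n)"
  using assms by (induction S rule: infinite_finite_induct) auto

lemma lpa_relations_subset: "lpa_relations n \<subseteq> carrier (free_algebra n)"
  unfolding lpa_relations_def by (auto intro!: free_algebra_sum free_algebra_diff)

lemma ideal_lpa_ideal: "ideal (lpa_ideal n :: 'k::field free_alg set) (free_algebra n)"
proof -
  interpret ring "free_algebra n :: 'k free_alg ring" by (rule ring_free_algebra)
  show ?thesis unfolding lpa_ideal_def by (rule genideal_ideal[OF lpa_relations_subset])
qed

lemma ring_LPA: "ring (LPA n :: 'k::field lpa ring)"
  unfolding LPA_def by (rule ideal.quotient_is_ring[OF ideal_lpa_ideal])

lemma lpa_class_hom: "lpa_class n \<in> ring_hom (free_algebra n) (LPA n :: 'k::field lpa ring)"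
proof -
  have "lpa_class n = (+>\<^bsub>free_algebra n\<^esub>) (lpa_ideal n :: 'k free_alg set)"
    by (auto simp: lpa_class_def)
  then show ?thesis
    using ideal.rcos_ring_hom[OF ideal_lpa_ideal] by (simp add: LPA_def)
qed

lemma carrier_LPA: "carrier (LPA n) = lpa_class n ` carrier (free_algebra n)"
  by (auto simp: LPA_def FactRing_def A_RCOSETS_def' lpa_class_def)

lemma lpa_class_eq_iff:
  fixes x y :: "'k::field free_alg"
  assumes "x \<in> carrier (free_algebra n)" "y \<in> carrier (free_algebra n)"
  shows "lpa_class n x = lpa_class n y \<longleftrightarrow> x - y \<in> lpa_ideal n"
proof -
  interpret ring "free_algebra n :: 'k free_alg ring" by (rule ring_free_algebra)
  show ?thesis
    using quotient_eq_iff_same_a_r_cos[OF ideal_lpa_ideal assms] assms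
    by (simp add: lpa_class_def free_algebra_a_minus)
qed

lemma lpa_relation_class:
  assumes "x - y \<in> lpa_relations n" "x \<in> carrier (free_algebra n)" "y \<in> carrier (free_algebra n)"
  shows "lpa_class n x = (lpa_class n y :: 'k::field lpa)"
proof -
  interpret ring "free_algebra n :: 'k free_alg ring" by (rule ring_free_algebra)
  show ?thesis
    using genideal_self[OF lpa_relations_subset] assms
    by (auto simp: lpa_class_eq_iff lpa_ideal_def)
qed

text \<open>\<open>R\<close> is a variable tied to \<open>LPA n\<close> by an equation, so that the
  unindexed ring notation refers to it and the quotient construction stays folded.\<close>

locale leavitt_rose = ring R for n :: nat and R :: "'k::field lpa ring" (structure) +
  assumes R_def: "R = LPA n" and n_ge_2: "2 \<le> n"

lemma leavitt_rose_LPA: "2 \<le> n \<Longrightarrow> leavitt_rose n (LPA n)"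
  by (simp add: leavitt_rose_def leavitt_rose_axioms_def ring_LPA)

section \<open>Generators, relations and induction in the quotient algebra\<close>

context leavitt_rose
begin

abbreviation "F \<equiv> (free_algebra n :: 'k free_alg ring)"
abbreviation "cl \<equiv> (lpa_class n :: 'k free_alg \<Rightarrow> 'k lpa)"
abbreviation "e \<equiv> (edge n :: nat \<Rightarrow> 'k lpa)"
abbreviation "g \<equiv> (ghost n :: nat \<Rightarrow> 'k lpa)"
abbreviation "sc \<equiv> (scal n :: 'k \<Rightarrow> 'k lpa)"

lemma carrier_R: "carrier R = cl ` carrier F"
  by (simp add: R_def carrier_LPA)

lemma cl_closed [simp, intro]: "x \<in> carrier F \<Longrightarrow> cl x \<in> carrier R"
  by (simp add: carrier_R)

lemma cl_add: "x \<in> carrier F \<Longrightarrow> y \<in> carrier F \<Longrightarrow> cl (x + y) = cl x \<oplus> cl y"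
  and cl_mult: "x \<in> carrier F \<Longrightarrow> y \<in> carrier F \<Longrightarrow> cl (x * y) = cl x \<otimes> cl y"
  and cl_one: "cl 1 = \<one>"
  using ring_hom_add[OF lpa_class_hom, of x n y] ring_hom_mult[OF lpa_class_hom, of x n y]
    ring_hom_one[OF lpa_class_hom, of n]
  by (simp_all add: R_def)

lemma cl_zero: "cl 0 = \<zero>"
proof -
  interpret h: ring_hom_ring F R "cl"
    using lpa_class_hom R_def by (intro ring_hom_ringI2 ring_free_algebra ring_axioms) auto
  show ?thesis using h.hom_zero by simp
qed

lemma cl_uminus: "x \<in> carrier F \<Longrightarrow> cl (- x) = \<ominus> cl x"
  using cl_add[of "- x" x] by (metis add.inv_equality cl_closed cl_zero free_algebra_closed(3) left_minus)

lemma cl_diff: "x \<in> carrier F \<Longrightarrow> y \<in> carrier F \<Longrightarrow> cl (x - y) = cl x \<ominus> cl y"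
  using cl_add[of x "- y"] cl_uminus[of y] by (simp add: a_minus_def)

lemma vtx_eq_one: "vtx n = \<one>"
proof -
  have "free_gen Vertex - 1 \<in> (lpa_relations n :: 'k free_alg set)"
    by (simp add: lpa_relations_def)
  from lpa_relation_class[OF this] show ?thesis by (simp add: vtx_def cl_one)
qed

lemma edge_closed [simp, intro]: "i \<in> {1..n} \<Longrightarrow> e i \<in> carrier R"
  and ghost_closed [simp, intro]: "i \<in> {1..n} \<Longrightarrow> g i \<in> carrier R"
  and scal_closed [simp, intro]: "sc k \<in> carrier R"
  by (auto simp: edge_def ghost_def scal_def)

lemma ghost_edge:
  assumes "i \<in> {1..n}" "j \<in> {1..n}"
  shows "g i \<otimes> e j = (if i = j then \<one> else \<zero>)"
proof -
  have "free_gen (Ghost i) * free_gen (Edge j) - (if i = j then free_gen Vertex else 0)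
      \<in> (lpa_relations n :: 'k free_alg set)"
    unfolding lpa_relations_def using assms by blast
  from lpa_relation_class[OF this] have "cl (free_gen (Ghost i) * free_gen (Edge j))
    = cl (if i = j then free_gen Vertex else 0)"
    using assms by auto
  then show ?thesis
    using assms vtx_eq_one by (auto simp: ghost_def edge_def cl_mult cl_zero vtx_def split: if_splits)
qed

lemma cl_sum:
  assumes "finite S" "\<And>i. i \<in> S \<Longrightarrow> x i \<in> carrier F"
  shows "cl (sum x S) = (\<Oplus>i\<in>S. cl (x i))"
  using assms
proof (induction S rule: finite_induct)
  case empty
  then show ?case by (simp add: cl_zero)
next
  case (insert i S)
  have "sum x S \<in> carrier F" using insert by (intro free_algebra_sum) auto
  moreover have "(\<lambda>i. cl (x i)) \<in> S \<rightarrow> carrier R" using insert by auto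
  ultimately show ?case using insert by (simp add: cl_add)
qed

lemma sum_edge_ghost: "(\<Oplus>i\<in>{1..n}. e i \<otimes> g i) = \<one>"
proof -
  have *: "(\<Sum>i\<in>{1..n}. free_gen (Edge i) * free_gen (Ghost i)) - free_gen Vertex
      \<in> (lpa_relations n :: 'k free_alg set)"
    by (simp add: lpa_relations_def)
  have "(\<Sum>i\<in>{1..n}. free_gen (Edge i) * free_gen (Ghost i)) \<in> carrier F"
    by (intro free_algebra_sum) auto
  from lpa_relation_class[OF * this]
  have "cl (\<Sum>i\<in>{1..n}. free_gen (Edge i) * free_gen (Ghost i)) = \<one>"
    using vtx_eq_one by (simp add: vtx_def)
  moreover have "cl (\<Sum>i\<in>{1..n}. free_gen (Edge i) * free_gen (Ghost i))
      = (\<Oplus>i\<in>{1..n}. cl (free_gen (Edge i) * free_gen (Ghost i)))"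
    by (rule cl_sum) auto
  moreover have "\<dots> = (\<Oplus>i\<in>{1..n}. e i \<otimes> g i)"
    by (rule add.finprod_cong') (auto simp: cl_mult edge_def ghost_def)
  ultimately show ?thesis by simp
qed

lemma scal_add: "sc (k + l) = sc k \<oplus> sc l"
  and scal_mult: "sc (k * l) = sc k \<otimes> sc l"
  and scal_zero: "sc 0 = \<zero>"
  and scal_one: "sc 1 = \<one>"
  by (simp_all add: scal_def single_add cl_add mult_single cl_zero cl_one
      flip: cl_mult)

lemma scal_commute: "x \<in> carrier R \<Longrightarrow> sc k \<otimes> x = x \<otimes> sc k"
  by (auto simp: carrier_R scal_def single_zero_commute simp flip: cl_mult)

text \<open>Every element is the class of a combination of words, and a word is a product of
  letters. The vertex falls under the scalars, being equal to \<open>sc 1\<close>.\<close>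

lemma lpa_induct [consumes 1, case_names scal edge ghost add mult]:
  assumes "x \<in> carrier R"
    and scal: "\<And>k. P (sc k)"
    and edge: "\<And>i. i \<in> {1..n} \<Longrightarrow> P (e i)"
    and ghost: "\<And>i. i \<in> {1..n} \<Longrightarrow> P (g i)"
    and add: "\<And>x y. x \<in> carrier R \<Longrightarrow> y \<in> carrier R \<Longrightarrow> P x \<Longrightarrow> P y \<Longrightarrow> P (x \<oplus> y)"
    and mult: "\<And>x y. x \<in> carrier R \<Longrightarrow> y \<in> carrier R \<Longrightarrow> P x \<Longrightarrow> P y \<Longrightarrow> P (x \<otimes> y)"
  shows "P x"
proof -
  obtain u where u: "u \<in> carrier F" "x = cl u" using assms(1) by (auto simp: carrier_R)
  have word: "P (cl (Poly_Mapping.single (Word as) k))"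
    if "set as \<subseteq> gens n" for as k
    using that
  proof (induction as)
    case Nil
    then show ?case using scal[of k] by (simp add: scal_def zero_word_def)
  next
    case (Cons a as)
    have a: "a \<in> gens n" using Cons.prems by simp
    have w: "Poly_Mapping.single (Word as) k \<in> carrier F"
      using Cons.prems by (auto simp: carrier_free_algebra split: if_splits)
    have "P (cl (free_gen a))"
    proof (cases a)
      case Vertex
      then show ?thesis using vtx_eq_one scal[of 1] scal_one by (simp add: vtx_def)
    next
      case (Edge i)
      then show ?thesis using a edge by (auto simp: edge_def)
    next
      case (Ghost i)
      then show ?thesis using a ghost by (auto simp: ghost_def)
    qed
    then show ?case
      using Cons mult a w by (simp add: single_Word_Cons cl_mult)
  qed
  have "u \<in> carrier F \<and> P (cl u)"
  proof (induction u rule: free_alg_induct)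
    case zero
    then show ?case using scal[of 0] by (simp add: scal_zero cl_zero)
  next
    case (single w k)
    then have "set (letters w) \<subseteq> gens n" using u by (auto simp: carrier_free_algebra)
    then show ?case
      using word[of "letters w" k] by (auto simp: carrier_free_algebra split: if_splits)
  next
    case (add a b)
    then show ?case using assms(5) by (simp add: cl_add)
  qed
  then show ?thesis using u by simp
qed

end

section \<open>Linear actions of the free algebra\<close>

text \<open>The universal property of the free algebra in module form: linear operators may be
  assigned freely to the generators. It is instantiated by left multiplications on the free algebra
  itself, which yields substitution, and by the operators on functions of block sequences, where K
  acts through its closure.\<close>

locale free_action =
  fixes scale :: "'k::field \<Rightarrow> 'v::ab_group_add \<Rightarrow> 'v" and op :: "gen \<Rightarrow> 'v \<Rightarrow> 'v"
  assumes scale_add_left: "scale (k + l) v = scale k v + scale l v"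
    and scale_add_right: "scale k (v + w) = scale k v + scale k w"
    and scale_scale: "scale k (scale l v) = scale (k * l) v"
    and scale_one: "scale 1 v = v"
    and op_add: "op a (v + w) = op a v + op a w"
    and op_scale: "op a (scale k v) = scale k (op a v)"
begin

definition act :: "'k free_alg \<Rightarrow> 'v \<Rightarrow> 'v" where
  "act x v = (\<Sum>w\<in>Poly_Mapping.keys x. scale (Poly_Mapping.lookup x w) (foldr op (letters w) v))"

lemma scale_zero: "scale 0 v = 0"
  using scale_add_left[of 0 0 v] by simp

lemma foldr_op_add: "foldr op as (v + w) = foldr op as v + foldr op as w"
  by (induction as) (simp_all add: op_add)

lemma foldr_op_scale: "foldr op as (scale k v) = scale k (foldr op as v)"
  by (induction as) (simp_all add: op_scale)

lemma act_superset:
  assumes "finite S" "Poly_Mapping.keys x \<subseteq> S"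
  shows "act x v = (\<Sum>w\<in>S. scale (Poly_Mapping.lookup x w) (foldr op (letters w) v))"
  unfolding act_def using assms
  by (intro sum.mono_neutral_left) (auto simp: in_keys_iff scale_zero)

lemma act_zero [simp]: "act 0 v = 0"
  by (simp add: act_def)

lemma act_single: "act (Poly_Mapping.single w k) v = scale k (foldr op (letters w) v)"
  by (simp add: act_def scale_zero)

lemma act_add: "act (x + y) v = act x v + act y v"
proof -
  let ?S = "Poly_Mapping.keys x \<union> Poly_Mapping.keys y"
  have "act (x + y) v =
      (\<Sum>w\<in>?S. scale (Poly_Mapping.lookup (x + y) w) (foldr op (letters w) v))"
    using keys_add[of x y] by (intro act_superset) auto
  also have "\<dots> = act x v + act y v"
    using act_superset[of ?S x v] act_superset[of ?S y v]
    by (simp add: lookup_add scale_add_left sum.distrib)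
  finally show ?thesis .
qed

lemma act_add_right: "act x (v + w) = act x v + act x w"
  by (simp add: act_def foldr_op_add scale_add_right sum.distrib)

lemma act_mult: "act (x * y) v = act x (act y v)"
proof (induction x rule: free_alg_induct)
  case (single w k)
  show ?case
  proof (induction y rule: free_alg_induct)
    case zero
    show ?case using act_add_right[of "Poly_Mapping.single w k" 0 0] by simp
  qed (simp_all add: mult_single act_single foldr_op_scale scale_scale
      distrib_left act_add act_add_right)
qed (simp_all add: distrib_right act_add)

lemma act_one [simp]: "act 1 v = v"
  using act_single[of 0 1 v] by (simp add: scale_one)

lemma act_gen: "act (free_gen a) v = op a v"
  by (simp add: free_gen_def act_single scale_one)

lemma act_uminus: "act (- x) v = - act x v"
  using act_add[of x "- x" v] by (simp add: eq_neg_iff_add_eq_0 add.commute)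

lemma act_diff: "act (x - y) v = act x v - act y v"
  using act_add[of x "- y" v] by (simp add: act_uminus)

end

interpretation subst: free_action
  "\<lambda>k v. Poly_Mapping.single 0 k * (v :: 'k::field free_alg)" "\<lambda>a v. s a * v" for s
proof
  fix a :: gen and k l :: 'k and v w :: "'k free_alg"
  show "Poly_Mapping.single 0 k * (Poly_Mapping.single 0 l * v) = Poly_Mapping.single 0 (k * l) * v"
    by (simp add: mult_single flip: mult.assoc)
  show "s a * (Poly_Mapping.single 0 k * v) = Poly_Mapping.single 0 k * (s a * v)"
    using single_zero_commute[of k "s a"] by (simp flip: mult.assoc)
qed (simp_all add: distrib_left distrib_right single_add)

text \<open>The free algebra acts on itself through left multiplication by the \<open>s a\<close>;
  applying this to 1 gives the algebra homomorphism extending \<open>s\<close>.\<close>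

definition subst :: "(gen \<Rightarrow> 'k::field free_alg) \<Rightarrow> 'k free_alg \<Rightarrow> 'k free_alg" where
  "subst s x = subst.act s x 1"

lemma subst_gen: "subst s (free_gen a) = s a"
  by (simp add: subst_def subst.act_gen)

lemma subst_single_zero: "subst s (Poly_Mapping.single 0 k) = Poly_Mapping.single 0 k"
  by (simp add: subst_def subst.act_single)

lemma subst_add: "subst s (x + y) = subst s x + subst s y"
  by (simp add: subst_def subst.act_add)

lemma subst_diff: "subst s (x - y) = subst s x - subst s y"
  by (simp add: subst_def subst.act_diff)

lemma subst_zero: "subst s 0 = 0"
  by (simp add: subst_def)

lemma subst_one: "subst s 1 = 1"
  by (simp add: subst_def)

lemma subst_mult: "subst s (x * y) = subst s x * subst s y"
proof -
  have *: "foldr (\<lambda>a v. s a * v) as (v * w) = foldr (\<lambda>a v. s a * v) as v * w" for as v w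
    by (induction as) (simp_all add: mult.assoc)
  have "subst.act s x (v * w) = subst.act s x v * w" for v w
    unfolding subst.act_def sum_distrib_right
    by (rule sum.cong[OF refl], subst *, rule mult.assoc[symmetric])
  from this[of 1 "subst.act s y 1"] show ?thesis
    unfolding subst_def subst.act_mult by simp
qed

lemma subst_sum: "subst s (sum f S) = (\<Sum>i\<in>S. subst s (f i))"
  by (induction S rule: infinite_finite_induct) (simp_all add: subst_zero subst_add)

lemma subst_closed:
  assumes "x \<in> carrier (free_algebra n)"
    and s: "\<And>a. a \<in> gens n \<Longrightarrow> s a \<in> carrier (free_algebra n)"
  shows "subst s x \<in> carrier (free_algebra n)"
proof -
  have "foldr (\<lambda>a v. s a * v) as 1 \<in> carrier (free_algebra n)" if "set as \<subseteq> gens n" for as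
    using that by (induction as) (auto intro: s)
  then show ?thesis
    using assms(1) unfolding subst_def subst.act_def
    by (intro free_algebra_sum) (auto simp: carrier_free_algebra[of x])
qed

section \<open>Homomorphisms out of the Leavitt path algebra\<close>

context leavitt_rose
begin

lemma lpa_ideal_minimal:
  "ideal J F \<Longrightarrow> lpa_relations n \<subseteq> J \<Longrightarrow> lpa_ideal n \<subseteq> J"
  unfolding lpa_ideal_def by (rule ring.genideal_minimal[OF ring_free_algebra])

text \<open>Substituting representatives of the \<open>a i\<close> and \<open>b i\<close> is a
  homomorphism on the free algebra whose kernel, after passing to classes, contains the relations
  and so the whole ideal; hence it descends to the quotient.\<close>

lemma lpa_universal:
  assumes ab: "\<And>i. i \<in> {1..n} \<Longrightarrow> a i \<in> carrier R" "\<And>i. i \<in> {1..n} \<Longrightarrow> b i \<in> carrier R"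
    and ba: "\<And>i j. i \<in> {1..n} \<Longrightarrow> j \<in> {1..n} \<Longrightarrow> b i \<otimes> a j = (if i = j then \<one> else \<zero>)"
    and sum_ab: "(\<Oplus>i\<in>{1..n}. a i \<otimes> b i) = \<one>"
  obtains h where "h \<in> ring_hom R R" "\<And>k. h (sc k) = sc k"
    "\<And>i. i \<in> {1..n} \<Longrightarrow> h (e i) = a i" "\<And>i. i \<in> {1..n} \<Longrightarrow> h (g i) = b i"
proof -
  \<comment> \<open>The \<open>a i\<close> and \<open>b i\<close> are cosets, whereas
    \<open>subst\<close> expects elements of the free algebra.\<close>
  define rep where "rep x = (SOME u. u \<in> carrier F \<and> cl u = x)" for x
  have rep: "rep x \<in> carrier F" "cl (rep x) = x" if "x \<in> carrier R" for x
    using someI_ex[of "\<lambda>u. u \<in> carrier F \<and> cl u = x"] that by (auto simp: rep_def carrier_R)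
  define s where "s u = (case u of Vertex \<Rightarrow> free_gen Vertex | Edge i \<Rightarrow> rep (a i)
    | Ghost i \<Rightarrow> rep (b i))" for u
  have s: "s u \<in> carrier F" if "u \<in> gens n" for u
    using that by (cases u) (auto simp: s_def intro!: rep ab)
  have hom: "cl \<circ> subst s \<in> ring_hom F R"
    by (rule ring_hom_memI)
      (auto simp: subst_closed s subst_mult subst_add subst_one cl_mult cl_add cl_one)
  interpret h: ring_hom_ring F R "cl \<circ> subst s"
    by (intro ring_hom_ringI2 ring_free_algebra ring_axioms hom)
  have "lpa_relations n \<subseteq> a_kernel F R (cl \<circ> subst s)"
  proof
    fix x assume x: "x \<in> (lpa_relations n :: 'k free_alg set)"
    then have "x \<in> carrier F" using lpa_relations_subset by blast
    moreover have "cl (subst s x) = \<zero>"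
    proof -
      consider "x = free_gen Vertex - 1"
        | i j where "i \<in> {1..n}" "j \<in> {1..n}"
          "x = free_gen (Ghost i) * free_gen (Edge j) - (if i = j then free_gen Vertex else 0)"
        | "x = (\<Sum>i\<in>{1..n}. free_gen (Edge i) * free_gen (Ghost i)) - free_gen Vertex"
        using x unfolding lpa_relations_def by blast
      then show ?thesis
      proof cases
        case 1
        then show ?thesis
          using vtx_eq_one by (simp add: subst_diff subst_gen subst_one cl_diff s s_def vtx_def cl_one r_neg a_minus_def)
      next
        case 2
        then show ?thesis
          using vtx_eq_one ba[of i j]
          by (auto simp: subst_diff subst_gen subst_mult subst_zero cl_diff s s_def vtx_def
              cl_mult rep ab r_neg a_minus_def cl_zero)
      next
        case 3
        have "cl (subst s (\<Sum>i\<in>{1..n}. free_gen (Edge i) * free_gen (Ghost i)))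
            = (\<Oplus>i\<in>{1..n}. cl (s (Edge i) * s (Ghost i)))"
          unfolding subst_sum by (subst cl_sum) (auto simp: subst_mult subst_gen s)
        also have "\<dots> = (\<Oplus>i\<in>{1..n}. a i \<otimes> b i)"
          by (rule add.finprod_cong') (auto simp: cl_mult s_def rep ab)
        finally have "cl (subst s (\<Sum>i\<in>{1..n}. free_gen (Edge i) * free_gen (Ghost i))) = \<one>"
          using sum_ab by simp
        moreover have "cl (subst s (free_gen Vertex)) = \<one>"
          using vtx_eq_one by (simp add: subst_gen s_def vtx_def)
        moreover have "subst s (\<Sum>i\<in>{1..n}. free_gen (Edge i) * free_gen (Ghost i)) \<in> carrier F"
          by (intro subst_closed free_algebra_sum s) auto
        ultimately show ?thesis
          using 3 s by (simp add: subst_diff cl_diff r_neg a_minus_def subst_closed)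
      qed
    qed
    ultimately show "x \<in> a_kernel F R (cl \<circ> subst s)"
      by (simp add: a_kernel_def')
  qed
  then have ker: "lpa_ideal n \<subseteq> a_kernel F R (cl \<circ> subst s)"
    by (intro lpa_ideal_minimal h.kernel_is_ideal)
  define h where "h x = cl (subst s (rep x))" for x
  have h_cl: "h (cl u) = cl (subst s u)" if u: "u \<in> carrier F" for u
  proof -
    have "rep (cl u) - u \<in> lpa_ideal n"
      using lpa_class_eq_iff[of "rep (cl u)" n u] rep[of "cl u"] u by auto
    then have "cl (subst s (rep (cl u) - u)) = \<zero>" using ker by (auto simp: a_kernel_def')
    then have "cl (subst s (rep (cl u))) \<ominus> cl (subst s u) = \<zero>"
      using u rep[of "cl u"] by (simp add: subst_diff cl_diff subst_closed s)
    then show ?thesis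
      using u rep[of "cl u"] unfolding h_def by (simp add: subst_closed s)
  qed
  show ?thesis
  proof
    show "h \<in> ring_hom R R"
    proof (rule ring_hom_memI)
      fix x y assume "x \<in> carrier R" "y \<in> carrier R"
      then obtain u w where "u \<in> carrier F" "w \<in> carrier F" "x = cl u" "y = cl w"
        by (auto simp: carrier_R)
      then show "h (x \<otimes> y) = h x \<otimes> h y" "h (x \<oplus> y) = h x \<oplus> h y"
        by (simp_all add: subst_mult subst_add h_cl cl_mult cl_add subst_closed s
            flip: cl_mult cl_add)
    next
      fix x assume "x \<in> carrier R"
      then show "h x \<in> carrier R" by (auto simp: h_def rep subst_closed s)
    next
      show "h \<one> = \<one>" using h_cl[of 1] by (simp add: subst_one cl_one)
    qed
    show "h (sc k) = sc k" for k
      using h_cl[of "Poly_Mapping.single 0 k"] by (simp add: scal_def subst_single_zero)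
    show "h (e i) = a i" if "i \<in> {1..n}" for i
      using h_cl[of "free_gen (Edge i)"] that by (simp add: edge_def subst_gen s_def rep ab)
    show "h (g i) = b i" if "i \<in> {1..n}" for i
      using h_cl[of "free_gen (Ghost i)"] that by (simp add: ghost_def subst_gen s_def rep ab)
  qed
qed

lemma lpa_hom_eqI:
  assumes "h \<in> ring_hom R R" "h' \<in> ring_hom R R" "\<And>k. h (sc k) = h' (sc k)"
    "\<And>i. i \<in> {1..n} \<Longrightarrow> h (e i) = h' (e i)" "\<And>i. i \<in> {1..n} \<Longrightarrow> h (g i) = h' (g i)"
    and "x \<in> carrier R"
  shows "h x = h' x"
  using assms(6)
  by (induction x rule: lpa_induct)
    (simp_all add: assms ring_hom_add[OF assms(1)] ring_hom_add[OF assms(2)]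
      ring_hom_mult[OF assms(1)] ring_hom_mult[OF assms(2)])

section \<open>The automorphisms\<close>

abbreviation "A \<equiv> (subalg_A n :: 'k lpa set)"

abbreviation "A_gens \<equiv> range sc \<union> {vtx n} \<union> e ` ({1} \<union> {3..n}) \<union> g ` {2..n}"

lemma A_def: "A = generate_ring R A_gens"
  by (simp add: subalg_A_def R_def)

lemma A_gens_subset: "A_gens \<subseteq> carrier R"
  using vtx_eq_one n_ge_2 by auto

lemma A_subset: "A \<subseteq> carrier R"
  unfolding A_def using generate_ring_in_carrier[OF A_gens_subset] by blast

lemma A_carrier: "x \<in> A \<Longrightarrow> x \<in> carrier R"
  using A_subset by blast

lemma A_subring: "subring A R"
  unfolding A_def by (rule generate_ring_is_subring[OF A_gens_subset])

lemma A_closed [intro]: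
  "\<zero> \<in> A" "x \<in> A \<Longrightarrow> y \<in> A \<Longrightarrow> x \<oplus> y \<in> A" "x \<in> A \<Longrightarrow> \<ominus> x \<in> A"
  using subringE(2,5,7)[OF A_subring] by auto

lemma A_minus_closed [intro]: "x \<in> A \<Longrightarrow> y \<in> A \<Longrightarrow> x \<ominus> y \<in> A"
  by (simp add: a_minus_def A_closed)

lemma A_induct [consumes 1, case_names scal edge ghost uminus add mult]:
  assumes "x \<in> A"
    and scal: "\<And>k. P (sc k)"
    and edge: "\<And>i. i \<in> {1..n} \<Longrightarrow> i \<noteq> 2 \<Longrightarrow> P (e i)"
    and ghost: "\<And>i. i \<in> {1..n} \<Longrightarrow> i \<noteq> 1 \<Longrightarrow> P (g i)"
    and "\<And>x. x \<in> A \<Longrightarrow> P x \<Longrightarrow> P (\<ominus> x)"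
    and "\<And>x y. x \<in> A \<Longrightarrow> y \<in> A \<Longrightarrow> P x \<Longrightarrow> P y \<Longrightarrow> P (x \<oplus> y)"
    and "\<And>x y. x \<in> A \<Longrightarrow> y \<in> A \<Longrightarrow> P x \<Longrightarrow> P y \<Longrightarrow> P (x \<otimes> y)"
  shows "P x"
  using assms(1) unfolding A_def
proof (induction x rule: generate_ring.induct)
  case one
  then show ?case using scal[of 1] scal_one by simp
next
  case (incl h)
  then show ?case using scal[of 1] scal_one vtx_eq_one scal n_ge_2
    by (auto intro!: edge ghost)
qed (use assms in \<open>auto simp: A_def\<close>)

text \<open>The description of \<open>sigma\<close> without extensionality and bijectivity. The
  former is restored by restriction to the carrier, the latter follows from the inverse
  \<open>is_sigma (\<ominus> p)\<close>.\<close>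

definition is_sigma :: "'k lpa \<Rightarrow> ('k lpa \<Rightarrow> 'k lpa) \<Rightarrow> bool" where
  "is_sigma p h \<longleftrightarrow> h \<in> ring_hom R R \<and> (\<forall>k. h (sc k) = sc k) \<and>
     h (e 2) = e 2 \<oplus> e 1 \<otimes> p \<and> h (g 1) = g 1 \<ominus> p \<otimes> g 2 \<and> (\<forall>a\<in>A. h a = a)"

lemma gens_in_A [intro]:
  "i \<in> {1..n} \<Longrightarrow> i \<noteq> 2 \<Longrightarrow> e i \<in> A" "i \<in> {1..n} \<Longrightarrow> i \<noteq> 1 \<Longrightarrow> g i \<in> A" "sc k \<in> A"
proof -
  show "e i \<in> A" if "i \<in> {1..n}" "i \<noteq> 2"
  proof -
    have "i \<in> {1} \<union> {3..n}" using that by auto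
    then show ?thesis unfolding A_def by (intro generate_ring.incl) blast
  qed
  show "g i \<in> A" if "i \<in> {1..n}" "i \<noteq> 1"
  proof -
    have "i \<in> {2..n}" using that by auto
    then show ?thesis unfolding A_def by (intro generate_ring.incl) blast
  qed
qed (auto simp: A_def intro: generate_ring.incl)

lemma is_sigma_unique:
  assumes "is_sigma p h" "is_sigma p h'" "x \<in> carrier R"
  shows "h x = h' x"
proof (rule lpa_hom_eqI[of h h' x])
  show "h (e i) = h' (e i)" if "i \<in> {1..n}" for i
    using assms gens_in_A(1)[OF that] by (cases "i = 2") (auto simp: is_sigma_def)
  show "h (g i) = h' (g i)" if "i \<in> {1..n}" for i
    using assms gens_in_A(2)[OF that] by (cases "i = 1") (auto simp: is_sigma_def)
qed (use assms in \<open>auto simp: is_sigma_def\<close>)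

text \<open>The changed generators still satisfy the Leavitt relations: in (g_1 - p g_2)(e_2 + e_1
  p) the two copies of p cancel and the quadratic term dies because g_2 e_1 = 0; in the sum of the
  products a_i b_i the terms e_1 p g_2 cancel.\<close>

lemma is_sigma_exists:
  assumes p: "p \<in> A"
  obtains h where "is_sigma p h"
proof -
  have n: "1 \<in> {1..n}" "2 \<in> {1..n}" using n_ge_2 by auto
  have pR: "p \<in> carrier R" using p A_carrier by blast
  define a where "a i = (if i = 2 then e 2 \<oplus> e 1 \<otimes> p else e i)" for i
  define b where "b i = (if i = 1 then g 1 \<ominus> p \<otimes> g 2 else g i)" for i
  have ab: "a i \<in> carrier R" "b i \<in> carrier R" if "i \<in> {1..n}" for i
    using that n pR by (auto simp: a_def b_def)
  have ba: "b i \<otimes> a j = (if i = j then \<one> else \<zero>)" if ij: "i \<in> {1..n}" "j \<in> {1..n}" for i j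
  proof -
    have pg: "p \<otimes> g 2 \<otimes> e j = (if j = 2 then p else \<zero>)" if "j \<in> {1..n}" for j
      using that n pR by (simp add: m_assoc ghost_edge)
    have ge: "g i \<otimes> (e 1 \<otimes> p) = (if i = 1 then p else \<zero>)" if "i \<in> {1..n}" for i
      using that n pR by (simp add: ghost_edge flip: m_assoc)
    have pge: "p \<otimes> g 2 \<otimes> (e 1 \<otimes> p) = \<zero>"
      using n pR ge[of 2] by (simp add: m_assoc)
    have pg2: "p \<otimes> g 2 \<in> carrier R" "e 1 \<otimes> p \<in> carrier R" using n pR by auto
    consider "i = 1" "j = 2" | "i = 1" "j \<noteq> 2" | "i \<noteq> 1" "j = 2" | "i \<noteq> 1" "j \<noteq> 2" by blast
    then show ?thesis
    proof cases
      case 1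
      have "(g 1 \<ominus> p \<otimes> g 2) \<otimes> (e 2 \<oplus> e 1 \<otimes> p) = (\<zero> \<oplus> p) \<oplus> \<ominus> (p \<oplus> \<zero>)"
        using n pg2 pR ge[of 1] pg[of 2] pge
        by (simp add: minus_eq l_distr r_distr l_minus ghost_edge l_neg r_neg)
      then show ?thesis using 1 pR by (simp add: a_def b_def r_neg l_neg)
    next
      case 2
      then show ?thesis
        using ij n pg2 pR pg[of j] by (simp add: a_def b_def minus_eq l_distr l_minus ghost_edge)
    next
      case 3
      then show ?thesis
        using ij n pg2 pR ge[of i] by (simp add: a_def b_def r_distr ghost_edge)
    next
      case 4
      then show ?thesis using ij by (simp add: a_def b_def ghost_edge)
    qed
  qed
  have "(\<Oplus>i\<in>{1..n}. a i \<otimes> b i) = \<one>"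
  proof -
    have split: "(\<Oplus>i\<in>{1..n}. x i) = x 1 \<oplus> (x 2 \<oplus> (\<Oplus>i\<in>{3..n}. x i))"
      if "\<And>i. i \<in> {1..n} \<Longrightarrow> x i \<in> carrier R" for x
    proof -
      have "{1..n} = insert 1 (insert 2 {3..n})" using n_ge_2 by auto
      moreover have "x \<in> {3..n} \<rightarrow> carrier R" "x 1 \<in> carrier R" "x 2 \<in> carrier R"
        using that n_ge_2 by auto
      ultimately show ?thesis by (simp add: Pi_def)
    qed
    let ?t = "\<Oplus>i\<in>{3..n}. e i \<otimes> g i"
    have t: "(\<Oplus>i\<in>{3..n}. a i \<otimes> b i) = ?t"
      by (rule add.finprod_cong') (auto simp: a_def b_def)
    have tR: "?t \<in> carrier R" by (intro finsum_closed) auto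
    have "(\<Oplus>i\<in>{1..n}. a i \<otimes> b i)
        = e 1 \<otimes> (g 1 \<ominus> p \<otimes> g 2) \<oplus> ((e 2 \<oplus> e 1 \<otimes> p) \<otimes> g 2 \<oplus> ?t)"
      using split[of "\<lambda>i. a i \<otimes> b i"] ab t by (simp add: a_def b_def)
    also have "\<dots> = e 1 \<otimes> g 1 \<oplus> (e 2 \<otimes> g 2 \<oplus> ?t)"
      using n pR tR by (simp add: minus_eq r_distr l_distr r_minus m_assoc a_ac r_neg1 r_neg2)
    also have "\<dots> = \<one>"
      using split[of "\<lambda>i. e i \<otimes> g i"] sum_edge_ghost by simp
    finally show ?thesis .
  qed
  from lpa_universal[of a b, OF ab ba this] obtain h where h: "h \<in> ring_hom R R"
    "\<And>k. h (sc k) = sc k" "\<And>i. i \<in> {1..n} \<Longrightarrow> h (e i) = a i" "\<And>i. i \<in> {1..n} \<Longrightarrow> h (g i) = b i"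
    by blast
  interpret h: ring_hom_ring R R h
    by (intro ring_hom_ringI2 ring_axioms h)
  have "h x = x" if "x \<in> A" for x
    using that
    by (induction x rule: A_induct) (auto simp: h a_def b_def A_carrier)
  then show ?thesis
    using that[of h] h n by (auto simp: is_sigma_def a_def b_def)
qed

text \<open>The outer map fixes \<open>q\<close>, \<open>e 1\<close> and \<open>g 2\<close>, all of
  which lie in \<open>A\<close>, so the corrections add up. In particular the twist by
  \<open>\<ominus> p\<close> inverts the twist by \<open>p\<close>.\<close>

lemma is_sigma_comp:
  assumes "is_sigma p h" "is_sigma q h'" "p \<in> A" "q \<in> A"
  shows "is_sigma (p \<oplus> q) (h \<circ> h')"
proof -
  have n: "1 \<in> {1..n}" "2 \<in> {1..n}" using n_ge_2 by auto
  have R: "p \<in> carrier R" "q \<in> carrier R" using assms A_carrier by auto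
  interpret h: ring_hom_ring R R h
    using assms by (intro ring_hom_ringI2 ring_axioms) (auto simp: is_sigma_def)
  have h_id: "h q = q" "h (e 1) = e 1" "h (g 2) = g 2"
    using assms n gens_in_A(1)[of 1] gens_in_A(2)[of 2] by (auto simp: is_sigma_def)
  have "(h \<circ> h') (e 2) = e 2 \<oplus> e 1 \<otimes> (p \<oplus> q)"
    using assms n R by (simp add: is_sigma_def h_id r_distr a_assoc)
  moreover have "(h \<circ> h') (g 1) = g 1 \<ominus> (p \<oplus> q) \<otimes> g 2"
    using assms n R by (simp add: is_sigma_def h_id l_distr minus_eq minus_add a_assoc)
  moreover have "h \<circ> h' \<in> ring_hom R R"
    using assms by (intro ring_hom_trans[of h' R R h R]) (auto simp: is_sigma_def)
  ultimately show ?thesis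
    using assms by (auto simp: is_sigma_def)
qed

lemma is_sigma_zero: "is_sigma \<zero> (\<lambda>x. x)"
  using n_ge_2 ring_iso_set_refl[of R] by (simp add: is_sigma_def ring_iso_def id_def minus_eq)

lemma is_sigma_bij:
  assumes "is_sigma p h" "p \<in> A"
  shows "bij_betw h (carrier R) (carrier R)"
proof -
  obtain h' where h': "is_sigma (\<ominus> p) h'" using is_sigma_exists assms by blast
  have "is_sigma \<zero> (h \<circ> h')" "is_sigma \<zero> (h' \<circ> h)"
    using is_sigma_comp[OF assms(1) h'] is_sigma_comp[OF h' assms(1)] assms A_carrier[of p]
    by (simp_all add: A_closed r_neg l_neg)
  then have "h (h' x) = x" "h' (h x) = x" if "x \<in> carrier R" for x
    using is_sigma_unique[of \<zero> "h \<circ> h'", OF _ is_sigma_zero that]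
      is_sigma_unique[of \<zero> "h' \<circ> h", OF _ is_sigma_zero that] by auto
  moreover have "h \<in> carrier R \<rightarrow> carrier R" "h' \<in> carrier R \<rightarrow> carrier R"
    using assms h' by (auto simp: is_sigma_def dest: ring_hom_closed)
  ultimately show ?thesis by (intro bij_betwI[of h _ _ h']) auto
qed

abbreviation "sig \<equiv> (sigma n :: 'k lpa \<Rightarrow> 'k lpa \<Rightarrow> 'k lpa)"

lemma sigma_is_sigma:
  assumes p: "p \<in> A"
  shows "is_sigma p (sig p)"
proof -
  obtain h where h: "is_sigma p h" using is_sigma_exists p by blast
  let ?P = "\<lambda>s. s \<in> extensional (carrier R) \<and> s \<in> alg_iso R sc R sc \<and>
     s (e 2) = e 2 \<oplus> e 1 \<otimes> p \<and> s (g 1) = g 1 \<ominus> p \<otimes> g 2 \<and> (\<forall>a\<in>A. s a = a)"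
  have P: "is_sigma p s" if "?P s" for s
    using that by (auto simp: is_sigma_def alg_iso_def ring_iso_def)
  have "?P (restrict h (carrier R))"
  proof -
    have "restrict h (carrier R) \<in> ring_iso R R"
      using ring_iso_restrict[of h R "restrict h (carrier R)"] h is_sigma_bij[OF h p]
      by (auto simp: ring_iso_def is_sigma_def)
    then show ?thesis
      using h n_ge_2 A_carrier by (auto simp: alg_iso_def is_sigma_def)
  qed
  moreover have "s = restrict h (carrier R)" if "?P s" for s
    using is_sigma_unique[OF P[OF that] h] that
    by (intro ext) (auto simp: extensional_def restrict_def)
  ultimately have "?P (THE s. ?P s)"
    by (rule theI)
  then show ?thesis
    using P by (simp add: sigma_def R_def)
qed

end

section \<open>A representation on functions of block sequences\<close>

definition vsmult :: "'a::field \<Rightarrow> ('b \<Rightarrow> 'a) \<Rightarrow> 'b \<Rightarrow> 'a" (infixr "*v" 75) where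
  "c *v y = (\<lambda>\<xi>. c * y \<xi>)"

text \<open>
  A sequence \<open>\<xi>\<close> of words encodes the infinite path \<open>\<xi> 0 e\<^sub>2 \<xi> 1 e\<^sub>2 \<xi> 2 e\<^sub>2 \<cdots>\<close>, and functions of \<open>\<xi>\<close>
  stand for formal combinations of these paths. The operators below are the pull-backs of prepending
  and removing a letter.
\<close>

fun vop :: "'a::field \<Rightarrow> gen \<Rightarrow> ((nat \<Rightarrow> nat list) \<Rightarrow> 'a) \<Rightarrow> (nat \<Rightarrow> nat list) \<Rightarrow> 'a" where
  "vop \<theta> Vertex y = y"
| "vop \<theta> (Edge i) y =
    (if i = 2 then (\<lambda>\<xi>. if \<xi> 0 = [] then \<theta> * y (\<lambda>j. \<xi> (Suc j)) else 0)
     else (\<lambda>\<xi>. case \<xi> 0 of [] \<Rightarrow> 0 | j # w \<Rightarrow> if j = i then y (\<xi>(0 := w)) else 0))"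
| "vop \<theta> (Ghost i) y =
    (if i = 2 then (\<lambda>\<xi>. y (case_nat [] \<xi>) / \<theta>) else (\<lambda>\<xi>. y (\<xi>(0 := i # \<xi> 0))))"

lemma vop_vsmult: "vop \<theta> a (c *v y) = c *v vop \<theta> a y"
  by (cases a) (auto simp: vsmult_def fun_eq_iff split: list.split)

lemma vop_add: "vop \<theta> a (y + y') = vop \<theta> a y + vop \<theta> a y'"
  by (cases a) (auto simp: fun_eq_iff algebra_simps add_divide_distrib split: list.split)

lemma free_action_vop:
  "free_action (\<lambda>k. vsmult (to_ac k)) (vop (\<theta> :: 'k::field alg_closure))"
proof
qed (simp_all add: vop_vsmult vop_add, simp_all add: vsmult_def fun_eq_iff algebra_simps)

interpretation vact: free_action "\<lambda>k. vsmult (to_ac k)" "vop (\<theta> :: 'k::field alg_closure)" for \<theta>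
  by (rule free_action_vop)

lemma vsmult_vsmult: "c *v d *v y = (c * d) *v y"
  and vsmult_add: "c *v (y + y') = c *v y + c *v y'"
  and vsmult_add_left: "(c + d) *v y = c *v y + d *v y"
  and vsmult_zero [simp]: "c *v 0 = 0" "0 *v y = 0"
  and vsmult_one [simp]: "1 *v y = y"
  and vsmult_apply: "(c *v y) \<xi> = c * y \<xi>"
  by (simp_all add: vsmult_def fun_eq_iff algebra_simps)

text \<open>Scalars of the closure commute with the action, not only those of K; eigenvalues such as
  \<theta> lie outside K in general.\<close>

lemma vact_vsmult:
  fixes \<theta> :: "'k::field alg_closure"
  shows "vact.act \<theta> x (c *v y) = c *v vact.act \<theta> x y"
proof -
  have *: "foldr (vop \<theta>) as (c *v y) = c *v foldr (vop \<theta>) as y" for as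
    by (induction as) (simp_all add: vop_vsmult)
  show ?thesis
    by (induction x rule: free_alg_induct)
      (simp_all only: vact.act_zero vsmult_zero vact.act_single vact.act_add * vsmult_vsmult
        vsmult_add mult.commute[of c])
qed

text \<open>\<open>v\<close> is the part of \<open>c\<close> before its final \<open>e 2\<close>. No
  polynomial is fixed yet: \<theta> only has to be invertible, since
  \<open>vop \<theta> (Ghost 2)\<close> divides by it.\<close>

locale leavitt_model = leavitt_rose n R
  for n and R :: "'k::field lpa ring" (structure) +
  fixes v :: "nat list" and \<theta> :: "'k alg_closure"
  assumes v: "set v \<subseteq> {1..n} - {2}" and \<theta>: "\<theta> \<noteq> 0"
begin

text \<open>This secures the relation for the sum of the \<open>e i \<otimes> g i\<close>: a
  sequence whose first block begins with 2, or with a letter outside \<open>{1..n}\<close>, is not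
  in the support of any \<open>vop \<theta> (Edge i) y\<close>,
  \<open>i \<in> {1..n}\<close>.\<close>

definition adm :: "(nat \<Rightarrow> nat list) \<Rightarrow> bool" where
  "adm \<xi> \<longleftrightarrow> (\<forall>i. set (\<xi> i) \<subseteq> {1..n} - {2})"

text \<open>A filtration by the block from which a path agrees with the periodic one;
  \<open>V 0\<close> is the line spanned by the indicator of the periodic path. Supports may be
  infinite, as nothing limits the lengths of the first \<open>k\<close> blocks.\<close>

definition V :: "nat \<Rightarrow> ((nat \<Rightarrow> nat list) \<Rightarrow> 'k alg_closure) set" where
  "V k = {y. \<forall>\<xi>. y \<xi> \<noteq> 0 \<longrightarrow> adm \<xi> \<and> (\<forall>i\<ge>k. \<xi> i = v)}"

definition W :: "((nat \<Rightarrow> nat list) \<Rightarrow> 'k alg_closure) set" where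
  "W = (\<Union>k. V k)"

lemma V_mono: "k \<le> l \<Longrightarrow> V k \<subseteq> V l"
  unfolding V_def by fastforce

lemma V_zero [simp]: "0 \<in> V k"
  by (simp add: V_def)

lemma V_add:
  assumes "y \<in> V k" "y' \<in> V k"
  shows "y + y' \<in> V k"
proof -
  have "y \<xi> \<noteq> 0 \<or> y' \<xi> \<noteq> 0" if "(y + y') \<xi> \<noteq> 0" for \<xi>
    using that by auto
  then show ?thesis using assms unfolding V_def by blast
qed

lemma V_vsmult: "y \<in> V k \<Longrightarrow> c *v y \<in> V k"
  unfolding V_def vsmult_def by fastforce

lemma V_uminus: "y \<in> V k \<Longrightarrow> - y \<in> V k"
  unfolding V_def by fastforce

lemma V_diff: "y \<in> V k \<Longrightarrow> y' \<in> V k \<Longrightarrow> y - y' \<in> V k"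
  using V_add[of y k "- y'"] V_uminus by simp

lemma V_W: "y \<in> V k \<Longrightarrow> y \<in> W"
  by (auto simp: W_def)

lemma W_zero [simp]: "0 \<in> W"
  using V_W[OF V_zero] .

lemma W_add: "y \<in> W \<Longrightarrow> y' \<in> W \<Longrightarrow> y + y' \<in> W"
proof -
  assume "y \<in> W" "y' \<in> W"
  then obtain k l where "y \<in> V k" "y' \<in> V l" by (auto simp: W_def)
  then have "y \<in> V (max k l)" "y' \<in> V (max k l)"
    using V_mono[of k "max k l"] V_mono[of l "max k l"] by auto
  then show ?thesis using V_add V_W by blast
qed

lemma W_vsmult: "y \<in> W \<Longrightarrow> c *v y \<in> W"
  using V_vsmult by (auto simp: W_def)

lemma W_adm: "y \<in> W \<Longrightarrow> y \<xi> \<noteq> 0 \<Longrightarrow> adm \<xi>"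
  by (auto simp: W_def V_def)

section \<open>Effect of the generators on the filtration\<close>

lemma vop_Edge_2_V: "y \<in> V k \<Longrightarrow> vop \<theta> (Edge 2) y \<in> V (Suc k)"
proof -
  assume y: "y \<in> V k"
  have "adm \<xi> \<and> (\<forall>i\<ge>Suc k. \<xi> i = v)"
    if "\<xi> 0 = []" "adm (\<lambda>j. \<xi> (Suc j))" "\<forall>i\<ge>k. \<xi> (Suc i) = v" for \<xi> :: "nat \<Rightarrow> nat list"
  proof -
    have "set (\<xi> i) \<subseteq> {1..n} - {2}" for i
      using that by (cases i) (auto simp: adm_def)
    moreover have "\<xi> i = v" if "i \<ge> Suc k" for i
      using \<open>\<forall>i\<ge>k. \<xi> (Suc i) = v\<close>[rule_format, of "i - 1"] that by simp
    ultimately show ?thesis by (simp add: adm_def)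
  qed
  then show ?thesis using y \<theta> by (auto simp: V_def split: if_splits)
qed

text \<open>For \<open>k = 0\<close> this fails: prepending a letter other than 2 changes the first
  block, which \<open>V 0\<close> prescribes. For \<open>k \<ge> 1\<close> the first block is
  free.\<close>

lemma vop_Edge_V:
  assumes "y \<in> V k" "k \<ge> 1" "i \<in> {1..n}" "i \<noteq> 2"
  shows "vop \<theta> (Edge i) y \<in> V k"
proof -
  have "adm \<xi> \<and> (\<forall>j\<ge>k. \<xi> j = v)"
    if "\<xi> 0 = i # w" "adm (\<xi>(0 := w))" "\<forall>j\<ge>k. (\<xi>(0 := w)) j = v" for \<xi> w
  proof -
    have *: "set ((\<xi>(0 := w)) j) \<subseteq> {1..n} - {2}" for j
      using that(2) unfolding adm_def by blast
    have "set (\<xi> j) \<subseteq> {1..n} - {2}" for j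
      using *[of 0] *[of j] that(1) assms by (cases "j = 0") auto
    moreover have "\<xi> j = v" if "j \<ge> k" for j
      using \<open>\<forall>j\<ge>k. (\<xi>(0 := w)) j = v\<close>[rule_format, OF that] that assms by simp
    ultimately show ?thesis by (simp add: adm_def)
  qed
  then show ?thesis using assms by (auto simp: V_def split: list.splits if_splits)
qed

lemma vop_Ghost_2_V: "y \<in> V k \<Longrightarrow> vop \<theta> (Ghost 2) y \<in> V k"
proof -
  assume y: "y \<in> V k"
  have "adm \<xi> \<and> (\<forall>i\<ge>k. \<xi> i = v)"
    if "adm (case_nat [] \<xi>)" "\<forall>i\<ge>k. case_nat [] \<xi> i = v" for \<xi> :: "nat \<Rightarrow> nat list"
  proof -
    have "set (\<xi> i) \<subseteq> {1..n} - {2}" for i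
      using that(1)[unfolded adm_def, rule_format, of "Suc i"] by simp
    moreover have "\<xi> i = v" if "i \<ge> k" for i
      using \<open>\<forall>i\<ge>k. case_nat [] \<xi> i = v\<close>[rule_format, of "Suc i"] that by simp
    ultimately show ?thesis by (simp add: adm_def)
  qed
  then show ?thesis using y by (auto simp: V_def)
qed

lemma vop_Ghost_V:
  assumes "y \<in> V k" "k \<ge> 1" "i \<noteq> 2"
  shows "vop \<theta> (Ghost i) y \<in> V k"
proof -
  have "adm \<xi> \<and> (\<forall>j\<ge>k. \<xi> j = v)"
    if "adm (\<xi>(0 := i # \<xi> 0))" "\<forall>j\<ge>k. (\<xi>(0 := i # \<xi> 0)) j = v" for \<xi>
  proof -
    have *: "set ((\<xi>(0 := i # \<xi> 0)) j) \<subseteq> {1..n} - {2}" for j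
      using that(1) unfolding adm_def by blast
    have "set (\<xi> j) \<subseteq> {1..n} - {2}" for j
      using *[of j] by (cases "j = 0") auto
    moreover have "\<xi> j = v" if "j \<ge> k" for j
      using \<open>\<forall>j\<ge>k. (\<xi>(0 := i # \<xi> 0)) j = v\<close>[rule_format, OF that] that assms by simp
    ultimately show ?thesis by (simp add: adm_def)
  qed
  then show ?thesis using assms by (auto simp: V_def)
qed

lemma vop_W: "y \<in> W \<Longrightarrow> a \<in> gens n \<Longrightarrow> vop \<theta> a y \<in> W"
proof -
  assume y: "y \<in> W" and a: "a \<in> gens n"
  then obtain k where "y \<in> V k" by (auto simp: W_def)
  then have k: "y \<in> V (Suc k)" using V_mono[of k "Suc k"] by auto
  show ?thesis
  proof (cases a)
    case Vertex
    then show ?thesis using y by simp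
  next
    case (Edge i)
    then show ?thesis
      using k a vop_Edge_2_V[OF k] vop_Edge_V[OF k, of i] by (cases "i = 2") (auto intro: V_W)
  next
    case (Ghost i)
    then show ?thesis
      using k vop_Ghost_2_V[OF k] vop_Ghost_V[OF k, of i] by (cases "i = 2") (auto intro: V_W)
  qed
qed

lemma vact_W:
  assumes "x \<in> carrier F" "y \<in> W"
  shows "vact.act \<theta> x y \<in> W"
proof -
  have *: "foldr (vop \<theta>) as y \<in> W" if "set as \<subseteq> gens n" for as
    using that assms(2) by (induction as) (auto intro: vop_W)
  have sum: "sum h S \<in> W" if "\<And>i. i \<in> S \<Longrightarrow> h i \<in> W"
    for S and h :: "word \<Rightarrow> (nat \<Rightarrow> nat list) \<Rightarrow> 'k alg_closure"
    using that by (induction S rule: infinite_finite_induct) (auto intro: W_add)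
  then show ?thesis
    using assms(1) unfolding vact.act_def carrier_free_algebra
    by (intro sum W_vsmult *) blast
qed

section \<open>The Leavitt relations and the action of the quotient algebra\<close>

lemma vop_Ghost_Edge:
  "vop \<theta> (Ghost i) (vop \<theta> (Edge j) y) = (if i = j then y else 0)"
proof
  show "vop \<theta> (Ghost i) (vop \<theta> (Edge j) y) \<xi> = (if i = j then y else 0) \<xi>" for \<xi>
    using \<theta> by (cases "i = 2"; cases "j = 2") simp_all
qed

lemma vop_sum_Edge_Ghost:
  assumes "y \<in> W"
  shows "(\<Sum>i\<in>{1..n}. vop \<theta> (Edge i) (vop \<theta> (Ghost i) y)) = y"
proof
  fix \<xi>
  have "(\<Sum>i\<in>{1..n}. vop \<theta> (Edge i) (vop \<theta> (Ghost i) y)) \<xi>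
      = (\<Sum>i\<in>{1..n}. vop \<theta> (Edge i) (vop \<theta> (Ghost i) y) \<xi>)"
    by (induction rule: infinite_finite_induct) auto
  also have "\<dots> = y \<xi>"
  proof (cases "\<xi> 0")
    case Nil
    have "case_nat [] (\<lambda>j. \<xi> (Suc j)) = \<xi>"
      using Nil by (auto simp: fun_eq_iff split: nat.split)
    then have "(\<Sum>i\<in>{1..n}. vop \<theta> (Edge i) (vop \<theta> (Ghost i) y) \<xi>)
        = (\<Sum>i\<in>{1..n}. if i = 2 then y \<xi> else 0)"
      using Nil \<theta> by (intro sum.cong) auto
    then show ?thesis using n_ge_2 by simp
  next
    case (Cons j w)
    have "\<xi>(0 := j # w) = \<xi>" using Cons by (simp add: fun_upd_idem)
    then have "(\<Sum>i\<in>{1..n}. vop \<theta> (Edge i) (vop \<theta> (Ghost i) y) \<xi>)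
        = (\<Sum>i\<in>{1..n}. if i = j then if j = 2 then 0 else y \<xi> else 0)"
      using Cons by (intro sum.cong) auto
    also have "\<dots> = (if j \<in> {1..n} - {2} then y \<xi> else 0)" by simp
    also have "\<dots> = y \<xi>"
    proof (cases "y \<xi> = 0")
      case False
      then have "set (\<xi> 0) \<subseteq> {1..n} - {2}"
        using W_adm[OF assms, of \<xi>] unfolding adm_def by blast
      then show ?thesis using Cons by simp
    qed simp
    finally show ?thesis .
  qed
  finally show "(\<Sum>i\<in>{1..n}. vop \<theta> (Edge i) (vop \<theta> (Ghost i) y)) \<xi> = y \<xi>" .
qed

text \<open>The elements killing all of \<open>W\<close> form a two-sided ideal, because
  \<open>W\<close> is stable under the action, and this ideal contains the relations.\<close>

lemma vact_lpa_ideal: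
  assumes "x \<in> lpa_ideal n" "y \<in> W"
  shows "vact.act \<theta> x y = 0"
proof -
  interpret F: ring F by (rule ring_free_algebra)
  let ?J = "{x \<in> carrier F. \<forall>y\<in>W. vact.act \<theta> x y = 0}"
  have "ideal ?J F"
  proof (rule idealI)
    show "subgroup ?J (add_monoid F)"
    proof (rule subgroup.intro)
      fix x assume "x \<in> ?J"
      then show "inv\<^bsub>add_monoid F\<^esub> x \<in> ?J"
        using free_algebra_a_inv[of x n] unfolding a_inv_def by (auto simp: vact.act_uminus)
    qed (auto simp: vact.act_add)
  qed (auto simp: ring_free_algebra vact.act_mult vact_W intro: vact.act_add_right[of \<theta> _ 0 0, simplified])
  moreover have "lpa_relations n \<subseteq> ?J"
  proof -
    have sum: "vact.act \<theta> (sum h S) y = (\<Sum>i\<in>S. vact.act \<theta> (h i) y)"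
      for h y and S :: "nat set"
      by (induction S rule: infinite_finite_induct) (simp_all add: vact.act_add)
    have "\<forall>y\<in>W. vact.act \<theta> x y = 0" if "x \<in> lpa_relations n" for x :: "'k free_alg"
      using that vop_Ghost_Edge vop_sum_Edge_Ghost unfolding lpa_relations_def
      by (auto simp: vact.act_diff vact.act_mult vact.act_gen sum simp del: vop.simps(2,3))
    then show ?thesis using lpa_relations_subset by blast
  qed
  ultimately show ?thesis using lpa_ideal_minimal[of ?J] assms by blast
qed

text \<open>Some representative of the class is applied; by \<open>ap_cl\<close> the choice does not
  matter on \<open>W\<close>.\<close>

definition ap :: "'k lpa \<Rightarrow> ((nat \<Rightarrow> nat list) \<Rightarrow> 'k alg_closure) \<Rightarrow> (nat \<Rightarrow> nat list) \<Rightarrow> 'k alg_closure"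
  (infixr "\<cdot>" 75)
  where "x \<cdot> y = vact.act \<theta> (SOME u. u \<in> carrier F \<and> cl u = x) y"

lemma ap_cl:
  assumes "u \<in> carrier F" "y \<in> W"
  shows "cl u \<cdot> y = vact.act \<theta> u y"
proof -
  define w where "w = (SOME w. w \<in> carrier F \<and> cl w = cl u)"
  have w: "w \<in> carrier F" "cl w = cl u"
    using someI[of "\<lambda>w. w \<in> carrier F \<and> cl w = cl u" u] assms by (auto simp: w_def)
  then have "w - u \<in> lpa_ideal n" using lpa_class_eq_iff assms by blast
  then have "vact.act \<theta> (w - u) y = 0" using vact_lpa_ideal assms by blast
  then show ?thesis by (simp add: ap_def vact.act_diff flip: w_def)
qed

lemma ap_closed [intro, simp]: "x \<in> carrier R \<Longrightarrow> y \<in> W \<Longrightarrow> x \<cdot> y \<in> W"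
  by (auto simp: carrier_R ap_cl vact_W)

lemma ap_add_left: "x \<in> carrier R \<Longrightarrow> x' \<in> carrier R \<Longrightarrow> y \<in> W \<Longrightarrow> (x \<oplus> x') \<cdot> y = x \<cdot> y + x' \<cdot> y"
  by (auto simp: carrier_R ap_cl vact.act_add simp flip: cl_add)

lemma ap_mult: "x \<in> carrier R \<Longrightarrow> x' \<in> carrier R \<Longrightarrow> y \<in> W \<Longrightarrow> (x \<otimes> x') \<cdot> y = x \<cdot> x' \<cdot> y"
  by (auto simp: carrier_R ap_cl vact.act_mult vact_W simp flip: cl_mult)

lemma ap_uminus: "x \<in> carrier R \<Longrightarrow> y \<in> W \<Longrightarrow> (\<ominus> x) \<cdot> y = - (x \<cdot> y)"
  by (auto simp: carrier_R ap_cl vact.act_uminus simp flip: cl_uminus)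

lemma ap_diff: "x \<in> carrier R \<Longrightarrow> x' \<in> carrier R \<Longrightarrow> y \<in> W \<Longrightarrow> (x \<ominus> x') \<cdot> y = x \<cdot> y - x' \<cdot> y"
  by (simp add: minus_eq ap_add_left ap_uminus)

lemma ap_one [simp]: "y \<in> W \<Longrightarrow> \<one> \<cdot> y = y"
  using ap_cl[of 1 y] by (simp add: cl_one)

lemma ap_zero_left [simp]: "y \<in> W \<Longrightarrow> \<zero> \<cdot> y = 0"
  using ap_cl[of 0 y] by (simp add: cl_zero)

lemma ap_scal: "y \<in> W \<Longrightarrow> sc k \<cdot> y = to_ac k *v y"
  using ap_cl[of "Poly_Mapping.single 0 k" y] by (simp add: scal_def vact.act_single)

lemma ap_edge: "i \<in> {1..n} \<Longrightarrow> y \<in> W \<Longrightarrow> e i \<cdot> y = vop \<theta> (Edge i) y"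
  using ap_cl[of "free_gen (Edge i)" y] by (simp add: edge_def vact.act_gen del: vop.simps)

lemma ap_ghost: "i \<in> {1..n} \<Longrightarrow> y \<in> W \<Longrightarrow> g i \<cdot> y = vop \<theta> (Ghost i) y"
  using ap_cl[of "free_gen (Ghost i)" y] by (simp add: ghost_def vact.act_gen del: vop.simps)

lemma ap_add_right: "x \<cdot> (y + y') = x \<cdot> y + x \<cdot> y'"
  by (simp add: ap_def vact.act_add_right)

lemma ap_vsmult: "x \<cdot> (c *v y) = c *v (x \<cdot> y)"
  by (simp add: ap_def vact_vsmult)

lemma ap_zero_right [simp]: "x \<cdot> 0 = 0"
  using ap_add_right[of x 0 0] by simp

text \<open>Only \<open>e 2\<close> can leave \<open>V k\<close> when \<open>k \<ge> 1\<close>, and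
  it is not among the generators of \<open>A\<close>.\<close>

lemma A_ap_V:
  assumes "x \<in> A" "k \<ge> 1" "y \<in> V k"
  shows "x \<cdot> y \<in> V k"
  using assms(1,3)
proof (induction x arbitrary: y rule: A_induct)
  case (scal k)
  then show ?case by (simp add: ap_scal V_W V_vsmult)
next
  case (edge i)
  then show ?case using assms(2) vop_Edge_V by (simp add: ap_edge V_W del: vop.simps)
next
  case (ghost i)
  then show ?case using assms(2) vop_Ghost_V vop_Ghost_2_V
    by (cases "i = 2") (simp_all add: ap_ghost V_W del: vop.simps)
next
  case (uminus x)
  then show ?case using V_uminus[of "x \<cdot> y" k] ap_uminus[of x y] A_carrier[of x] V_W by metis
next
  case (add x x')
  then have "(x \<oplus> x') \<cdot> y = x \<cdot> y + x' \<cdot> y"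
    by (intro ap_add_left) (auto intro: A_carrier V_W)
  then show ?case using V_add[of "x \<cdot> y" k "x' \<cdot> y"] add by metis
next
  case (mult x x')
  then show ?case by (simp add: ap_mult V_W A_carrier)
qed

end

section \<open>Polynomial evaluation\<close>

text \<open>A nonzero element of least degree in the ideal generated by \<open>f\<close> and
  \<open>h\<close> divides both, by division with remainder, and irreducibility of \<open>f\<close>
  makes it a unit.\<close>

lemma irreducible_bezout:
  fixes f h :: "'k::field poly"
  assumes "comm_semiring_1_class.irreducible f" "\<not> f dvd h"
  obtains s t where "s * f + t * h = 1"
proof -
  define S where "S = {s * f + t * h | s t. True}"
  have "f = 1 * f + 0 * h" by simp
  then have "f \<in> S" unfolding S_def by blast
  moreover have "f \<noteq> 0" using assms by auto
  ultimately have "\<exists>m. m \<in> S \<and> m \<noteq> 0" by blast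
  then obtain m where m: "m \<in> S" "m \<noteq> 0"
    and min: "\<And>m'. m' \<in> S \<Longrightarrow> m' \<noteq> 0 \<Longrightarrow> Polynomial.degree m \<le> Polynomial.degree m'"
    using exists_least_lemma[of "\<lambda>k. \<exists>m. m \<in> S \<and> m \<noteq> 0 \<and> Polynomial.degree m = k"]
      ex_has_least_nat[of "\<lambda>m. m \<in> S \<and> m \<noteq> 0" _ Polynomial.degree] by metis
  obtain s t where st: "m = s * f + t * h" using m(1) by (auto simp: S_def)
  have "m dvd x" if x: "x \<in> S" for x
  proof (rule ccontr)
    assume "\<not> m dvd x"
    then have "x mod m \<noteq> 0" by (simp add: dvd_eq_mod_eq_0)
    moreover obtain s' t' where "x = s' * f + t' * h" using x by (auto simp: S_def)
    then have "x mod m = (s' - x div m * s) * f + (t' - x div m * t) * h"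
      using minus_div_mult_eq_mod[of x m] st by (simp add: algebra_simps)
    then have "x mod m \<in> S" unfolding S_def by blast
    ultimately show False
      using min[of "x mod m"] degree_mod_less[of m x] m(2) by auto
  qed
  moreover have "h = 0 * f + 1 * h" by simp
  then have "h \<in> S" unfolding S_def by blast
  ultimately have dvd: "m dvd f" "m dvd h" using \<open>f \<in> S\<close> by auto
  from dvd(1) obtain u where u: "f = m * u" by (auto simp: dvd_def)
  \<comment> \<open>If the cofactor \<open>u\<close> were a unit, \<open>m\<close> would be
    associated to \<open>f\<close>, and \<open>f\<close> would divide \<open>h\<close>.\<close>
  have "\<not> u dvd 1"
  proof
    assume "u dvd 1"
    then have "f dvd m" using u by (simp add: mult_unit_dvd_iff)
    then show False using dvd(2) assms(2) dvd_trans by blast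
  qed
  then have "m dvd 1" using assms(1) u unfolding comm_semiring_1_class.irreducible_def by blast
  then obtain w where "1 = m * w" by (auto simp: dvd_def)
  then have "(w * s) * f + (w * t) * h = 1" using st by (simp add: algebra_simps)
  then show ?thesis using that by blast
qed

abbreviation peval :: "'k::field poly \<Rightarrow> 'k alg_closure \<Rightarrow> 'k alg_closure" where
  "peval h \<theta> \<equiv> poly (map_poly to_ac h) \<theta>"

lemma peval_pCons: "peval (pCons a h) \<theta> = to_ac a + \<theta> * peval h \<theta>"
  by (simp add: map_poly_pCons)

lemma peval_add: "peval (h + h') \<theta> = peval h \<theta> + peval h' \<theta>"
  by (induction h h' rule: poly_induct2) (simp_all add: map_poly_pCons algebra_simps)

lemma peval_smult: "peval (Polynomial.smult a h) \<theta> = to_ac a * peval h \<theta>"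
  by (induction h) (simp_all add: map_poly_pCons algebra_simps)

lemma peval_mult: "peval (h * h') \<theta> = peval h \<theta> * peval h' \<theta>"
  by (induction h)
    (simp_all only: mult_zero_left mult_pCons_left peval_add peval_smult peval_pCons to_ac_0
      map_poly_0 poly_0 distrib_right add_0_left mult.assoc)

lemma peval_one: "peval 1 \<theta> = 1"
  by (simp add: one_pCons map_poly_pCons)

text \<open>Up to a unit \<open>f\<close> is the minimal polynomial of \<theta> over K: by Bezout, a
  polynomial that \<open>f\<close> does not divide cannot vanish at \<theta>.\<close>

lemma irreducible_dvd_iff_root:
  assumes "comm_semiring_1_class.irreducible f" "peval f \<theta> = 0"
  shows "f dvd h \<longleftrightarrow> peval h \<theta> = 0"
proof
  assume "f dvd h"
  then show "peval h \<theta> = 0" using assms by (auto simp: dvd_def peval_mult)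
next
  assume h: "peval h \<theta> = 0"
  show "f dvd h"
  proof (rule ccontr)
    assume "\<not> f dvd h"
    then obtain s t where "s * f + t * h = 1" using irreducible_bezout assms by blast
    then have "peval (s * f + t * h) \<theta> = 1" by (simp add: peval_one)
    then show False using assms h by (simp add: peval_add peval_mult)
  qed
qed

lemma Irr_root:
  assumes "f \<in> Irr"
  obtains \<theta> where "peval f \<theta> = 0" "\<theta> \<noteq> 0"
proof -
  have f: "f \<noteq> 0" "\<not> f dvd 1" "poly.coeff f 0 = 1"
    using assms by (auto simp: Irr_def comm_semiring_1_class.irreducible_def)
  have "Polynomial.degree f > 0"
    using f is_unit_iff_degree[of f] by simp
  then have "Polynomial.degree (map_poly to_ac f) > 0"
    by (subst degree_map_poly) auto
  then obtain \<theta> where \<theta>: "peval f \<theta> = 0"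
    using alg_closed_imp_poly_has_root by blast
  obtain a h where ah: "f = pCons a h" by (cases f)
  have "\<theta> \<noteq> 0"
  proof
    assume "\<theta> = 0"
    then show False using \<theta> f(3) ah by (simp add: map_poly_pCons)
  qed
  then show ?thesis using that \<theta> by blast
qed

section \<open>Evaluating polynomials and paths in the algebra\<close>

context leavitt_rose
begin

abbreviation "ev \<equiv> (lpa_eval n :: 'k poly \<Rightarrow> 'k lpa \<Rightarrow> 'k lpa)"

lemma ev_def: "ev h x = (\<Oplus>i\<in>{..Polynomial.degree h}. sc (poly.coeff h i) \<otimes> x [^] i)"
  by (simp add: lpa_eval_def R_def)

lemma ev_bound:
  assumes "x \<in> carrier R" "Polynomial.degree h \<le> m"
  shows "ev h x = (\<Oplus>i\<in>{..m}. sc (poly.coeff h i) \<otimes> x [^] i)"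
  unfolding ev_def
  using assms
  by (intro add.finprod_mono_neutral_cong_left)
    (auto simp: coeff_eq_0 scal_zero)

lemma ev_closed [simp, intro]: "x \<in> carrier R \<Longrightarrow> ev h x \<in> carrier R"
  unfolding ev_def by (intro finsum_closed) auto

lemma ev_zero [simp]: "x \<in> carrier R \<Longrightarrow> ev 0 x = \<zero>"
  by (simp add: ev_def scal_zero)

text \<open>Horner's rule, valid because scalars are central. The further facts about
  \<open>ev\<close> are inductions over \<open>pCons\<close> based on it.\<close>

lemma ev_pCons:
  assumes x: "x \<in> carrier R"
  shows "ev (pCons a h) x = sc a \<oplus> x \<otimes> ev h x"
proof -
  let ?m = "Polynomial.degree h"
  have "ev (pCons a h) x
      = (\<Oplus>i\<in>{..Suc ?m}. sc (poly.coeff (pCons a h) i) \<otimes> x [^] i)"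
    using x by (intro ev_bound degree_pCons_le)
  also have "\<dots> = (\<Oplus>i\<in>{..?m}. sc (poly.coeff h i) \<otimes> x [^] Suc i) \<oplus> sc a"
    using x by (subst finsum_Suc2) auto
  also have "(\<Oplus>i\<in>{..?m}. sc (poly.coeff h i) \<otimes> x [^] Suc i)
      = (\<Oplus>i\<in>{..?m}. x \<otimes> (sc (poly.coeff h i) \<otimes> x [^] i))"
  proof (rule add.finprod_cong')
    fix i
    have "sc (poly.coeff h i) \<otimes> x [^] Suc i = sc (poly.coeff h i) \<otimes> (x \<otimes> x [^] i)"
      using x by (simp only: nat_pow_Suc2)
    also have "\<dots> = x \<otimes> (sc (poly.coeff h i) \<otimes> x [^] i)"
      using x scal_commute[of x "poly.coeff h i"] by (simp add: m_assoc[symmetric])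
    finally show "sc (poly.coeff h i) \<otimes> x [^] Suc i = x \<otimes> (sc (poly.coeff h i) \<otimes> x [^] i)" .
  qed (use x in auto)
  also have "\<dots> = x \<otimes> ev h x"
    unfolding ev_def using x by (intro finsum_rdistr[symmetric]) auto
  finally show ?thesis using x by (simp add: a_comm)
qed

lemma ev_add:
  assumes x: "x \<in> carrier R"
  shows "ev (h + h') x = ev h x \<oplus> ev h' x"
proof (induction h h' rule: poly_induct2)
  case (pCons a h b h')
  then show ?case using x by (simp add: ev_pCons scal_add r_distr a_ac)
qed (use x in simp)

lemma ev_smult:
  assumes x: "x \<in> carrier R"
  shows "ev (Polynomial.smult a h) x = sc a \<otimes> ev h x"
proof (induction h)
  case (pCons b h)
  have "sc a \<otimes> (x \<otimes> ev h x) = x \<otimes> (sc a \<otimes> ev h x)"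
    using x scal_commute[of x a] by (simp add: m_assoc[symmetric])
  then show ?case using pCons x by (simp add: ev_pCons scal_mult r_distr)
qed (use x in simp)

lemma ev_mult:
  assumes x: "x \<in> carrier R"
  shows "ev (h * h') x = ev h x \<otimes> ev h' x"
proof (induction h)
  case (pCons b h)
  then show ?case
    using x by (simp add: ev_add ev_smult ev_pCons scal_zero l_distr m_assoc)
qed (use x in simp)

lemma ev_one: "x \<in> carrier R \<Longrightarrow> ev 1 x = \<one>"
  by (simp add: one_pCons ev_pCons scal_one)

lemma ev_hom:
  assumes "s \<in> ring_hom R R" "\<And>k. s (sc k) = sc k" and x: "x \<in> carrier R"
  shows "s (ev h x) = ev h (s x)"
proof -
  interpret s: ring_hom_ring R R s
    by (intro ring_hom_ringI2 ring_axioms assms)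
  show ?thesis
    using x by (induction h) (simp_all add: ev_pCons assms(2))
qed

text \<open>Used to pass between a product of paths \<open>u w\<close> and its rotation
  \<open>w u\<close>, as w (u w) = (w u) w, and with \<open>x = x'\<close> to commute an element
  past a polynomial in it.\<close>

lemma ev_intertwine:
  assumes "x \<in> carrier R" "x' \<in> carrier R" "y \<in> carrier R" "y \<otimes> x = x' \<otimes> y"
  shows "y \<otimes> ev h x = ev h x' \<otimes> y"
proof (induction h)
  case (pCons a h)
  have "y \<otimes> (x \<otimes> ev h x) = x' \<otimes> (y \<otimes> ev h x)"
    using assms by (simp add: m_assoc[symmetric])
  then show ?case
    using assms pCons scal_commute[of y a] by (simp add: ev_pCons r_distr l_distr m_assoc)
qed (use assms in simp)

lemma path_elem_Nil [simp]: "path_elem n [] = \<one>"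
  by (simp add: path_elem_def R_def)

lemma path_elem_Cons [simp]: "path_elem n (i # w) = e i \<otimes> path_elem n w"
  by (simp add: path_elem_def R_def)

abbreviation "pe \<equiv> (path_elem n :: nat list \<Rightarrow> 'k lpa)"

lemma path_closed [simp, intro]: "set w \<subseteq> {1..n} \<Longrightarrow> pe w \<in> carrier R"
  by (induction w) auto

lemma path_append: "set w \<subseteq> {1..n} \<Longrightarrow> set w' \<subseteq> {1..n} \<Longrightarrow> pe (w @ w') = pe w \<otimes> pe w'"
  by (induction w) (auto simp: m_assoc)

lemma path_in_A: "set w \<subseteq> {1..n} - {2} \<Longrightarrow> pe w \<in> A"
proof (induction w)
  case Nil
  show ?case using subringE(3)[OF A_subring] by simp
next
  case (Cons i w)
  then show ?case using subringE(6)[OF A_subring] gens_in_A(1)[of i] by auto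
qed

end

section \<open>The module as a submodule of the representation\<close>

locale leavitt_irr = leavitt_model n R v \<theta>
  for n and R :: "'k::field lpa ring" (structure) and v \<theta> +
  fixes f :: "'k poly"
  assumes f: "f \<in> Defs.Irr" and root: "peval f \<theta> = 0"
begin

lemma f_irr: "comm_semiring_1_class.irreducible f" and f_0: "poly.coeff f 0 = 1"
  using f by (auto simp: Defs.Irr_def)

definition c :: "nat list" where "c = v @ [2]"

definition z :: "(nat \<Rightarrow> nat list) \<Rightarrow> 'k alg_closure" where
  "z = (\<lambda>\<xi>. if \<xi> = (\<lambda>_. v) then 1 else 0)"

lemma set_c: "set c \<subseteq> {1..n}"
  using v n_ge_2 by (auto simp: c_def)

lemma C_closed [simp, intro]: "pe c \<in> carrier R"
  using set_c by auto

lemma z_V: "z \<in> V 0"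
  using v by (auto simp: z_def V_def adm_def)

lemma z_W [simp, intro]: "z \<in> W"
  using z_V V_W by blast

lemma z_neq_0: "z \<noteq> 0"
proof
  assume "z = 0"
  then have "z (\<lambda>_. v) = 0" by simp
  then show False by (simp add: z_def)
qed

lemma V_0_eq:
  assumes "y \<in> V 0"
  shows "y = y (\<lambda>_. v) *v z"
proof
  fix \<xi>
  show "y \<xi> = (y (\<lambda>_. v) *v z) \<xi>"
  proof (cases "\<xi> = (\<lambda>_. v)")
    case False
    then have "y \<xi> = 0" using assms by (fastforce simp: V_def)
    then show ?thesis using False by (simp add: vsmult_def z_def)
  qed (simp add: vsmult_def z_def)
qed

lemma ap_path:
  assumes "set w \<subseteq> {1..n} - {2}" "y \<in> W"
  shows "pe w \<cdot> y
    = (\<lambda>\<xi>. if take (length w) (\<xi> 0) = w then y (\<xi>(0 := drop (length w) (\<xi> 0))) else 0)"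
  using assms(1)
proof (induction w)
  case Nil
  then show ?case using assms by simp
next
  case (Cons i w)
  then have i: "i \<in> {1..n}" "i \<noteq> 2" "set w \<subseteq> {1..n}" by auto
  then have "pe (i # w) \<cdot> y = vop \<theta> (Edge i) (pe w \<cdot> y)"
    using assms(2) by (simp add: ap_mult ap_edge del: vop.simps)
  then show ?case
    using Cons i by (auto simp: fun_eq_iff split: list.split)
qed

lemma ap_path_block:
  assumes "set w \<subseteq> {1..n} - {2}" "y \<in> W"
  shows "pe (w @ [2]) \<cdot> y = (\<lambda>\<xi>. if \<xi> 0 = w then \<theta> * y (\<lambda>j. \<xi> (Suc j)) else 0)"
proof -
  have 2: "2 \<in> {1..n}" using n_ge_2 by auto
  have w: "set w \<subseteq> {1..n}" using assms by auto
  have "pe (w @ [2]) = pe w \<otimes> e 2"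
    using w 2 by (simp add: path_append)
  then have "pe (w @ [2]) \<cdot> y = pe w \<cdot> vop \<theta> (Edge 2) y"
    using ap_edge[OF 2 assms(2)] ap_mult[of "pe w" "e 2" y] w 2 assms(2) by simp
  also have "\<dots> = (\<lambda>\<xi>. if take (length w) (\<xi> 0) = w
      then vop \<theta> (Edge 2) y (\<xi>(0 := drop (length w) (\<xi> 0))) else 0)"
    using assms vop_W[OF assms(2), of "Edge 2"] 2 by (intro ap_path) auto
  also have "\<dots> = (\<lambda>\<xi>. if \<xi> 0 = w then \<theta> * y (\<lambda>j. \<xi> (Suc j)) else 0)"
  proof
    fix \<xi> :: "nat \<Rightarrow> nat list"
    have "\<xi> 0 = w \<longleftrightarrow> take (length w) (\<xi> 0) = w \<and> drop (length w) (\<xi> 0) = []"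
      by (metis append_Nil2 append_take_drop_id drop_all order_refl take_all)
    then show "(if take (length w) (\<xi> 0) = w
        then vop \<theta> (Edge 2) y (\<xi>(0 := drop (length w) (\<xi> 0))) else 0) =
      (if \<xi> 0 = w then \<theta> * y (\<lambda>j. \<xi> (Suc j)) else 0)"
      by simp
  qed
  finally show ?thesis .
qed

lemma const_shift:
  "\<xi> = (\<lambda>_. a) \<longleftrightarrow> \<xi> 0 = a \<and> (\<lambda>j. \<xi> (Suc j)) = (\<lambda>_. a)" for \<xi> :: "nat \<Rightarrow> 'x"
proof
  assume *: "\<xi> 0 = a \<and> (\<lambda>j. \<xi> (Suc j)) = (\<lambda>_. a)"
  have "\<xi> i = a" for i
    using * fun_cong[of "\<lambda>j. \<xi> (Suc j)" "\<lambda>_. a" "i - 1"] by (cases i) auto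
  then show "\<xi> = (\<lambda>_. a)" by auto
qed auto

lemma ap_C_z: "pe c \<cdot> z = \<theta> *v z"
proof
  fix \<xi>
  have "(pe c \<cdot> z) \<xi> = (if \<xi> 0 = v then \<theta> * z (\<lambda>j. \<xi> (Suc j)) else 0)"
    unfolding c_def ap_path_block[OF v z_W] ..
  then show "(pe c \<cdot> z) \<xi> = (\<theta> *v z) \<xi>"
    by (simp add: vsmult_apply z_def const_shift[of \<xi> v])
qed

lemma ap_ev_eigen:
  assumes "x \<in> carrier R" "y \<in> W" "x \<cdot> y = \<mu> *v y"
  shows "ev h x \<cdot> y = peval h \<mu> *v y"
proof (induction h)
  case 0
  then show ?case using assms by simp
next
  case (pCons a h)
  have "ev (pCons a h) x \<cdot> y = to_ac a *v y + x \<cdot> (ev h x \<cdot> y)"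
    using assms by (simp add: ev_pCons ap_add_left ap_scal ap_mult)
  also have "\<dots> = to_ac a *v y + peval h \<mu> *v (\<mu> *v y)"
    using pCons assms by (simp add: ap_vsmult)
  also have "\<dots> = peval (pCons a h) \<mu> *v y"
    by (simp add: peval_pCons vsmult_vsmult vsmult_add_left mult.commute)
  finally show ?case .
qed

lemma ap_ev_z: "ev h (pe c) \<cdot> z = peval h \<theta> *v z"
  by (intro ap_ev_eigen ap_C_z) auto

end

context ring
begin

lemma PIdl_mem: "x \<in> PIdl a \<longleftrightarrow> (\<exists>r\<in>carrier R. x = r \<otimes> a)"
  by (auto simp: cgenideal_def)

lemma PIdl_closed:
  assumes "a \<in> carrier R"
  shows "x \<in> PIdl a \<Longrightarrow> x \<in> carrier R"
    and "\<zero> \<in> PIdl a"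
    and "x \<in> PIdl a \<Longrightarrow> y \<in> PIdl a \<Longrightarrow> x \<oplus> y \<in> PIdl a"
    and "x \<in> PIdl a \<Longrightarrow> \<ominus> x \<in> PIdl a"
    and "r \<in> carrier R \<Longrightarrow> x \<in> PIdl a \<Longrightarrow> r \<otimes> x \<in> PIdl a"
    and "x \<in> PIdl a \<Longrightarrow> y \<in> PIdl a \<Longrightarrow> x \<ominus> y \<in> PIdl a"
proof -
  show 1: "x \<in> PIdl a \<Longrightarrow> y \<in> PIdl a \<Longrightarrow> x \<oplus> y \<in> PIdl a" for x y
    using assms unfolding PIdl_mem by (metis a_closed l_distr)
  show 2: "x \<in> PIdl a \<Longrightarrow> \<ominus> x \<in> PIdl a" for x
    using assms unfolding PIdl_mem by (metis a_inv_closed l_minus)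
  show "x \<in> PIdl a \<Longrightarrow> y \<in> PIdl a \<Longrightarrow> x \<ominus> y \<in> PIdl a"
    using 1 2 by (simp add: minus_eq)
  show "\<zero> \<in> PIdl a"
    using assms unfolding PIdl_mem by (metis l_null zero_closed)
  show "r \<in> carrier R \<Longrightarrow> x \<in> PIdl a \<Longrightarrow> r \<otimes> x \<in> PIdl a"
    using assms unfolding PIdl_mem by (metis m_assoc m_closed)
qed (use assms in \<open>auto simp: PIdl_mem\<close>)

lemma minus_add_minus:
  assumes "x \<in> carrier R" "y \<in> carrier R" "a \<in> carrier R" "b \<in> carrier R"
  shows "(x \<oplus> y) \<ominus> (a \<oplus> b) = (x \<ominus> a) \<oplus> (y \<ominus> b)"
  using assms by (simp add: minus_eq minus_add a_ac)

lemma mult_minus_distrib: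
  assumes "x \<in> carrier R" "y \<in> carrier R" "r \<in> carrier R"
  shows "r \<otimes> (x \<ominus> y) = r \<otimes> x \<ominus> r \<otimes> y" "(x \<ominus> y) \<otimes> r = x \<otimes> r \<ominus> y \<otimes> r"
  using assms by (simp_all add: minus_eq r_distr r_minus l_distr l_minus)

end

section \<open>The annihilator of the periodic path\<close>

context leavitt_irr
begin

abbreviation "E h \<equiv> ev h (pe c)"
abbreviation "J \<equiv> PIdl (E f)"

lemmas J_closed = PIdl_closed[OF ev_closed[OF C_closed, of f]]

lemma E_J: "f dvd h \<Longrightarrow> E h \<in> J"
proof -
  assume "f dvd h"
  then obtain q where "h = q * f" by (auto simp: dvd_def mult.commute)
  then have "E h = E q \<otimes> E f" by (simp add: ev_mult)
  then show ?thesis by (auto simp: PIdl_mem)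
qed

text \<open>As f(0) = 1, the polynomial \<open>q\<close> inverts x modulo f. It provides 1 /
  \<theta> as a value of a polynomial over K and lets a path be cancelled modulo f of that
  path.\<close>

lemma f_split: obtains q where "f = pCons 1 (- q)" "\<theta> * peval q \<theta> = 1"
proof -
  obtain a q where q: "f = pCons a q" by (cases f)
  then have a: "a = 1" using f_0 by simp
  have "peval (- q) \<theta> = - peval q \<theta>"
    using peval_add[of "- q" q \<theta>] by (simp add: eq_neg_iff_add_eq_0)
  moreover have "\<theta> * peval q \<theta> = - 1"
    using root q a by (simp add: peval_pCons eq_neg_iff_add_eq_0 add.commute)
  ultimately have "\<theta> * peval (- q) \<theta> = 1" by simp
  then show ?thesis using that[of "- q"] q a by simp
qed

lemma ap_J: "x \<in> J \<Longrightarrow> x \<cdot> z = 0"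
  using root by (auto simp: PIdl_mem ap_mult ap_ev_z)

definition u :: "nat \<Rightarrow> 'k lpa" where "u j = pe (drop j c)"

text \<open>The range \<open>j < length c\<close> leaves out the empty suffix: it and the full
  suffix \<open>u 0\<close> would send \<open>z\<close> to multiples of the same path.\<close>

definition comb :: "(nat \<Rightarrow> 'k poly) \<Rightarrow> 'k lpa" where
  "comb h = (\<Oplus>j\<in>{..<length c}. u j \<otimes> E (h j))"

text \<open>
  To see that the annihilator of \<open>z\<close> is no larger than \<open>J\<close>, strip a long path from an element \<open>x\<close>: the
  result is, modulo \<open>J\<close>, a combination of nonempty suffixes of \<open>c\<close> with coefficients in \<open>K[c]\<close>. These
  suffixes send \<open>z\<close> to multiples of distinct paths, so the combination lies in \<open>J\<close> as soon as it
  kills \<open>z\<close>, and \<open>x\<close> is recovered from its stripped versions by \<open>\<Sum> e\<^sub>i e\<^sub>i\<^sup>* = 1\<close>.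
\<close>

definition U :: "'k lpa set" where
  "U = {x \<in> carrier R. \<exists>h. x \<ominus> comb h \<in> J}"

lemma u_closed [simp, intro]: "u j \<in> carrier R"
  unfolding u_def using set_c set_drop_subset[of j c] by (intro path_closed) auto

lemma comb_closed [simp, intro]: "comb h \<in> carrier R"
  unfolding comb_def by (intro finsum_closed) auto

lemma U_carrier: "x \<in> U \<Longrightarrow> x \<in> carrier R"
  by (simp add: U_def)

lemma comb_add: "comb (\<lambda>j. h j + h' j) = comb h \<oplus> comb h'"
proof -
  have "comb (\<lambda>j. h j + h' j) = (\<Oplus>j\<in>{..<length c}. u j \<otimes> E (h j) \<oplus> u j \<otimes> E (h' j))"
    unfolding comb_def by (rule add.finprod_cong') (auto simp: ev_add r_distr)
  also have "\<dots> = comb h \<oplus> comb h'"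
    unfolding comb_def by (intro finsum_addf) auto
  finally show ?thesis .
qed

lemma comb_single:
  assumes "j < length c"
  shows "comb (\<lambda>i. if j = i then h else 0) = u j \<otimes> E h"
proof -
  have "comb (\<lambda>i. if j = i then h else 0)
      = (\<Oplus>i\<in>{..<length c}. if j = i then u i \<otimes> E h else \<zero>)"
    unfolding comb_def by (rule add.finprod_cong') auto
  also have "\<dots> = u j \<otimes> E h"
    using assms by (intro finsum_singleton) auto
  finally show ?thesis .
qed

lemma U_add:
  assumes "x \<in> U" "y \<in> U"
  shows "x \<oplus> y \<in> U"
proof -
  obtain h h' where h: "x \<ominus> comb h \<in> J" "y \<ominus> comb h' \<in> J" using assms by (auto simp: U_def)
  have "(x \<oplus> y) \<ominus> comb (\<lambda>j. h j + h' j) = (x \<ominus> comb h) \<oplus> (y \<ominus> comb h')"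
    using assms by (simp add: comb_add minus_add_minus U_carrier)
  also have "\<dots> \<in> J" using h by (rule J_closed)
  finally show ?thesis using assms unfolding U_def by auto
qed

lemma U_single: "j < length c \<Longrightarrow> u j \<otimes> E h \<in> U"
proof -
  assume "j < length c"
  then have "u j \<otimes> E h \<ominus> comb (\<lambda>i. if j = i then h else 0) = \<zero>"
    by (simp add: comb_single minus_eq r_neg)
  then have "u j \<otimes> E h \<ominus> comb (\<lambda>i. if j = i then h else 0) \<in> J"
    using J_closed(2) by metis
  then show ?thesis unfolding U_def by blast
qed

lemma J_subset_U: "x \<in> J \<Longrightarrow> x \<in> U"
proof -
  assume x: "x \<in> J"
  have "comb (\<lambda>_. 0) = \<zero>"
    unfolding comb_def by (simp add: add.finprod_one_eqI)
  then have "x \<ominus> comb (\<lambda>_. 0) = x" using J_closed(1)[OF x] by (simp add: minus_eq)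
  then show ?thesis using x J_closed(1)[OF x] unfolding U_def by (metis (mono_tags, lifting) mem_Collect_eq)
qed

lemma U_zero: "\<zero> \<in> U"
  using J_subset_U J_closed(2) .

text \<open>Modulo f one has 1 = x q. So \<open>E h\<close>, which carries the empty suffix, is
  traded modulo \<open>J\<close> for \<open>E (h * q)\<close> preceded by the suffix
  \<open>u 0\<close>, that is \<open>c\<close>.\<close>

lemma E_U: "E h \<in> U"
proof -
  obtain q where q: "f = pCons 1 (- q)" using f_split by blast
  have "1 = f + pCons 0 q" using q by (simp add: one_pCons)
  then have "h = h * (f + pCons 0 q)" by simp
  also have "\<dots> = h * f + pCons 0 (h * q)"
    by (simp add: distrib_left mult_pCons_right)
  finally have "E h = E (h * f) \<oplus> pe c \<otimes> E (h * q)"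
    by (metis C_closed add.left_neutral ev_add ev_closed ev_pCons l_zero m_closed scal_zero)
  moreover have "E (h * f) \<in> U" by (intro J_subset_U E_J) simp
  moreover have "pe c \<otimes> E (h * q) \<in> U"
    using U_single[of 0 "h * q"] by (simp add: u_def c_def)
  ultimately show ?thesis using U_add by simp
qed

lemma U_lmult:
  assumes y: "y \<in> carrier R" and "\<And>j h. j < length c \<Longrightarrow> y \<otimes> (u j \<otimes> E h) \<in> U"
    and x: "x \<in> U"
  shows "y \<otimes> x \<in> U"
proof -
  obtain h where h: "x \<ominus> comb h \<in> J" using x by (auto simp: U_def)
  have "y \<otimes> (x \<ominus> comb h) \<in> U"
    using J_closed(5)[OF y h] by (rule J_subset_U)
  moreover have "y \<otimes> comb h = (\<Oplus>j\<in>{..<length c}. y \<otimes> (u j \<otimes> E (h j)))"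
    unfolding comb_def using y by (intro finsum_rdistr) auto
  moreover have "(\<Oplus>j\<in>S. y \<otimes> (u j \<otimes> E (h j))) \<in> U" if "S \<subseteq> {..<length c}" for S
    using finite_subset[OF that finite_lessThan] that
  proof (induction S rule: finite_induct)
    case empty
    then show ?case by (simp add: U_zero)
  next
    case (insert j S)
    then show ?case using y assms(2) by (simp add: U_add)
  qed
  ultimately have "y \<otimes> (x \<ominus> comb h) \<oplus> y \<otimes> comb h \<in> U"
    by (intro U_add) auto
  moreover have "y \<otimes> (x \<ominus> comb h) = y \<otimes> x \<ominus> y \<otimes> comb h"
    using x y by (simp add: mult_minus_distrib U_carrier)
  then have "y \<otimes> (x \<ominus> comb h) \<oplus> y \<otimes> comb h = y \<otimes> x"
    using x y by (simp add: U_carrier minus_eq a_assoc l_neg)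
  ultimately show ?thesis by simp
qed

lemma U_scal: "x \<in> U \<Longrightarrow> sc k \<otimes> x \<in> U"
proof (rule U_lmult)
  fix j h assume "j < length c"
  have "sc k \<otimes> (u j \<otimes> E h) = u j \<otimes> E (Polynomial.smult k h)"
    using scal_commute[of "u j" k] by (simp add: ev_smult m_assoc[symmetric])
  then show "sc k \<otimes> (u j \<otimes> E h) \<in> U" using U_single[OF \<open>j < length c\<close>] by simp
qed auto

text \<open>\<open>g i\<close> removes the first letter of a suffix or kills it. When the suffix is
  used up, the remaining \<open>E h\<close> is brought back by \<open>E_U\<close>.\<close>

lemma U_ghost:
  assumes i: "i \<in> {1..n}" and "x \<in> U"
  shows "g i \<otimes> x \<in> U"
proof (rule U_lmult)
  fix j h assume j: "j < length c"
  have cj: "c ! j \<in> {1..n}" using j set_c nth_mem by blast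
  have "u j = e (c ! j) \<otimes> u (Suc j)"
    using j by (simp add: u_def flip: Cons_nth_drop_Suc)
  then have *: "g i \<otimes> (u j \<otimes> E h) = (if i = c ! j then u (Suc j) \<otimes> E h else \<zero>)"
    using i cj ghost_edge[OF i cj] by (simp add: m_assoc[symmetric])
  show "g i \<otimes> (u j \<otimes> E h) \<in> U"
  proof (cases "Suc j < length c")
    case True
    then show ?thesis using * U_single U_zero by auto
  next
    case False
    then have "u (Suc j) = \<one>" by (simp add: u_def)
    then show ?thesis using * E_U U_zero by auto
  qed
qed (use assms in auto)

text \<open>Left multiplication by the adjoint of the path \<open>w\<close>: \<open>fold\<close>
  applies the ghost of the first letter of \<open>w\<close> first.\<close>

abbreviation "gh w x \<equiv> fold (\<lambda>i x. g i \<otimes> x) w x"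

lemma gh_closed: "set w \<subseteq> {1..n} \<Longrightarrow> x \<in> carrier R \<Longrightarrow> gh w x \<in> carrier R"
  by (induction w arbitrary: x) auto

lemma gh_add: "set w \<subseteq> {1..n} \<Longrightarrow> x \<in> carrier R \<Longrightarrow> y \<in> carrier R
    \<Longrightarrow> gh w (x \<oplus> y) = gh w x \<oplus> gh w y"
  by (induction w arbitrary: x y) (auto simp: r_distr)

lemma gh_scal: "set w \<subseteq> {1..n} \<Longrightarrow> x \<in> carrier R \<Longrightarrow> gh w (sc k \<otimes> x) = sc k \<otimes> gh w x"
proof (induction w arbitrary: x)
  case (Cons i w)
  have "g i \<otimes> (sc k \<otimes> x) = sc k \<otimes> (g i \<otimes> x)"
    using Cons.prems scal_commute[of "g i" k] by (simp add: m_assoc[symmetric])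
  then show ?case using Cons by simp
qed simp

lemma gh_U: "set w \<subseteq> {1..n} \<Longrightarrow> x \<in> U \<Longrightarrow> gh w x \<in> U"
  by (induction w arbitrary: x) (simp_all add: U_ghost)

definition EU :: "'k lpa set" where
  "EU = {x \<in> carrier R. \<exists>m. \<forall>w. set w \<subseteq> {1..n} \<longrightarrow> length w \<ge> m \<longrightarrow> gh w x \<in> U}"

text \<open>An edge costs one more letter: the first letter stripped either cancels it or kills the
  product. A ghost is absorbed as an extra first letter of the stripping word.\<close>

lemma lmult_EU: "x \<in> carrier R \<Longrightarrow> y \<in> EU \<Longrightarrow> x \<otimes> y \<in> EU"
proof (induction x arbitrary: y rule: lpa_induct)
  case (scal k)
  then obtain m where m: "\<And>w. set w \<subseteq> {1..n} \<Longrightarrow> length w \<ge> m \<Longrightarrow> gh w y \<in> U" "y \<in> carrier R"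
    by (auto simp: EU_def)
  then have "gh w (sc k \<otimes> y) \<in> U" if "set w \<subseteq> {1..n}" "length w \<ge> m" for w
    using that by (simp add: gh_scal U_scal)
  then show ?case using m by (auto simp: EU_def)
next
  case (edge i)
  then obtain m where m: "\<And>w. set w \<subseteq> {1..n} \<Longrightarrow> length w \<ge> m \<Longrightarrow> gh w y \<in> U" "y \<in> carrier R"
    by (auto simp: EU_def)
  have "gh w (e i \<otimes> y) \<in> U" if w: "set w \<subseteq> {1..n}" "length w \<ge> Suc m" for w
  proof (cases w)
    case (Cons j w')
    have "g j \<otimes> (e i \<otimes> y) = (if j = i then y else \<zero>)"
      using edge Cons w m by (simp add: ghost_edge m_assoc[symmetric])
    then show ?thesis using Cons w m gh_U[OF _ U_zero, of w'] by auto
  qed (use w in simp)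
  then show ?case using m edge unfolding EU_def by (auto intro!: exI[of _ "Suc m"])
next
  case (ghost i)
  then obtain m where m: "\<And>w. set w \<subseteq> {1..n} \<Longrightarrow> length w \<ge> m \<Longrightarrow> gh w y \<in> U" "y \<in> carrier R"
    by (auto simp: EU_def)
  have "gh w (g i \<otimes> y) \<in> U" if "set w \<subseteq> {1..n}" "length w \<ge> m" for w
    using m(1)[of "i # w"] that ghost by simp
  then show ?case using m ghost by (auto simp: EU_def)
next
  case (add x x')
  have y: "y \<in> carrier R" using add by (simp add: EU_def)
  obtain m where m: "\<And>w. set w \<subseteq> {1..n} \<Longrightarrow> length w \<ge> m \<Longrightarrow> gh w (x \<otimes> y) \<in> U"
    using add.IH(1)[OF add.prems] by (auto simp: EU_def)
  obtain m' where m': "\<And>w. set w \<subseteq> {1..n} \<Longrightarrow> length w \<ge> m' \<Longrightarrow> gh w (x' \<otimes> y) \<in> U"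
    using add.IH(2)[OF add.prems] by (auto simp: EU_def)
  have "gh w ((x \<oplus> x') \<otimes> y) \<in> U" if "set w \<subseteq> {1..n}" "length w \<ge> max m m'" for w
    using m m' that add.hyps y by (simp add: l_distr gh_add U_add)
  then show ?case using add.hyps y unfolding EU_def by blast
next
  case (mult x x')
  then have "(x \<otimes> x') \<otimes> y = x \<otimes> (x' \<otimes> y)" by (simp add: m_assoc EU_def)
  then show ?case using mult by simp
qed

lemma carrier_EU: "x \<in> carrier R \<Longrightarrow> x \<in> EU"
proof -
  assume x: "x \<in> carrier R"
  have "\<one> \<in> U" using E_U[of 1] by (simp add: ev_one)
  then have "\<one> \<in> EU" using gh_U by (auto simp: EU_def)
  then show ?thesis using lmult_EU[OF x, of \<one>] x by simp
qed

lemma ap_finsum: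
  assumes "finite S" "\<And>j. j \<in> S \<Longrightarrow> x j \<in> carrier R" "y \<in> W"
  shows "((\<Oplus>j\<in>S. x j) \<cdot> y) \<xi> = (\<Sum>j\<in>S. (x j \<cdot> y) \<xi>)"
  using assms
proof (induction S rule: finite_induct)
  case (insert j S)
  then have "x \<in> S \<rightarrow> carrier R" "x j \<in> carrier R" by auto
  then show ?case using insert by (simp add: ap_add_left)
qed simp

lemma J_finsum:
  assumes "finite S" "\<And>j. j \<in> S \<Longrightarrow> x j \<in> J"
  shows "(\<Oplus>j\<in>S. x j) \<in> J"
  using assms
proof (induction S rule: finite_induct)
  case (insert j S)
  then have "x \<in> S \<rightarrow> carrier R" "x j \<in> carrier R" using J_closed(1) by auto
  then show ?case using insert J_closed(3) by simp
qed (simp add: J_closed)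

lemma U_ann:
  assumes x: "x \<in> U" "x \<cdot> z = 0"
  shows "x \<in> J"
proof -
  obtain h where h: "x \<ominus> comb h \<in> J" using x by (auto simp: U_def)
  have comb0: "comb h \<cdot> z = 0"
    using ap_J[OF h] x U_carrier[OF x(1)] by (simp add: ap_diff)
  have "peval (h j) \<theta> = 0" if j: "j < length c" for j
  proof -
    \<comment> \<open>The path \<open>u j\<close> followed by c c c ... . Suffixes of
      \<open>v\<close> starting at different places have different lengths, so among all
      \<open>u i \<cdot> z\<close> only the one for \<open>j\<close> is nonzero here.\<close>
    define \<xi> where "\<xi> i = (if i = 0 then drop j v else v)" for i :: nat
    have "((u i \<otimes> E (h i)) \<cdot> z) \<xi> = (if i = j then \<theta> * peval (h j) \<theta> else 0)"
      if i: "i < length c" for i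
    proof -
      have "u i = pe (drop i v @ [2])" using i by (simp add: u_def c_def)
      moreover have "set (drop i v) \<subseteq> {1..n} - {2}" by (rule order_trans[OF set_drop_subset v])
      ultimately have "(u i \<cdot> z) \<xi> = (if \<xi> 0 = drop i v then \<theta> * z (\<lambda>j. \<xi> (Suc j)) else 0)"
        using ap_path_block[of "drop i v" z] by simp
      moreover have "(u i \<otimes> E (h i)) \<cdot> z = peval (h i) \<theta> *v (u i \<cdot> z)"
        by (simp only: ap_mult u_closed ev_closed C_closed z_W ap_ev_z ap_vsmult)
      ultimately have "((u i \<otimes> E (h i)) \<cdot> z) \<xi>
          = peval (h i) \<theta> * (if \<xi> 0 = drop i v then \<theta> * z (\<lambda>j. \<xi> (Suc j)) else 0)"
        by (simp only: vsmult_apply)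
      moreover have "z (\<lambda>j. \<xi> (Suc j)) = 1" by (simp add: z_def \<xi>_def)
      moreover have "\<xi> 0 = drop i v \<longleftrightarrow> i = j"
      proof
        assume "\<xi> 0 = drop i v"
        then have "length (drop j v) = length (drop i v)" by (simp add: \<xi>_def)
        then show "i = j" using i j by (simp add: c_def)
      qed (simp add: \<xi>_def)
      ultimately show ?thesis by (simp add: mult.commute)
    qed
    then have "(\<Sum>i<length c. ((u i \<otimes> E (h i)) \<cdot> z) \<xi>)
        = (\<Sum>i<length c. if i = j then \<theta> * peval (h j) \<theta> else 0)"
      by (intro sum.cong) auto
    moreover have "(comb h \<cdot> z) \<xi> = (\<Sum>i<length c. ((u i \<otimes> E (h i)) \<cdot> z) \<xi>)"
      unfolding comb_def by (intro ap_finsum) auto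
    ultimately show ?thesis using comb0 j \<theta> by simp
  qed
  then have "comb h \<in> J"
    unfolding comb_def
    by (intro J_finsum J_closed(5) E_J) (auto simp: irreducible_dvd_iff_root[OF f_irr root])
  then have "(x \<ominus> comb h) \<oplus> comb h \<in> J" using h J_closed(3) by blast
  moreover have "(x \<ominus> comb h) \<oplus> comb h = x"
    using U_carrier[OF x(1)] by (simp add: minus_eq a_assoc l_neg)
  ultimately show ?thesis by simp
qed

theorem J_eq_ann: "x \<in> J \<longleftrightarrow> x \<in> carrier R \<and> x \<cdot> z = 0"
proof
  assume "x \<in> J"
  then show "x \<in> carrier R \<and> x \<cdot> z = 0" using ap_J J_closed(1) by blast
next
  assume x: "x \<in> carrier R \<and> x \<cdot> z = 0"
  then obtain m where m: "\<And>w. set w \<subseteq> {1..n} \<Longrightarrow> length w \<ge> m \<Longrightarrow> gh w x \<in> U"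
    using carrier_EU[of x] by (auto simp: EU_def)
  \<comment> \<open>Fixing the exact length suits the induction: a word of length \<open>m\<close>
    applied to \<open>g i \<otimes> x\<close> is a word of length \<open>Suc m\<close> applied to
    \<open>x\<close>.\<close>
  have "x \<in> J" if "\<And>w. set w \<subseteq> {1..n} \<Longrightarrow> length w = m \<Longrightarrow> gh w x \<in> U"
    "x \<in> carrier R" "x \<cdot> z = 0" for x m
    using that
  proof (induction m arbitrary: x)
    case 0
    have "x \<in> U" using 0(1)[of "[]"] by simp
    then show ?case using U_ann 0(3) by blast
  next
    case (Suc m)
    have "g i \<otimes> x \<in> J" if i: "i \<in> {1..n}" for i
    proof (rule Suc.IH)
      show "gh w (g i \<otimes> x) \<in> U" if "set w \<subseteq> {1..n}" "length w = m" for w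
        using Suc.prems(1)[of "i # w"] that i by simp
      show "(g i \<otimes> x) \<cdot> z = 0"
        using ap_mult[of "g i" x z] i Suc.prems ap_zero_right z_W ghost_closed by metis
    qed (use i Suc.prems in auto)
    then have "(\<Oplus>i\<in>{1..n}. e i \<otimes> (g i \<otimes> x)) \<in> J"
      using J_closed(5)[OF edge_closed] by (intro J_finsum) blast+
    moreover have "(\<Oplus>i\<in>{1..n}. e i \<otimes> (g i \<otimes> x)) = (\<Oplus>i\<in>{1..n}. e i \<otimes> g i \<otimes> x)"
      using Suc.prems by (intro add.finprod_cong') (auto simp: m_assoc)
    moreover have "\<dots> = (\<Oplus>i\<in>{1..n}. e i \<otimes> g i) \<otimes> x"
      using Suc.prems by (intro finsum_ldistr[symmetric]) auto
    ultimately show ?case using sum_edge_ghost Suc.prems by simp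
  qed
  from this[of m x] show "x \<in> J" using x m by simp
qed

section \<open>Maximality of the left ideal\<close>

lemma one_notin_J: "\<one> \<notin> J"
  using z_neq_0 by (simp add: J_eq_ann)

text \<open>K[\<theta>] contains 1 / \<theta>, so functions with values in it are stable under all
  generators. A scalar of the closure found as a value of \<open>x \<cdot> z\<close> is therefore
  some h(\<theta>), which \<open>E h\<close> realises on \<open>z\<close>.\<close>

lemma ap_values:
  assumes "x \<in> carrier R" "y \<in> W" "\<And>\<xi>. \<exists>h. y \<xi> = peval h \<theta>"
  shows "\<exists>h. (x \<cdot> y) \<xi> = peval h \<theta>"
  using assms
proof (induction x arbitrary: y \<xi> rule: lpa_induct)
  case (scal k)
  then obtain h where "y \<xi> = peval h \<theta>" by blast
  then have "(sc k \<cdot> y) \<xi> = peval (Polynomial.smult k h) \<theta>"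
    using scal by (simp add: ap_scal vsmult_apply peval_smult)
  then show ?case by blast
next
  case (edge i)
  have 0: "\<exists>h. 0 = peval h \<theta>" by (rule exI[of _ 0]) simp
  have 1: "\<exists>h. \<theta> * y \<xi> = peval h \<theta>" for \<xi>
    using edge(3)[of \<xi>] peval_pCons[of 0 _ \<theta>] by (metis add.left_neutral to_ac_0)
  show ?case
    using edge 0 1 by (auto simp: ap_edge split: list.split)
next
  case (ghost i)
  obtain q where q: "\<theta> * peval q \<theta> = 1" using f_split by blast
  have "\<exists>h. y \<xi> / \<theta> = peval h \<theta>" for \<xi>
  proof -
    obtain h where "y \<xi> = peval h \<theta>" using ghost(3) by blast
    then have "y \<xi> / \<theta> = peval (q * h) \<theta>"
      using q \<theta> by (simp add: peval_mult field_simps)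
    then show ?thesis by blast
  qed
  then show ?case using ghost by (auto simp: ap_ghost)
next
  case (add x x')
  then obtain h h' where "(x \<cdot> y) \<xi> = peval h \<theta>" "(x' \<cdot> y) \<xi> = peval h' \<theta>" by metis
  then have "((x \<oplus> x') \<cdot> y) \<xi> = peval (h + h') \<theta>"
    using add by (simp add: ap_add_left peval_add)
  then show ?case by blast
next
  case (mult x x')
  have "\<exists>h. (x \<cdot> x' \<cdot> y) \<xi> = peval h \<theta>"
    by (rule mult.IH(1)) (use mult in auto)
  then show ?case using mult by (simp add: ap_mult)
qed

lemma ap_z_values:
  assumes "x \<in> carrier R"
  shows "\<exists>h. (x \<cdot> z) \<xi> = peval h \<theta>"
proof (rule ap_values[OF assms z_W])
  fix \<xi>
  show "\<exists>h. z \<xi> = peval h \<theta>"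
  proof (cases "\<xi> = (\<lambda>_. v)")
    case True
    then show ?thesis by (intro exI[of _ 1]) (simp add: z_def peval_one)
  next
    case False
    then show ?thesis by (intro exI[of _ 0]) (simp add: z_def)
  qed
qed

lemma ap_gh:
  assumes "set w \<subseteq> {1..n} - {2}" "x \<in> carrier R" "y \<in> W"
  shows "(gh w x \<cdot> y) \<xi> = (x \<cdot> y) (\<xi>(0 := w @ \<xi> 0))"
  using assms
proof (induction w arbitrary: x)
  case (Cons i w)
  have "(gh (i # w) x \<cdot> y) \<xi> = ((g i \<otimes> x) \<cdot> y) (\<xi>(0 := w @ \<xi> 0))"
    using Cons.IH[of "g i \<otimes> x"] Cons.prems by (simp del: fun_upd_apply)
  also have "\<dots> = (x \<cdot> y) (\<xi>(0 := (i # w) @ \<xi> 0))"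
    using Cons.prems by (auto simp: ap_mult ap_ghost)
  finally show ?case .
qed simp

text \<open>Choose a sequence in the support of \<open>y\<close> and remove its first block together
  with the following \<open>e 2\<close>: what remains of it lies in the support of the result, and
  the level drops by one. At level 0 only multiples of \<open>z\<close> are left.\<close>

lemma strip:
  assumes "y \<in> V k" "y \<noteq> 0"
  shows "\<exists>s\<in>carrier R. \<exists>\<mu>. \<mu> \<noteq> 0 \<and> s \<cdot> y = \<mu> *v z"
  using assms
proof (induction k arbitrary: y)
  case 0
  have "y = y (\<lambda>_. v) *v z" using V_0_eq 0 by blast
  moreover from this have "y (\<lambda>_. v) \<noteq> 0" using 0 by (metis vsmult_zero(2))
  moreover have "\<one> \<cdot> y = y" using 0 V_W by simp
  ultimately show ?case by (metis one_closed)
next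
  case (Suc k)
  have 2: "2 \<in> {1..n}" using n_ge_2 by auto
  obtain \<xi> where \<xi>: "y \<xi> \<noteq> 0" using Suc.prems(2) by (auto simp: fun_eq_iff)
  define w where "w = \<xi> 0"
  have "adm \<xi>" using \<xi> Suc.prems(1) by (auto simp: V_def)
  then have w: "set w \<subseteq> {1..n} - {2}" by (simp add: adm_def w_def)
  have yW: "y \<in> W" using Suc.prems V_W by blast
  \<comment> \<open>The adjoint of the block: the letters of \<open>w\<close> are stripped first,
    then \<open>e 2\<close>, which divides by \<theta>.\<close>
  define s where "s = g 2 \<otimes> gh w \<one>"
  have wn: "set w \<subseteq> {1..n}" using w by auto
  have s: "s \<in> carrier R" using 2 gh_closed[OF wn one_closed] by (simp add: s_def)
  have "(s \<cdot> y) \<eta> = (gh w \<one> \<cdot> y) (case_nat [] \<eta>) / \<theta>" for \<eta>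
    using 2 yW gh_closed[OF wn one_closed] by (simp add: s_def ap_mult ap_ghost)
  moreover have "(case_nat [] \<eta>)(0 := w) = case_nat w \<eta>" for \<eta> :: "nat \<Rightarrow> nat list"
    by (auto simp: fun_eq_iff split: nat.split)
  ultimately have sy: "(s \<cdot> y) \<eta> = y (case_nat w \<eta>) / \<theta>" for \<eta>
    using ap_gh[OF w one_closed yW] yW by simp
  have "s \<cdot> y \<in> V k"
    unfolding V_def
  proof (intro CollectI allI impI conjI)
    fix \<eta> assume "(s \<cdot> y) \<eta> \<noteq> 0"
    then have "y (case_nat w \<eta>) \<noteq> 0" using sy by auto
    then have *: "adm (case_nat w \<eta>)" "\<And>i. i \<ge> Suc k \<Longrightarrow> case_nat w \<eta> i = v"
      using Suc.prems(1) by (auto simp: V_def)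
    show "adm \<eta>" unfolding adm_def
    proof
      show "set (\<eta> i) \<subseteq> {1..n} - {2}" for i
        using *(1)[unfolded adm_def, rule_format, of "Suc i"] by simp
    qed
    show "\<eta> i = v" if "i \<ge> k" for i using *(2)[of "Suc i"] that by simp
  qed
  moreover have "case_nat w (\<lambda>j. \<xi> (Suc j)) = \<xi>"
    by (auto simp: fun_eq_iff w_def split: nat.split)
  then have "(s \<cdot> y) (\<lambda>j. \<xi> (Suc j)) \<noteq> 0" using sy \<xi> \<theta> by simp
  then have "s \<cdot> y \<noteq> 0" by auto
  ultimately obtain s' \<mu> where "s' \<in> carrier R" "\<mu> \<noteq> 0" "s' \<cdot> s \<cdot> y = \<mu> *v z"
    using Suc.IH by blast
  then have "(s' \<otimes> s) \<cdot> y = \<mu> *v z" "s' \<otimes> s \<in> carrier R"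
    using s yW by (auto simp: ap_mult)
  then show ?case using \<open>\<mu> \<noteq> 0\<close> by blast
qed

text \<open>An element outside \<open>J\<close> moves \<open>z\<close> to a nonzero vector, which
  \<open>strip\<close> returns to \<mu> z. The scalar \<mu> lies in K[\<theta>], a field since f is
  irreducible, so a polynomial in c undoes it.\<close>

theorem J_maximal:
  assumes x: "x \<in> carrier R" "x \<notin> J"
  shows "\<exists>s\<in>carrier R. s \<otimes> x \<ominus> \<one> \<in> J"
proof -
  have "x \<cdot> z \<noteq> 0" using x J_eq_ann by blast
  moreover obtain k where "x \<cdot> z \<in> V k" using ap_closed[OF x(1) z_W] by (auto simp: W_def)
  ultimately obtain s \<mu> where s: "s \<in> carrier R" "\<mu> \<noteq> 0" "s \<cdot> x \<cdot> z = \<mu> *v z"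
    using strip by blast
  have "(s \<otimes> x) \<cdot> z = \<mu> *v z"
    using s x by (simp add: ap_mult)
  moreover have "(\<mu> *v z) (\<lambda>_. v) = \<mu>" by (simp add: vsmult_apply z_def)
  ultimately have "((s \<otimes> x) \<cdot> z) (\<lambda>_. v) = \<mu>" by metis
  then obtain h where h: "\<mu> = peval h \<theta>" using ap_z_values[of "s \<otimes> x"] s x by fastforce
  then have "\<not> f dvd h" using s irreducible_dvd_iff_root[OF f_irr root] by simp
  then obtain a b where "a * f + b * h = 1" using irreducible_bezout f_irr by blast
  then have "peval (a * f + b * h) \<theta> = 1" by (simp add: peval_one)
  then have b: "\<mu> * peval b \<theta> = 1" using root h by (simp add: peval_add peval_mult mult.commute)
  have "(E b \<otimes> s \<otimes> x \<ominus> \<one>) \<cdot> z = 0"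
    using s x b by (simp add: ap_diff ap_mult ap_vsmult ap_ev_z vsmult_vsmult)
  then show ?thesis using s x by (intro bexI[of _ "E b \<otimes> s"]) (auto simp: J_eq_ann)
qed

end

section \<open>Eigenvectors of twisted paths\<close>

context leavitt_rose
begin

lemma sig_hom: "p \<in> A \<Longrightarrow> sig p \<in> ring_hom R R"
  and sig_scal: "p \<in> A \<Longrightarrow> sig p (sc k) = sc k"
  and sig_edge_2: "p \<in> A \<Longrightarrow> sig p (e 2) = e 2 \<oplus> e 1 \<otimes> p"
  and sig_A: "p \<in> A \<Longrightarrow> a \<in> A \<Longrightarrow> sig p a = a"
  using sigma_is_sigma[of p] by (auto simp: is_sigma_def)

lemma sig_bij: "p \<in> A \<Longrightarrow> bij_betw (sig p) (carrier R) (carrier R)"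
  using is_sigma_bij sigma_is_sigma by blast

lemma sig_closed [simp]: "p \<in> A \<Longrightarrow> x \<in> carrier R \<Longrightarrow> sig p x \<in> carrier R"
  using ring_hom_closed[OF sig_hom] .

lemma sig_mult: "p \<in> A \<Longrightarrow> x \<in> carrier R \<Longrightarrow> y \<in> carrier R \<Longrightarrow> sig p (x \<otimes> y) = sig p x \<otimes> sig p y"
  and sig_one: "p \<in> A \<Longrightarrow> sig p \<one> = \<one>"
  using ring_hom_mult[OF sig_hom] ring_hom_one[OF sig_hom] by auto

lemma sig_ev: "p \<in> A \<Longrightarrow> x \<in> carrier R \<Longrightarrow> sig p (ev h x) = ev h (sig p x)"
  by (rule ev_hom[OF sig_hom sig_scal])

lemma sig_comp:
  "p \<in> A \<Longrightarrow> q \<in> A \<Longrightarrow> x \<in> carrier R \<Longrightarrow> sig p (sig q x) = sig (p \<oplus> q) x"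
  using is_sigma_unique[OF is_sigma_comp[OF sigma_is_sigma sigma_is_sigma] sigma_is_sigma, of p q x]
  by (simp add: A_closed)

lemma sig_zero: "x \<in> carrier R \<Longrightarrow> sig \<zero> x = x"
  using is_sigma_unique[OF sigma_is_sigma is_sigma_zero] by (simp add: A_closed)

lemma sig_block:
  assumes p: "p \<in> A" and w: "set w \<subseteq> {1..n} - {2}"
  shows "sig p (pe (w @ [2])) = pe w \<otimes> (e 2 \<oplus> e 1 \<otimes> p)"
proof -
  have "set w \<subseteq> {1..n}" "2 \<in> {1..n}" using w n_ge_2 by auto
  then show ?thesis
    using sig_A[OF p path_in_A[OF w]]
    by (simp add: path_append sig_mult[OF p] sig_edge_2[OF p])
qed

end

context leavitt_irr
begin

lemma ap_sig_block:
  assumes p: "p \<in> A" and w: "set w \<subseteq> {1..n} - {2}" and y: "y \<in> W"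
  shows "sig p (pe (w @ [2])) \<cdot> y = pe (w @ [2]) \<cdot> y + pe (w @ [1]) \<cdot> p \<cdot> y"
proof -
  have n: "set w \<subseteq> {1..n}" "2 \<in> {1..n}" "1 \<in> {1..n}" using w n_ge_2 by auto
  have pR: "p \<in> carrier R" using p A_carrier by blast
  have "sig p (pe (w @ [2])) = pe (w @ [2]) \<oplus> pe (w @ [1]) \<otimes> p"
    unfolding sig_block[OF p w] using n pR by (simp add: path_append r_distr m_assoc)
  moreover have "pe (w @ [2]) \<in> carrier R" "pe (w @ [1]) \<in> carrier R"
    using n by auto
  ultimately show ?thesis using pR y ap_add_left ap_mult by simp
qed

text \<open>The condition \<open>k \<ge> 1\<close> guards against truncation in \<open>k - 1\<close>.\<close>

definition deg_eq :: "nat \<Rightarrow> ((nat \<Rightarrow> nat list) \<Rightarrow> 'k alg_closure) \<Rightarrow> bool" where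
  "deg_eq k y \<longleftrightarrow> k \<ge> 1 \<and> y \<in> V k \<and> y \<notin> V (k - 1)"

lemma deg_eqE:
  assumes "deg_eq k y"
  obtains \<xi> where "y \<xi> \<noteq> 0" "adm \<xi>" "\<xi> (k - 1) \<noteq> v"
proof -
  obtain \<xi> where \<xi>: "y \<xi> \<noteq> 0" "\<not> (adm \<xi> \<and> (\<forall>i\<ge>k - 1. \<xi> i = v))"
    using assms by (auto simp: deg_eq_def V_def)
  then have "adm \<xi>" "\<forall>i\<ge>k. \<xi> i = v" using assms by (auto simp: deg_eq_def V_def)
  moreover obtain i where "i \<ge> k - 1" "\<xi> i \<noteq> v" using \<xi> calculation by blast
  ultimately have "\<xi> (k - 1) \<noteq> v" by (metis diff_Suc_1 le_antisym not_less_eq_eq old.nat.exhaust zero_diff)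
  then show ?thesis using that \<xi> \<open>adm \<xi>\<close> by blast
qed

lemma deg_eqI:
  assumes "y \<in> V k" "k \<ge> 1" "y \<xi> \<noteq> 0" "\<xi> (k - 1) \<noteq> v"
  shows "deg_eq k y"
proof -
  have "y \<notin> V (k - 1)"
  proof
    assume "y \<in> V (k - 1)"
    then have "\<forall>i\<ge>k - 1. \<xi> i = v" using assms(3) unfolding V_def by blast
    then show False using assms(4) by blast
  qed
  then show ?thesis using assms by (simp add: deg_eq_def)
qed

lemma path_append_one_in_A: "set w \<subseteq> {1..n} - {2} \<Longrightarrow> pe (w @ [1]) \<in> A"
  using n_ge_2 by (intro path_in_A) auto

lemma path_block_V:
  assumes "set w \<subseteq> {1..n} - {2}" "y \<in> V k"
  shows "pe (w @ [2]) \<cdot> y \<in> V (Suc k)"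
proof -
  have 2: "2 \<in> {1..n}" "set w \<subseteq> {1..n}" using n_ge_2 assms by auto
  have "pe (w @ [2]) \<cdot> y = pe w \<cdot> vop \<theta> (Edge 2) y"
    using 2 V_W[OF assms(2)] by (simp add: path_append ap_mult ap_edge del: vop.simps)
  then show ?thesis
    using A_ap_V[OF path_in_A[OF assms(1)] _ vop_Edge_2_V[OF assms(2)]] by simp
qed

text \<open>The summand of \<open>p\<close> stays inside \<open>V k\<close>, as \<open>A\<close> preserves \<open>V k\<close> for \<open>k \<ge> 1\<close>; so the top
  degree part is that of the untwisted path.\<close>

lemma deg_eq_block:
  assumes p: "p \<in> A" and w: "set w \<subseteq> {1..n} - {2}" and y: "deg_eq k y"
  shows "deg_eq (Suc k) (sig p (pe (w @ [2])) \<cdot> y)"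
proof -
  have k: "k \<ge> 1" "y \<in> V k" using y by (auto simp: deg_eq_def)
  have yW: "y \<in> W" using k V_W by blast
  let ?a = "pe (w @ [2]) \<cdot> y" and ?b = "pe (w @ [1]) \<cdot> p \<cdot> y"
  have b: "?b \<in> V k"
    using A_ap_V[OF p k] A_ap_V[OF path_append_one_in_A[OF w] k(1)] by blast
  have eq: "sig p (pe (w @ [2])) \<cdot> y = ?a + ?b" by (rule ap_sig_block[OF p w yW])
  obtain \<xi> where \<xi>: "y \<xi> \<noteq> 0" "\<xi> (k - 1) \<noteq> v" using deg_eqE[OF y] by blast
  define \<eta> where "\<eta> = case_nat w \<xi>"
  have \<eta>: "\<eta> k \<noteq> v" using \<xi> k by (cases k) (auto simp: \<eta>_def)
  have "?a \<eta> = \<theta> * y \<xi>"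
    using ap_path_block[OF w yW] by (simp add: \<eta>_def)
  moreover have "?b \<eta> = 0" using b \<eta> by (auto simp: V_def)
  ultimately have "(?a + ?b) \<eta> \<noteq> 0" using \<xi> \<theta> by simp
  moreover have "?a + ?b \<in> V (Suc k)"
    using path_block_V[OF w k(2)] b V_mono[of k "Suc k"] by (intro V_add) auto
  ultimately show ?thesis unfolding eq using \<eta> by (intro deg_eqI) auto
qed

text \<open>Paths in \<open>C_s n\<close> are single blocks, but a general closed path ending in
  \<open>e 2\<close> may contain further copies of it; cutting after each copy gives
  \<open>ws\<close>.\<close>

abbreviation "blocks ws \<equiv> concat (map (\<lambda>w. w @ [2::nat]) ws)"

lemma set_block: "set w \<subseteq> {1..n} - {2} \<Longrightarrow> set (w @ [2]) \<subseteq> {1..n}"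
  using n_ge_2 by auto

lemma set_blocks:
  "(\<And>w. w \<in> set ws \<Longrightarrow> set w \<subseteq> {1..n} - {2}) \<Longrightarrow> set (blocks ws) \<subseteq> {1..n}"
  using n_ge_2 by (induction ws) auto

lemma ap_sig_blocks_Cons:
  assumes p: "p \<in> A" and ws: "\<And>u. u \<in> set (w # ws) \<Longrightarrow> set u \<subseteq> {1..n} - {2}" and y: "y \<in> W"
  shows "sig p (pe (blocks (w # ws))) \<cdot> y = sig p (pe (w @ [2])) \<cdot> sig p (pe (blocks ws)) \<cdot> y"
proof -
  have w: "set (w @ [2]) \<subseteq> {1..n}" using ws by (intro set_block) simp
  have b: "set (blocks ws) \<subseteq> {1..n}" using ws by (intro set_blocks) simp
  have "pe (blocks (w # ws)) = pe (w @ [2]) \<otimes> pe (blocks ws)"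
    using path_append[OF w b] by simp
  then show ?thesis
    using ap_mult[OF sig_closed[OF p path_closed[OF w]] sig_closed[OF p path_closed[OF b]] y]
      sig_mult[OF p path_closed[OF w] path_closed[OF b]] by simp
qed

lemma deg_eq_blocks:
  assumes p: "p \<in> A" and "\<And>w. w \<in> set ws \<Longrightarrow> set w \<subseteq> {1..n} - {2}" and y: "deg_eq k y"
  shows "deg_eq (k + length ws) (sig p (pe (blocks ws)) \<cdot> y)"
  using assms(2)
proof (induction ws)
  case Nil
  have "y \<in> W" using y V_W by (auto simp: deg_eq_def)
  then show ?case using y by (simp add: sig_one[OF p])
next
  case (Cons w ws)
  have "y \<in> W" using y V_W by (auto simp: deg_eq_def)
  then have "sig p (pe (blocks (w # ws))) \<cdot> y = sig p (pe (w @ [2])) \<cdot> sig p (pe (blocks ws)) \<cdot> y"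
    using Cons.prems by (intro ap_sig_blocks_Cons[OF p]) auto
  moreover have "deg_eq (k + length ws) (sig p (pe (blocks ws)) \<cdot> y)"
    using Cons by simp
  ultimately show ?case
    using deg_eq_block[OF p, of w "k + length ws" "sig p (pe (blocks ws)) \<cdot> y"] Cons.prems by simp
qed

lemma deg_eq_W: "deg_eq k y \<Longrightarrow> y \<in> W"
  using V_W by (auto simp: deg_eq_def)

text \<open>The vectors obtained from \<open>y\<close> by the powers of \<open>x\<close> have
  strictly increasing degrees, so the one with the leading coefficient survives. The bound
  \<open>l \<ge> k\<close> keeps the constant term below the rest in the Horner induction.\<close>

lemma deg_eq_ev:
  assumes x: "x \<in> carrier R" and m: "m \<ge> 1"
    and raise: "\<And>k y. deg_eq k y \<Longrightarrow> deg_eq (k + m) (x \<cdot> y)"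
    and y: "deg_eq k y" and h: "h \<noteq> 0"
  shows "\<exists>l\<ge>k. deg_eq l (ev h x \<cdot> y)"
  using h
proof (induction h)
  case (pCons a h)
  have yW: "y \<in> W" using y by (rule deg_eq_W)
  have eq: "ev (pCons a h) x \<cdot> y = to_ac a *v y + x \<cdot> ev h x \<cdot> y"
    using x yW by (simp add: ev_pCons ap_add_left ap_scal ap_mult)
  show ?case
  proof (cases "h = 0")
    case True
    then have a: "a \<noteq> 0" using pCons by simp
    have "ev (pCons a h) x \<cdot> y = to_ac a *v y"
      using True x yW by (simp add: ev_pCons ap_scal)
    moreover have "deg_eq k (to_ac a *v y)"
    proof -
      obtain \<xi> where "y \<xi> \<noteq> 0" "\<xi> (k - 1) \<noteq> v" using deg_eqE[OF y] by blast
      then show ?thesis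
        using y a by (intro deg_eqI[of _ _ \<xi>] V_vsmult) (auto simp: deg_eq_def vsmult_apply)
    qed
    ultimately show ?thesis by auto
  next
    case False
    then obtain l where l: "l \<ge> k" "deg_eq l (ev h x \<cdot> y)" using pCons by blast
    have top: "deg_eq (l + m) (x \<cdot> ev h x \<cdot> y)" using raise[OF l(2)] .
    obtain \<xi> where \<xi>: "(x \<cdot> ev h x \<cdot> y) \<xi> \<noteq> 0" "\<xi> (l + m - 1) \<noteq> v"
      using deg_eqE[OF top] by blast
    have yk: "to_ac a *v y \<in> V k" using y by (intro V_vsmult) (simp add: deg_eq_def)
    \<comment> \<open>As \<open>m \<ge> 1\<close>, the position \<open>l + m - 1\<close> is at least
      \<open>k\<close>; there \<xi> differs from \<open>v\<close>, which \<open>V k\<close>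
      forbids.\<close>
    then have "(to_ac a *v y) \<xi> = 0"
      using \<xi>(2) l(1) m by (auto simp: V_def)
    then have "(to_ac a *v y + x \<cdot> ev h x \<cdot> y) \<xi> \<noteq> 0" using \<xi> by simp
    moreover have "to_ac a *v y + x \<cdot> ev h x \<cdot> y \<in> V (l + m)"
      using yk top V_mono[of k "l + m"] l by (intro V_add) (auto simp: deg_eq_def)
    ultimately have "deg_eq (l + m) (ev (pCons a h) x \<cdot> y)"
      unfolding eq using \<xi> m by (intro deg_eqI) auto
    then show ?thesis using l by (intro exI[of _ "l + m"]) simp
  qed
qed simp

section \<open>Kernels of polynomials in a twisted path\<close>

lemma W_cases:
  assumes "y \<in> W"
  obtains "y \<in> V 0" | k where "deg_eq k y"
proof (cases "y \<in> V 0")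
  case False
  define k where "k = (LEAST k. y \<in> V k)"
  have "\<exists>k. y \<in> V k" using assms by (auto simp: W_def)
  then have k: "y \<in> V k" unfolding k_def by (rule LeastI_ex)
  then have "k \<noteq> 0" using False by metis
  moreover have "y \<notin> V (k - 1)"
  proof
    assume "y \<in> V (k - 1)"
    then have "k \<le> k - 1" unfolding k_def by (rule Least_le)
    then show False using \<open>k \<noteq> 0\<close> by simp
  qed
  ultimately have "deg_eq k y" using k by (simp add: deg_eq_def)
  then show ?thesis using that by blast
qed

lemma deg_eq_not_V_0: "deg_eq k y \<Longrightarrow> y \<notin> V 0"
  using V_mono[of 0 "k - 1"] by (auto simp: deg_eq_def)

lemma deg_eq_nonzero: "deg_eq k y \<Longrightarrow> y \<noteq> 0"
  using deg_eq_not_V_0 V_zero by blast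

lemma kernel_V_0:
  assumes p: "p \<in> A" and ws: "\<And>w. w \<in> set ws \<Longrightarrow> set w \<subseteq> {1..n} - {2}" "ws \<noteq> []"
    and y: "y \<in> W" and h: "h \<noteq> 0" and ker: "ev h (sig p (pe (blocks ws))) \<cdot> y = 0"
  shows "y \<in> V 0"
  using y
proof (cases y rule: W_cases)
  case (2 k)
  have "length ws \<ge> 1" using ws(2) by (cases ws) auto
  moreover have "sig p (pe (blocks ws)) \<in> carrier R"
    using set_blocks[OF ws(1)] by (intro sig_closed[OF p] path_closed)
  ultimately obtain l where "deg_eq l (ev h (sig p (pe (blocks ws))) \<cdot> y)"
    using deg_eq_ev[of _ "length ws", OF _ _ deg_eq_blocks[OF p ws(1)] 2 h] by blast
  then show ?thesis using deg_eq_nonzero ker by blast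
qed

text \<open>The two summands of the twisted block cannot cancel: one lives on sequences with first
  block exactly \<open>w\<close>, the other on those whose first block begins with
  \<open>w @ [1]\<close>. As the sum lies in \<open>V 0\<close>, where only the periodic path
  occurs, this pins down \<open>w\<close> and makes the second summand vanish.\<close>

lemma block_V_0:
  assumes p: "p \<in> A" and w: "set w \<subseteq> {1..n} - {2}"
    and y: "y \<in> V 0" "y \<noteq> 0" and Dy: "sig p (pe (w @ [2])) \<cdot> y \<in> V 0"
  shows "w = v \<and> p \<cdot> z = 0 \<and> sig p (pe (w @ [2])) \<cdot> y = \<theta> *v y"
proof -
  define \<mu> where "\<mu> = y (\<lambda>_. v)"
  have y_eq: "y = \<mu> *v z" using V_0_eq[OF y(1)] by (simp add: \<mu>_def)
  have \<mu>: "\<mu> \<noteq> 0" using y(2) y_eq by (metis vsmult_zero(2))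
  have yW: "y \<in> W" using y V_W by blast
  have pR: "p \<in> carrier R" using p A_carrier by blast
  have pyW: "p \<cdot> y \<in> W" using pR yW by simp
  have w1: "set (w @ [1]) \<subseteq> {1..n} - {2}" using w n_ge_2 by auto
  let ?D = "sig p (pe (w @ [2])) \<cdot> y" and ?b = "pe (w @ [1]) \<cdot> p \<cdot> y"
  have D: "?D = pe (w @ [2]) \<cdot> y + ?b" by (rule ap_sig_block[OF p w yW])
  have b0: "?b \<xi> = 0" if "\<xi> 0 = w" for \<xi>
    using that unfolding ap_path[OF w1 pyW] by simp
  \<comment> \<open>The path w e_2 c c c ..., at which only the untwisted summand
    contributes.\<close>
  let ?\<eta> = "case_nat w (\<lambda>_. v) :: nat \<Rightarrow> nat list"
  have "?D ?\<eta> = \<theta> * \<mu>"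
    unfolding D using b0[of ?\<eta>] by (simp add: ap_path_block[OF w yW] \<mu>_def)
  then have "?D ?\<eta> \<noteq> 0" using \<theta> \<mu> by simp
  then have "\<forall>i\<ge>0. ?\<eta> i = v" using Dy unfolding V_def by blast
  from this[rule_format, of 0] have wv: "w = v" by simp
  have Cy: "pe (w @ [2]) \<cdot> y = \<theta> *v y"
    using ap_C_z unfolding y_eq wv c_def
    by (simp add: ap_vsmult vsmult_vsmult mult.commute)
  have "?b = ?D - \<theta> *v y" unfolding D Cy by simp
  then have "?b \<in> V 0" using Dy V_diff V_vsmult[OF y(1)] by metis
  then have "?b = ?b (\<lambda>_. v) *v z" by (rule V_0_eq)
  then have b: "?b = 0" using b0[of "\<lambda>_. v"] wv by (metis vsmult_zero(2))
  \<comment> \<open>Prepending \<open>w @ [1]\<close> loses no information, so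
    \<open>p \<cdot> y\<close> can be read off from \<open>?b\<close>.\<close>
  have "p \<cdot> y = 0"
  proof
    fix \<xi>
    have "?b (\<xi>(0 := (w @ [1]) @ \<xi> 0)) = (p \<cdot> y) \<xi>"
      unfolding ap_path[OF w1 pyW] by simp
    then show "(p \<cdot> y) \<xi> = 0 \<xi>" using b by simp
  qed
  then have "\<mu> *v p \<cdot> z = 0" using y_eq by (simp add: ap_vsmult)
  then have "(1 / \<mu>) *v (\<mu> *v p \<cdot> z) = 0" by (metis vsmult_zero(1))
  then have "p \<cdot> z = 0" using \<mu> by (simp add: vsmult_vsmult)
  moreover have "?D = \<theta> *v y" using D Cy b by simp
  ultimately show ?thesis using wv by blast
qed

text \<open>Blocks act from the right end. As a positive degree only grows, a partial product
  outside \<open>V 0\<close> could never return to it, so \<open>block_V_0\<close> applies to each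
  block in turn.\<close>

lemma blocks_V_0:
  assumes p: "p \<in> A" and "\<And>w. w \<in> set ws \<Longrightarrow> set w \<subseteq> {1..n} - {2}"
    and y: "y \<in> V 0" "y \<noteq> 0" and "sig p (pe (blocks ws)) \<cdot> y \<in> V 0"
  shows "(\<forall>w\<in>set ws. w = v) \<and> (ws \<noteq> [] \<longrightarrow> p \<cdot> z = 0) \<and>
    sig p (pe (blocks ws)) \<cdot> y = \<theta> ^ length ws *v y"
  using assms(2,5)
proof (induction ws)
  case Nil
  have "y \<in> W" using y V_W by blast
  then show ?case by (simp add: sig_one[OF p])
next
  case (Cons w ws)
  have yW: "y \<in> W" using y V_W by blast
  let ?y = "sig p (pe (blocks ws)) \<cdot> y"
  have eq: "sig p (pe (blocks (w # ws))) \<cdot> y = sig p (pe (w @ [2])) \<cdot> ?y"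
    using Cons.prems by (intro ap_sig_blocks_Cons[OF p _ yW]) auto
  have w: "set w \<subseteq> {1..n} - {2}" using Cons.prems by simp
  have "set (blocks ws) \<subseteq> {1..n}" using Cons.prems by (intro set_blocks) simp
  then have "?y \<in> W" using yW by (intro ap_closed sig_closed[OF p] path_closed)
  then have V0: "?y \<in> V 0"
  proof (cases ?y rule: W_cases)
    case (2 k)
    then show ?thesis
      using deg_eq_not_V_0[OF deg_eq_block[OF p w 2]] Cons.prems(2) unfolding eq by blast
  qed
  have IH: "\<forall>w\<in>set ws. w = v" "?y = \<theta> ^ length ws *v y"
    using Cons.IH V0 Cons.prems by auto
  have "?y \<noteq> 0"
  proof
    assume "?y = 0"
    then have "(1 / \<theta> ^ length ws) *v (\<theta> ^ length ws *v y) = 0" using IH by (metis vsmult_zero(1))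
    then show False using \<theta> y by (simp add: vsmult_vsmult)
  qed
  from block_V_0[OF p w V0 this] have "w = v" "p \<cdot> z = 0" "sig p (pe (w @ [2])) \<cdot> ?y = \<theta> *v ?y"
    using Cons.prems(2) unfolding eq by auto
  then show ?case
    using IH unfolding eq by (simp add: vsmult_vsmult)
qed

text \<open>\<open>?D\<close> commutes with \<open>ev h ?D\<close> and so preserves its kernel.
  Hence \<open>?D \<cdot> y\<close> lies in \<open>V 0\<close> along with \<open>y\<close>, which
  makes \<open>y\<close> an eigenvector.\<close>

theorem eigenvector:
  assumes p: "p \<in> A" and ws: "\<And>w. w \<in> set ws \<Longrightarrow> set w \<subseteq> {1..n} - {2}" "ws \<noteq> []"
    and y: "y \<in> W" "y \<noteq> 0" and h: "h \<noteq> 0"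
    and ker: "ev h (sig p (pe (blocks ws))) \<cdot> y = 0"
  shows "(\<forall>w\<in>set ws. w = v) \<and> p \<cdot> z = 0 \<and> peval h (\<theta> ^ length ws) = 0 \<and> y \<in> V 0"
proof -
  let ?D = "sig p (pe (blocks ws))"
  have D: "?D \<in> carrier R"
    using set_blocks[OF ws(1)] by (intro sig_closed[OF p] path_closed)
  have V0: "y \<in> V 0" by (rule kernel_V_0[OF p ws y(1) h ker])
  have "ev h ?D \<cdot> ?D \<cdot> y = ?D \<cdot> ev h ?D \<cdot> y"
    using ev_intertwine[OF D D D refl, of h] D y
    by (metis ap_mult ev_closed)
  also have "\<dots> = 0" using ker by (metis ap_zero_right)
  finally have "?D \<cdot> y \<in> V 0"
    by (intro kernel_V_0[OF p ws _ h]) (use D y in auto)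
  from blocks_V_0[OF p ws(1) V0 y(2) this] ws(2)
  have *: "\<forall>w\<in>set ws. w = v" "p \<cdot> z = 0" "?D \<cdot> y = \<theta> ^ length ws *v y" by auto
  have "ev h ?D \<cdot> y = peval h (\<theta> ^ length ws) *v y"
    by (rule ap_ev_eigen[OF D y(1) *(3)])
  then have 0: "peval h (\<theta> ^ length ws) *v y = 0" using ker by simp
  have "peval h (\<theta> ^ length ws) = 0"
  proof (rule ccontr)
    assume "peval h (\<theta> ^ length ws) \<noteq> 0"
    moreover have "(1 / peval h (\<theta> ^ length ws)) *v (peval h (\<theta> ^ length ws) *v y) = 0"
      using 0 by (metis vsmult_zero(1))
    ultimately show False using y by (simp add: vsmult_vsmult)
  qed
  then show ?thesis using * V0 by blast
qed

text \<open>A path without \<open>e\<^sub>2\<close> strictly increases the minimal length of the first block.\<close>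

lemma no_eigenvector:
  assumes w: "set w \<subseteq> {1..n} - {2}" "w \<noteq> []" and h: "poly.coeff h 0 = 1"
    and y: "y \<in> W" and ker: "ev h (pe w) \<cdot> y = 0"
  shows "y = 0"
proof (rule ccontr)
  assume "y \<noteq> 0"
  then have "\<exists>\<xi>. y \<xi> \<noteq> 0" by (auto simp: fun_eq_iff)
  then obtain \<xi> where \<xi>: "y \<xi> \<noteq> 0" and min: "\<And>\<eta>. y \<eta> \<noteq> 0 \<Longrightarrow> length (\<xi> 0) \<le> length (\<eta> 0)"
    using ex_has_least_nat[of "\<lambda>\<xi>. y \<xi> \<noteq> 0" _ "\<lambda>\<xi>. length (\<xi> 0)"] by blast
  have W: "pe w \<in> carrier R" using w by (intro path_closed) auto
  have eq: "ev (pCons a h) (pe w) \<cdot> y = to_ac a *v y + pe w \<cdot> ev h (pe w) \<cdot> y" for a h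
    using W y by (simp add: ev_pCons ap_add_left ap_scal ap_mult)
  have shift: "\<exists>\<eta>'. (ev h (pe w) \<cdot> y) \<eta>' \<noteq> 0 \<and> length (\<eta>' 0) + length w = length (\<eta> 0)"
    if "(pe w \<cdot> ev h (pe w) \<cdot> y) \<eta> \<noteq> 0" for h \<eta>
  proof -
    have W': "ev h (pe w) \<cdot> y \<in> W" using W y by simp
    have "take (length w) (\<eta> 0) = w" "(ev h (pe w) \<cdot> y) (\<eta>(0 := drop (length w) (\<eta> 0))) \<noteq> 0"
      using that unfolding ap_path[OF w(1) W'] by (auto split: if_splits)
    moreover from this(1) have "length w \<le> length (\<eta> 0)" by (metis nat_le_linear take_all)
    ultimately show ?thesis
      by (intro exI[of _ "\<eta>(0 := drop (length w) (\<eta> 0))"]) simp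
  qed
  have bound: "length (\<xi> 0) \<le> length (\<eta> 0)" if "(ev h (pe w) \<cdot> y) \<eta> \<noteq> 0" for h \<eta>
    using that
  proof (induction h arbitrary: \<eta>)
    case 0
    then show ?case using W y by simp
  next
    case (pCons a h)
    then have "y \<eta> \<noteq> 0 \<or> (pe w \<cdot> ev h (pe w) \<cdot> y) \<eta> \<noteq> 0"
      unfolding eq by (auto simp: vsmult_apply)
    then show ?case
    proof
      assume "(pe w \<cdot> ev h (pe w) \<cdot> y) \<eta> \<noteq> 0"
      then show ?thesis using shift pCons.IH by (metis le_add1 le_trans)
    qed (use min in blast)
  qed
  \<comment> \<open>The constant term contributes \<open>y \<xi>\<close>, which the remaining terms
    have to cancel. They draw on a sequence whose first block is shorter by \<open>length w\<close>,
    against the minimality of \<xi>.\<close>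
  obtain h' where h': "h = pCons 1 h'" using h by (cases h) auto
  have "(y + pe w \<cdot> ev h' (pe w) \<cdot> y) \<xi> = 0"
    using ker unfolding h' eq by simp
  then have "(pe w \<cdot> ev h' (pe w) \<cdot> y) \<xi> \<noteq> 0" using \<xi> by auto
  then obtain \<eta> where "(ev h' (pe w) \<cdot> y) \<eta> \<noteq> 0" "length (\<eta> 0) + length w = length (\<xi> 0)"
    using shift by blast
  then show False using bound[of h' \<eta>] w(2) by (cases w) auto
qed

end

section \<open>Cyclic modules\<close>

lemma twist_simps [simp]:
  "carrier (twist s M) = carrier M"
  "\<zero>\<^bsub>twist s M\<^esub> = \<zero>\<^bsub>M\<^esub>"
  "x \<oplus>\<^bsub>twist s M\<^esub> y = x \<oplus>\<^bsub>M\<^esub> y"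
  "r \<odot>\<^bsub>twist s M\<^esub> x = s r \<odot>\<^bsub>M\<^esub> x"
  by (simp_all add: twist_def)

lemma mod_isomorphic_trans:
  assumes "mod_isomorphic R M N" "mod_isomorphic R N P"
  shows "mod_isomorphic R M P"
proof -
  obtain h k where h: "h \<in> mod_hom R M N" "bij_betw h (carrier M) (carrier N)"
    and k: "k \<in> mod_hom R N P" "bij_betw k (carrier N) (carrier P)"
    using assms by (auto simp: mod_isomorphic_def)
  have "k \<circ> h \<in> mod_hom R M P"
    using h(1) k(1) by (auto simp: mod_hom_def Pi_iff)
  then show ?thesis using bij_betw_trans[OF h(2) k(2)] by (auto simp: mod_isomorphic_def)
qed

text \<open>\<open>mod_isomorphic\<close> itself says nothing about closure of the operations, hence
  the two assumptions on \<open>M\<close>.\<close>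

lemma mod_isomorphic_sym:
  assumes iso: "mod_isomorphic R M N"
    and add: "\<And>x y. x \<in> carrier M \<Longrightarrow> y \<in> carrier M \<Longrightarrow> x \<oplus>\<^bsub>M\<^esub> y \<in> carrier M"
    and smult: "\<And>r x. r \<in> carrier R \<Longrightarrow> x \<in> carrier M \<Longrightarrow> r \<odot>\<^bsub>M\<^esub> x \<in> carrier M"
  shows "mod_isomorphic R N M"
proof -
  obtain h where h: "h \<in> mod_hom R M N" "bij_betw h (carrier M) (carrier N)"
    using iso by (auto simp: mod_isomorphic_def)
  let ?k = "inv_into (carrier M) h"
  have k: "?k y \<in> carrier M" "h (?k y) = y" if "y \<in> carrier N" for y
    using h(2) that by (auto simp: bij_betw_def inv_into_into f_inv_into_f)
  have inj: "x = y" if "h x = h y" "x \<in> carrier M" "y \<in> carrier M" for x y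
    using h(2) that by (auto simp: bij_betw_def inj_on_def)
  have hom: "h (x \<oplus>\<^bsub>M\<^esub> y) = h x \<oplus>\<^bsub>N\<^esub> h y" "r \<in> carrier R \<Longrightarrow> h (r \<odot>\<^bsub>M\<^esub> x) = r \<odot>\<^bsub>N\<^esub> h x"
    "h x \<in> carrier N" if "x \<in> carrier M" "y \<in> carrier M" for x y r
    using h(1) that by (auto simp: mod_hom_def)
  have left: "?k (h x) = x" if "x \<in> carrier M" for x
    using that k hom(3) inj by metis
  have "?k \<in> mod_hom R N M"
    unfolding mod_hom_def
  proof (intro CollectI conjI ballI funcsetI)
    fix y y' assume y: "y \<in> carrier N" "y' \<in> carrier N"
    have "y \<oplus>\<^bsub>N\<^esub> y' = h (?k y \<oplus>\<^bsub>M\<^esub> ?k y')" using y k hom by simp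
    then show "?k (y \<oplus>\<^bsub>N\<^esub> y') = ?k y \<oplus>\<^bsub>M\<^esub> ?k y'" using left add k y by simp
  next
    fix r y assume y: "r \<in> carrier R" "y \<in> carrier N"
    have "r \<odot>\<^bsub>N\<^esub> y = h (r \<odot>\<^bsub>M\<^esub> ?k y)"
      using y k hom(2)[of "?k y" "?k y" r] by simp
    then show "?k (r \<odot>\<^bsub>N\<^esub> y) = r \<odot>\<^bsub>M\<^esub> ?k y" using left smult k y by simp
  qed (use k in auto)
  then show ?thesis
    using bij_betw_inv_into[OF h(2)] by (auto simp: mod_isomorphic_def)
qed

locale cyclic = ring R for R (structure) +
  fixes a
  assumes a_closed' [simp, intro]: "a \<in> carrier R"
begin

abbreviation "K \<equiv> PIdl a"
abbreviation "M \<equiv> cyclic_module R a"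
abbreviation "cls x \<equiv> K +> x"

lemmas K_closed = PIdl_closed[OF a_closed']

sublocale K: abelian_subgroup K R
proof (rule abelian_subgroupI3)
  show "additive_subgroup K R"
    by (rule additive_subgroupI, rule add.subgroupI) (use K_closed in auto)
qed (rule abelian_group_axioms)

lemma cls_eq:
  assumes "x \<in> carrier R" "y \<in> carrier R"
  shows "cls x = cls y \<longleftrightarrow> x \<ominus> y \<in> K"
  using assms K.a_rcos_module_minus[OF ring_axioms, of y x] K.a_repr_independence' K.a_rcos_self
  by metis

lemma cls_zero: "cls \<zero> = K"
  by (rule a_coset_add_zero) (auto dest: K_closed(1))

lemma cls_eq_K: "x \<in> carrier R \<Longrightarrow> cls x = K \<longleftrightarrow> x \<in> K"
  using cls_eq[of x \<zero>] cls_zero by (simp add: minus_eq)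

lemma carrier_M: "carrier M = cls ` carrier R"
  by (auto simp: cyclic_module_def A_RCOSETS_def')

lemma zero_M: "\<zero>\<^bsub>M\<^esub> = K"
  by (simp add: cyclic_module_def)

lemma cls_closed [simp, intro]: "x \<in> carrier R \<Longrightarrow> cls x \<in> carrier M"
  by (simp add: carrier_M)

lemma add_M: "x \<in> carrier R \<Longrightarrow> y \<in> carrier R \<Longrightarrow> cls x \<oplus>\<^bsub>M\<^esub> cls y = cls (x \<oplus> y)"
  by (simp add: cyclic_module_def K.a_rcos_sum)

text \<open>Maps out of a quotient are written as unions over a coset; this evaluates such a union
  at one representative.\<close>

lemma UN_cls:
  assumes x: "x \<in> carrier R"
    and cong: "\<And>x'. x' \<in> carrier R \<Longrightarrow> x' \<ominus> x \<in> K \<Longrightarrow> t x' = t x"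
  shows "(\<Union>x'\<in>cls x. t x') = t x"
proof -
  have "t x' = t x" if "x' \<in> cls x" for x'
    using that K.a_elemrcos_carrier[OF x that] K.a_rcos_module_minus[OF ring_axioms x] cong by blast
  moreover have "x \<in> cls x" using K.a_rcos_self[OF x] .
  ultimately show ?thesis by blast
qed

lemma smult_M: "r \<in> carrier R \<Longrightarrow> x \<in> carrier R \<Longrightarrow> r \<odot>\<^bsub>M\<^esub> cls x = cls (r \<otimes> x)"
proof -
  assume r: "r \<in> carrier R" and x: "x \<in> carrier R"
  have "cls (r \<otimes> x') = cls (r \<otimes> x)" if "x' \<in> carrier R" "x' \<ominus> x \<in> K" for x'
    using that r x K_closed(5)[OF r that(2)] by (simp add: cls_eq mult_minus_distrib)
  then show ?thesis
    using UN_cls[OF x, of "\<lambda>x. cls (r \<otimes> x)"] by (simp add: cyclic_module_def)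
qed

lemma abelian_group_M: "abelian_group M"
proof (rule abelian_groupI)
  fix Y assume "Y \<in> carrier M"
  then obtain x where x: "x \<in> carrier R" "Y = cls x" by (auto simp: carrier_M)
  then have "cls (\<ominus> x) \<oplus>\<^bsub>M\<^esub> Y = \<zero>\<^bsub>M\<^esub>"
    by (simp add: add_M l_neg cls_zero zero_M)
  then show "\<exists>y\<in>carrier M. y \<oplus>\<^bsub>M\<^esub> Y = \<zero>\<^bsub>M\<^esub>" using x by blast
next
  show "\<zero>\<^bsub>M\<^esub> \<in> carrier M" using cls_closed[OF zero_closed] by (simp add: cls_zero zero_M)
next
  fix Y assume "Y \<in> carrier M"
  then obtain x where "x \<in> carrier R" "Y = cls x" by (auto simp: carrier_M)
  then show "\<zero>\<^bsub>M\<^esub> \<oplus>\<^bsub>M\<^esub> Y = Y"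
    using add_M[of \<zero> x] by (simp add: cls_zero zero_M)
qed (auto simp: carrier_M add_M a_ac)

lemma left_module_twist:
  assumes s: "s \<in> ring_hom R R"
  shows "left_module R (twist s M)"
proof -
  interpret s: ring_hom_ring R R s
    by (intro ring_hom_ringI2 ring_axioms s)
  interpret M: abelian_group M by (rule abelian_group_M)
  have "\<exists>y\<in>carrier M. y \<oplus>\<^bsub>M\<^esub> x = \<zero>\<^bsub>M\<^esub>" if "x \<in> carrier M" for x
    using M.l_neg[OF that] M.a_inv_closed[OF that] by blast
  then have "abelian_group (twist s M)"
    by (intro abelian_groupI) (auto simp: M.a_ac)
  then show ?thesis
    by (intro left_module.intro left_module_axioms.intro ring_axioms)
      (auto simp: carrier_M add_M smult_M l_distr r_distr m_assoc)
qed

lemma twist_closed: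
  assumes "s \<in> ring_hom R R"
  shows "x \<in> carrier M \<Longrightarrow> y \<in> carrier M \<Longrightarrow> x \<oplus>\<^bsub>twist s M\<^esub> y \<in> carrier M"
    and "r \<in> carrier R \<Longrightarrow> x \<in> carrier M \<Longrightarrow> r \<odot>\<^bsub>twist s M\<^esub> x \<in> carrier M"
  using assms by (auto simp: carrier_M add_M smult_M ring_hom_closed)

lemma simple_twist:
  assumes s: "s \<in> ring_hom R R" "bij_betw s (carrier R) (carrier R)" and one: "\<one> \<notin> K"
    and max: "\<And>x. x \<in> carrier R \<Longrightarrow> x \<notin> K \<Longrightarrow> \<exists>t\<in>carrier R. t \<otimes> x \<ominus> \<one> \<in> K"
  shows "simple_left_module R (twist s M)"
  unfolding simple_left_module_def
proof (intro conjI allI impI left_module_twist s)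
  have "cls \<one> \<noteq> K" using one by (simp add: cls_eq_K)
  then show "carrier (twist s M) \<noteq> {\<zero>\<^bsub>twist s M\<^esub>}"
    using cls_closed[OF one_closed] by (auto simp: zero_M)
next
  fix N assume "submodule N R (twist s M)"
  then have N: "N \<subseteq> carrier M" "K \<in> N"
    "\<And>r x. r \<in> carrier R \<Longrightarrow> x \<in> N \<Longrightarrow> s r \<odot>\<^bsub>M\<^esub> x \<in> N"
    using subgroup.subset[of N "add_monoid (twist s M)"] subgroup.one_closed[of N "add_monoid (twist s M)"]
      submodule.smult_closed[of N R "twist s M"]
    by (auto simp: submodule_def zero_M)
  show "N = {\<zero>\<^bsub>twist s M\<^esub>} \<or> N = carrier (twist s M)"
  proof (cases "N = {K}")
    case False
    then obtain Y where "Y \<in> N" "Y \<noteq> K" using N(2) by blast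
    then obtain x where x: "x \<in> carrier R" "cls x \<in> N" "cls x \<noteq> K"
      using N(1) unfolding carrier_M by blast
    then obtain t where t: "t \<in> carrier R" "t \<otimes> x \<ominus> \<one> \<in> K"
      using max cls_eq_K by blast
    have "cls r \<in> N" if r: "r \<in> carrier R" for r
    proof -
      \<comment> \<open>The twisted action realises every left multiplication because
        \<open>s\<close> is onto.\<close>
      obtain r' where r': "r' \<in> carrier R" "s r' = r \<otimes> t"
        using s(2) r t by (metis bij_betw_apply bij_betw_imp_surj_on imageE m_closed)
      have "r \<otimes> (t \<otimes> x \<ominus> \<one>) \<in> K" using K_closed(5) r t by blast
      then have "cls ((r \<otimes> t) \<otimes> x) = cls r"
        using r t x by (simp add: cls_eq mult_minus_distrib m_assoc)
      then show ?thesis using N(3)[OF r'(1) x(2)] r r' t x by (simp add: smult_M)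
    qed
    then show ?thesis using N by (auto simp: carrier_M)
  qed (simp add: zero_M)
qed

end

context ring
begin

lemma cyclicI: "a \<in> carrier R \<Longrightarrow> cyclic R a"
  by (simp add: cyclic_def cyclic_axioms_def ring_axioms)

text \<open>The class of \<open>y\<close> generates the twisted module, and its annihilator there is
  \<open>PIdl b\<close>. The map constructed starts from the module of \<open>b\<close> and sends x
  to s(x) y; it is inverted at the end.\<close>

lemma iso_cyclic:
  assumes a: "a \<in> carrier R" and b: "b \<in> carrier R"
    and s: "s \<in> ring_hom R R" "bij_betw s (carrier R) (carrier R)" and y: "y \<in> carrier R"
    and ker: "\<And>r. r \<in> carrier R \<Longrightarrow> s r \<otimes> y \<in> PIdl a \<longleftrightarrow> r \<in> PIdl b"
    and gen: "\<exists>t\<in>carrier R. t \<otimes> y \<ominus> \<one> \<in> PIdl a"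
  shows "mod_isomorphic R (twist s (cyclic_module R a)) (cyclic_module R b)"
proof -
  interpret A: cyclic R a by (rule cyclicI[OF a])
  interpret B: cyclic R b by (rule cyclicI[OF b])
  interpret s: ring_hom_ring R R s by (intro ring_hom_ringI2 ring_axioms s)
  define h where "h Y = (\<Union>x\<in>Y. A.cls (s x \<otimes> y))" for Y
  have eq: "A.cls (s x \<otimes> y) = A.cls (s x' \<otimes> y) \<longleftrightarrow> B.cls x = B.cls x'"
    if x: "x \<in> carrier R" "x' \<in> carrier R" for x x'
  proof -
    have "s (x \<ominus> x') \<otimes> y = s x \<otimes> y \<ominus> s x' \<otimes> y"
      using x y by (simp add: minus_eq l_distr l_minus)
    then show ?thesis using ker[of "x \<ominus> x'"] x y by (simp add: A.cls_eq B.cls_eq)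
  qed
  have h: "h (B.cls x) = A.cls (s x \<otimes> y)" if x: "x \<in> carrier R" for x
    unfolding h_def by (rule B.UN_cls[OF x]) (use eq x B.cls_eq in blast)
  have "h \<in> mod_hom R (cyclic_module R b) (twist s (cyclic_module R a))"
    using y by (auto simp: mod_hom_def B.carrier_M h B.add_M A.add_M B.smult_M A.smult_M l_distr m_assoc)
  moreover have "bij_betw h (carrier (cyclic_module R b)) (carrier (cyclic_module R a))"
  proof (rule bij_betw_imageI)
    show "inj_on h (carrier (cyclic_module R b))"
      by (auto simp: inj_on_def B.carrier_M h eq)
    show "h ` carrier (cyclic_module R b) = carrier (cyclic_module R a)"
    proof
      show "h ` carrier (cyclic_module R b) \<subseteq> carrier (cyclic_module R a)"
        using y by (auto simp: B.carrier_M h)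
      show "carrier (cyclic_module R a) \<subseteq> h ` carrier (cyclic_module R b)"
      proof
        fix Y assume "Y \<in> carrier (cyclic_module R a)"
        then obtain r where r: "r \<in> carrier R" "Y = A.cls r" by (auto simp: A.carrier_M)
        obtain t where t: "t \<in> carrier R" "t \<otimes> y \<ominus> \<one> \<in> PIdl a" using gen by blast
        obtain r' where r': "r' \<in> carrier R" "s r' = r \<otimes> t"
          using s(2) r t by (metis bij_betw_imp_surj_on imageE m_closed)
        have "r \<otimes> (t \<otimes> y \<ominus> \<one>) \<in> PIdl a" using A.K_closed(5) r t by blast
        then have "h (B.cls r') = Y"
          using r r' t y by (simp add: h A.cls_eq mult_minus_distrib m_assoc)
        then show "Y \<in> h ` carrier (cyclic_module R b)" using r' by auto
      qed
    qed
  qed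
  ultimately have "mod_isomorphic R (cyclic_module R b) (twist s (cyclic_module R a))"
    by (auto simp: mod_isomorphic_def)
  then show ?thesis
    by (rule mod_isomorphic_sym) (auto simp: B.carrier_M B.add_M B.smult_M)
qed

text \<open>\<open>y\<close> represents the preimage of the class of one. That class is killed by
  \<open>b\<close>, and in the twisted module \<open>b\<close> acts as \<open>s b\<close>.\<close>

lemma iso_cyclicD:
  assumes a: "a \<in> carrier R" and b: "b \<in> carrier R" and s: "s \<in> ring_hom R R"
    and one: "\<one> \<notin> PIdl a"
    and iso: "mod_isomorphic R (twist s (cyclic_module R a)) (cyclic_module R b)"
  shows "\<exists>y\<in>carrier R. y \<notin> PIdl a \<and> s b \<otimes> y \<in> PIdl a"
proof -
  interpret A: cyclic R a by (rule cyclicI[OF a])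
  interpret B: cyclic R b by (rule cyclicI[OF b])
  obtain h where h: "h \<in> mod_hom R (twist s A.M) B.M" "bij_betw h (carrier A.M) (carrier B.M)"
    using iso by (auto simp: mod_isomorphic_def)
  have sR: "s r \<in> carrier R" if "r \<in> carrier R" for r
    using ring_hom_closed[OF s that] .
  have inj: "inj_on h (carrier A.M)" and surj: "h ` carrier A.M = carrier B.M"
    using h(2) by (auto simp: bij_betw_def)
  have KA: "A.K \<in> carrier A.M" and KB: "B.K \<in> carrier B.M"
    using A.cls_closed[OF zero_closed] B.cls_closed[OF zero_closed]
    by (simp_all add: A.cls_zero B.cls_zero)
  have h0: "h A.K = B.K"
  proof -
    have "h A.K \<in> carrier B.M" using surj KA by blast
    then obtain w where w: "w \<in> carrier R" "h A.K = B.cls w" by (auto simp: B.carrier_M)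
    have "h (A.cls \<zero> \<oplus>\<^bsub>A.M\<^esub> A.cls \<zero>) = h (A.cls \<zero>) \<oplus>\<^bsub>B.M\<^esub> h (A.cls \<zero>)"
      using h(1) A.cls_closed[OF zero_closed] by (simp add: mod_hom_def)
    moreover have "A.cls \<zero> \<oplus>\<^bsub>A.M\<^esub> A.cls \<zero> = A.cls \<zero>" using A.add_M[of \<zero> \<zero>] by simp
    ultimately have "h (A.cls \<zero>) = h (A.cls \<zero>) \<oplus>\<^bsub>B.M\<^esub> h (A.cls \<zero>)" by simp
    then have "B.cls w = B.cls (w \<oplus> w)"
      using w by (simp add: B.add_M A.cls_zero)
    then have "B.cls (w \<oplus> w) = B.cls w" by simp
    then have "w \<in> B.K" using w by (simp add: B.cls_eq minus_eq a_assoc r_neg)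
    then show ?thesis using w B.cls_eq_K by simp
  qed
  obtain y where y: "y \<in> carrier R" "h (A.cls y) = B.cls \<one>"
  proof -
    have "B.cls \<one> \<in> h ` carrier A.M" using surj by simp
    then obtain Y where Y: "Y \<in> carrier A.M" "B.cls \<one> = h Y" by blast
    then obtain y where "y \<in> carrier R" "Y = A.cls y" unfolding A.carrier_M by blast
    then show ?thesis using that Y by simp
  qed
  have "h (b \<odot>\<^bsub>twist s A.M\<^esub> A.cls y) = b \<odot>\<^bsub>B.M\<^esub> h (A.cls y)"
  proof -
    have "\<forall>r\<in>carrier R. \<forall>x\<in>carrier A.M. h (r \<odot>\<^bsub>twist s A.M\<^esub> x) = r \<odot>\<^bsub>B.M\<^esub> h x"
      using h(1) by (simp add: mod_hom_def)
    then show ?thesis using b A.cls_closed[OF y(1)] by blast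
  qed
  then have "h (A.cls (s b \<otimes> y)) = B.cls b"
    using y b sR by (simp add: A.smult_M B.smult_M)
  also have "B.cls b = h A.K"
  proof -
    have "b \<in> B.K" unfolding PIdl_mem using b one_closed l_one by metis
    then show ?thesis using b B.cls_eq_K h0 by simp
  qed
  finally have "A.cls (s b \<otimes> y) = A.K"
    using inj KA y b sR by (auto simp: inj_on_def)
  then have "s b \<otimes> y \<in> A.K" using y b sR A.cls_eq_K by simp
  \<comment> \<open>Otherwise the class of one is zero in the target, so both modules vanish,
    against \<open>\<one> \<notin> PIdl a\<close>.\<close>
  moreover have "y \<notin> A.K"
  proof
    assume "y \<in> A.K"
    then have "A.cls y = A.K" using y A.cls_eq_K by simp
    then have "B.cls \<one> = B.K" using y h0 by simp
    then have "\<one> \<in> B.K" using B.cls_eq_K by simp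
    then have "x \<in> B.K" if "x \<in> carrier R" for x
      using B.K_closed(5)[OF that] that by fastforce
    then have "carrier B.M = {B.K}" using KB B.cls_eq_K by (auto simp: B.carrier_M)
    then have "h (A.cls \<one>) = h A.K" using surj h0 by auto
    then have "A.cls \<one> = A.K" using inj KA by (auto simp: inj_on_def)
    then show False using one A.cls_eq_K by simp
  qed
  ultimately show ?thesis using y by blast
qed

end

section \<open>Rotations of words\<close>

lemma rotations_iff: "a \<noteq> [] \<Longrightarrow> b \<in> rotations a \<longleftrightarrow> (\<exists>i. b = rotate i a)"
proof
  assume "a \<noteq> []" "\<exists>i. b = rotate i a"
  then obtain i where "b = rotate (i mod length a) a" using rotate_conv_mod by metis
  then show "b \<in> rotations a" using \<open>a \<noteq> []\<close> by (auto simp: rotations_def)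
qed (auto simp: rotations_def)

lemma rotate_inverse:
  assumes "b = rotate i a"
  shows "\<exists>j. a = rotate j b"
proof (cases "a = []")
  case False
  \<comment> \<open>\<open>j + i\<close> becomes \<open>length a * i\<close>, a whole number of
    turns; the subtraction does not truncate because \<open>a\<close> is nonempty.\<close>
  define j where "j = length a * i - i"
  have "j + i = length a * i" using False by (cases a) (auto simp: j_def)
  then have "rotate j b = a"
    using assms by (simp add: rotate_rotate rotate_id)
  then show ?thesis by metis
qed (use assms in simp)

lemma rotate1_concat_replicate:
  "rotate1 (concat (replicate k d)) = concat (replicate k (rotate1 d))"
proof (cases d)
  case (Cons x xs)
  have *: "concat (replicate k (x # xs)) @ [x] = x # concat (replicate k (xs @ [x]))" for k
    by (induction k) auto
  show ?thesis using * Cons by (cases k) auto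
qed simp

lemma rotate_concat_replicate:
  "rotate i (concat (replicate k d)) = concat (replicate k (rotate i d))"
  by (induction i) (simp_all add: rotate1_concat_replicate)

text \<open>Rotating a power rotates its base, so a rotation of a proper power is again a proper
  power.\<close>

lemma simple_closed_path_rotate_power:
  assumes "simple_closed_path n a" "a = rotate i (concat (replicate k d))" "k \<ge> 1"
  shows "k = 1"
proof (rule ccontr)
  assume "k \<noteq> 1"
  then have "k \<ge> 2" using assms(3) by simp
  have a: "a = concat (replicate k (rotate i d))" using assms by (simp add: rotate_concat_replicate)
  moreover have "set (rotate i d) \<subseteq> set a" using a \<open>k \<ge> 2\<close> by auto
  moreover have "rotate i d \<noteq> []" using a assms(1) by (auto simp: simple_closed_path_def closed_path_def)
  ultimately show False
    using assms(1) \<open>k \<ge> 2\<close> unfolding simple_closed_path_def closed_path_def by blast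
qed

lemma irreducible_dvd_eq:
  fixes f h :: "'k::field poly"
  assumes "f \<in> Irr" "h \<in> Irr" "f dvd h"
  shows "f = h"
proof -
  obtain u where u: "h = f * u" using assms by (auto simp: dvd_def)
  have "\<not> f dvd 1" using assms(1) by (auto simp: Irr_def comm_semiring_1_class.irreducible_def)
  then have "u dvd 1"
    using assms(2) u unfolding Irr_def comm_semiring_1_class.irreducible_def by blast
  then obtain a where a: "u = [:a:]" by (auto elim: is_unit_polyE)
  have "poly.coeff h 0 = poly.coeff f 0 * a" using u a by (simp add: coeff_mult)
  then have "a = 1" using assms by (simp add: Irr_def)
  then show ?thesis using u a by (simp add: one_pCons)
qed

section \<open>Isomorphisms between the twisted modules\<close>

context leavitt_rose
begin

lemma S_mod_eq: "S_mod n f w = cyclic_module R (ev f (pe w))"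
  by (simp add: S_mod_def R_def)

lemma S_twist_eq: "S_twist n f p w = twist (sig p) (cyclic_module R (ev f (pe w)))"
  by (simp add: S_twist_def S_mod_eq)

lemma sig_uminus_cancel:
  assumes "p \<in> A" "x \<in> carrier R"
  shows "sig p (sig (\<ominus> p) x) = x" "sig (\<ominus> p) (sig p x) = x"
  using assms sig_comp[of p "\<ominus> p" x] sig_comp[of "\<ominus> p" p x] A_carrier[of p]
  by (simp_all add: A_closed r_neg l_neg sig_zero)

lemma sigma_inv_eq:
  assumes "p \<in> A" "x \<in> carrier R"
  shows "sigma_inv n p x = sig (\<ominus> p) x"
proof -
  have "inj_on (sig p) (carrier R)" using sig_bij assms by (auto simp: bij_betw_def)
  then have "inv_into (carrier R) (sig p) (sig p (sig (\<ominus> p) x)) = sig (\<ominus> p) x"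
    using assms A_closed(3)[of p] by (intro inv_into_f_f) auto
  then show ?thesis using assms by (simp add: sigma_inv_def R_def sig_uminus_cancel flip: R_def)
qed

lemma PIdl_sig:
  assumes p: "p \<in> A" and r: "r \<in> carrier R" and a: "a \<in> carrier R"
  shows "sig p r \<in> PIdl a \<longleftrightarrow> r \<in> PIdl (sig (\<ominus> p) a)"
proof
  have p': "\<ominus> p \<in> A" using p A_closed by blast
  {
    assume "sig p r \<in> PIdl a"
    then obtain t where t: "t \<in> carrier R" "sig p r = t \<otimes> a" by (auto simp: PIdl_mem)
    then have "sig (\<ominus> p) (sig p r) = sig (\<ominus> p) t \<otimes> sig (\<ominus> p) a"
      using a p' by (simp add: sig_mult)
    then have "r = sig (\<ominus> p) t \<otimes> sig (\<ominus> p) a" using sig_uminus_cancel(2)[OF p r] by simp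
    then show "r \<in> PIdl (sig (\<ominus> p) a)" using t p' by (auto simp: PIdl_mem)
  next
    assume "r \<in> PIdl (sig (\<ominus> p) a)"
    then obtain t where t: "t \<in> carrier R" "r = t \<otimes> sig (\<ominus> p) a" by (auto simp: PIdl_mem)
    then have "sig p r = sig p t \<otimes> a"
      using a p p' sig_uminus_cancel(1)[OF p a] by (simp add: sig_mult)
    then show "sig p r \<in> PIdl a" using t p by (auto simp: PIdl_mem)
  }
qed

text \<open>In the twisted module the annihilator of the class of one is the preimage under
  \<open>sig p\<close> of the left ideal of f(w); since \<open>sig (\<ominus> p)\<close> is an
  automorphism, it is generated by the image of f(w).\<close>

lemma S_twist_iso_cyclic:
  assumes p: "p \<in> A" and w: "set w \<subseteq> {1..n}"
  shows "mod_isomorphic R (S_twist n f p w) (cyclic_module R (ev f (sigma_inv n p (pe w))))"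
proof -
  have p': "\<ominus> p \<in> A" using p A_closed by blast
  have W: "pe w \<in> carrier R" using w by blast
  have eq: "ev f (sigma_inv n p (pe w)) = sig (\<ominus> p) (ev f (pe w))"
    using sig_ev[OF p' W] sigma_inv_eq[OF p W] by simp
  show ?thesis
    unfolding S_twist_eq eq
  proof (rule iso_cyclic[where y = \<one>])
    show "sig p r \<otimes> \<one> \<in> PIdl (ev f (pe w)) \<longleftrightarrow> r \<in> PIdl (sig (\<ominus> p) (ev f (pe w)))"
      if "r \<in> carrier R" for r
      using PIdl_sig[OF p that] W p that by simp
    show "\<exists>t\<in>carrier R. t \<otimes> \<one> \<ominus> \<one> \<in> PIdl (ev f (pe w))"
      using W PIdl_closed(2)[of "ev f (pe w)"] by (intro bexI[of _ \<one>]) (auto simp: minus_eq r_neg)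
  qed (use W p p' sig_hom sig_bij in auto)
qed

end

context leavitt_irr
begin

lemma z_fixed:
  assumes p: "p \<in> A" and pz: "p \<cdot> z = 0"
  shows "sig p (pe c) \<cdot> z = \<theta> *v z"
  using ap_sig_block[OF p v z_W] ap_C_z pz by (simp add: c_def)

text \<open>If p kills z, then \<sigma>_p(c) still has z as an eigenvector for \<theta>, so
  \<sigma>_p(f(c)) = f(\<sigma>_p(c)) lies in the annihilator of z, which is
  \<open>J\<close>.\<close>

lemma sig_J:
  assumes p: "p \<in> A" and pz: "p \<cdot> z = 0" and x: "x \<in> J"
  shows "sig p x \<in> J"
proof -
  obtain t where t: "t \<in> carrier R" "x = t \<otimes> E f" using x by (auto simp: PIdl_mem)
  have D: "sig p (pe c) \<in> carrier R" using p by simp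
  have "ev f (sig p (pe c)) \<cdot> z = 0"
    using ap_ev_eigen[OF D z_W z_fixed[OF p pz], of f] root by simp
  moreover have "sig p x = sig p t \<otimes> ev f (sig p (pe c))"
    using t p by (simp add: sig_mult sig_ev)
  ultimately have "sig p x \<cdot> z = 0"
    using ap_mult[of "sig p t" "ev f (sig p (pe c))" z] t D p ap_zero_right by simp
  then show ?thesis using t p by (simp add: J_eq_ann)
qed

lemma simple_S_twist: "p \<in> A \<Longrightarrow> simple_left_module R (S_twist n f p c)"
  unfolding S_twist_eq
  by (rule cyclic.simple_twist[OF cyclicI])
    (use sig_hom sig_bij one_notin_J J_maximal in auto)

lemma ap_z_nonzero: "y \<in> carrier R \<Longrightarrow> y \<notin> J \<Longrightarrow> y \<cdot> z \<noteq> 0"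
  using J_eq_ann by blast

lemma ap_diff_J:
  assumes "p \<in> carrier R" "q \<in> carrier R" "p \<ominus> q \<in> J"
  shows "(q \<ominus> p) \<cdot> z = 0"
proof -
  have "\<ominus> (p \<ominus> q) \<in> J" using assms J_closed(4) by blast
  moreover have "\<ominus> (p \<ominus> q) = q \<ominus> p" using assms by (simp add: minus_eq minus_add a_comm)
  ultimately show ?thesis using ap_J by metis
qed

text \<open>An isomorphism yields y outside \<open>J\<close> such that y z is killed by the
  polynomial \<open>h\<close> in the twist of w e_2 by p - q, and \<open>eigenvector\<close>
  applies. Conversely the twists by p - q and q - p preserve \<open>J\<close>, so
  \<open>sig p\<close> and \<open>sig q\<close> pull \<open>J\<close> back to the same left
  ideal.\<close>

lemma S_twist_iso_iff:
  assumes p: "p \<in> A" and q: "q \<in> A" and h: "h \<in> Defs.Irr" and w: "set w \<subseteq> {1..n} - {2}"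
  shows "mod_isomorphic R (S_twist n f p c) (S_twist n h q (w @ [2])) \<longleftrightarrow>
    f = h \<and> c = w @ [2] \<and> p \<ominus> q \<in> J"
proof
  have pq: "p \<ominus> q \<in> A" and q': "\<ominus> q \<in> A" using p q by (auto intro: A_closed A_minus_closed)
  have pR: "p \<in> carrier R" "q \<in> carrier R" using p q A_carrier by auto
  have w2: "set (w @ [2]) \<subseteq> {1..n}" using set_block[OF w] .
  have W: "pe (w @ [2]) \<in> carrier R" using path_closed[OF w2] .
  define b where "b = ev h (sigma_inv n q (pe (w @ [2])))"
  have b_eq: "b = sig (\<ominus> q) (ev h (pe (w @ [2])))"
    unfolding b_def using sig_ev[OF q' W] sigma_inv_eq[OF q W] by simp
  have b: "b \<in> carrier R" unfolding b_eq using q' W by simp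
  have iso_q: "mod_isomorphic R (S_twist n h q (w @ [2])) (cyclic_module R b)"
    unfolding b_def by (rule S_twist_iso_cyclic[OF q w2])
  {
    assume "mod_isomorphic R (S_twist n f p c) (S_twist n h q (w @ [2]))"
    from mod_isomorphic_trans[OF this iso_q]
    have "mod_isomorphic R (twist (sig p) (cyclic_module R (E f))) (cyclic_module R b)"
      by (simp add: S_twist_eq)
    from iso_cyclicD[OF _ b sig_hom[OF p] one_notin_J this]
    obtain y where y: "y \<in> carrier R" "y \<notin> J" "sig p b \<otimes> y \<in> J" by auto
    have pb: "sig p b = ev h (sig (p \<ominus> q) (pe (w @ [2])))"
      unfolding b_eq using sig_comp[OF p q'] W sig_ev[OF pq W] by (simp add: minus_eq)
    have D: "sig (p \<ominus> q) (pe (w @ [2])) \<in> carrier R" using pq W by simp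
    have "ev h (sig (p \<ominus> q) (pe (w @ [2]))) \<cdot> y \<cdot> z = 0"
      using ap_J[OF y(3)] D y(1) unfolding pb by (simp add: ap_mult)
    moreover have "h \<noteq> 0" using h by (auto simp: Defs.Irr_def)
    ultimately have *: "w = v" "(p \<ominus> q) \<cdot> z = 0" "peval h \<theta> = 0"
      using eigenvector[OF pq, of "[w]" "y \<cdot> z" h] ap_z_nonzero[OF y(1,2)] y(1) w by auto
    then have "f dvd h" using irreducible_dvd_iff_root[OF f_irr root] by simp
    then have "f = h" using irreducible_dvd_eq f h by blast
    moreover have "p \<ominus> q \<in> J" using * pq A_carrier by (simp add: J_eq_ann)
    ultimately show "f = h \<and> c = w @ [2] \<and> p \<ominus> q \<in> J" using * by (simp add: c_def)
  }
  assume *: "f = h \<and> c = w @ [2] \<and> p \<ominus> q \<in> J"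
  then have pqJ: "p \<ominus> q \<in> J" by blast
  have qp: "q \<ominus> p \<in> A" using p q by (auto intro: A_minus_closed)
  have "(q \<ominus> p) \<cdot> z = 0" using ap_diff_J pR pqJ by blast
  have cancel: "(q \<ominus> p) \<oplus> p = q" "(p \<ominus> q) \<oplus> q = p"
    using pR by (simp_all add: minus_eq a_assoc l_neg)
  have "mod_isomorphic R (twist (sig p) (cyclic_module R (E f))) (cyclic_module R b)"
  proof (rule iso_cyclic[where y = \<one>])
    fix r assume r: "r \<in> carrier R"
    have "sig p r \<in> J \<longleftrightarrow> sig q r \<in> J"
    proof
      assume "sig p r \<in> J"
      then have "sig (q \<ominus> p) (sig p r) \<in> J" by (rule sig_J[OF qp \<open>(q \<ominus> p) \<cdot> z = 0\<close>])
      then show "sig q r \<in> J" using sig_comp[OF qp p r] cancel by simp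
    next
      assume "sig q r \<in> J"
      then have "sig (p \<ominus> q) (sig q r) \<in> J" by (rule sig_J[OF pq ap_J[OF pqJ]])
      then show "sig p r \<in> J" using sig_comp[OF pq q r] cancel by simp
    qed
    then show "sig p r \<otimes> \<one> \<in> J \<longleftrightarrow> r \<in> PIdl b"
      using PIdl_sig[OF q r ev_closed[OF W, of h]] p r * unfolding b_eq by simp
  next
    show "\<exists>t\<in>carrier R. t \<otimes> \<one> \<ominus> \<one> \<in> J"
      using J_closed(2) by (intro bexI[of _ \<one>]) (auto simp: minus_eq r_neg)
  qed (use b p sig_hom sig_bij in auto)
  then have "mod_isomorphic R (S_twist n f p c) (cyclic_module R b)"
    by (simp add: S_twist_eq)
  moreover have "mod_isomorphic R (cyclic_module R b) (S_twist n h q (w @ [2]))"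
  proof (rule mod_isomorphic_sym[OF iso_q])
    interpret B: cyclic R "ev h (pe (w @ [2]))" using W by (intro cyclicI) simp
    show "x \<oplus>\<^bsub>S_twist n h q (w @ [2])\<^esub> y \<in> carrier (S_twist n h q (w @ [2]))"
      if "x \<in> carrier (S_twist n h q (w @ [2]))" "y \<in> carrier (S_twist n h q (w @ [2]))" for x y
      using that B.twist_closed(1)[OF sig_hom[OF q]] by (simp add: S_twist_eq)
    show "r \<odot>\<^bsub>S_twist n h q (w @ [2])\<^esub> x \<in> carrier (S_twist n h q (w @ [2]))"
      if "r \<in> carrier R" "x \<in> carrier (S_twist n h q (w @ [2]))" for r x
      using that B.twist_closed(2)[OF sig_hom[OF q]] by (simp add: S_twist_eq)
  qed
  ultimately show "mod_isomorphic R (S_twist n f p c) (S_twist n h q (w @ [2]))"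
    by (rule mod_isomorphic_trans)
qed

lemma blocks_exist:
  assumes "set (w @ [2]) \<subseteq> {1..n}"
  shows "\<exists>ws. ws \<noteq> [] \<and> blocks ws = w @ [2] \<and> (\<forall>w\<in>set ws. set w \<subseteq> {1..n} - {2})"
  using assms
proof (induction "length w" arbitrary: w rule: less_induct)
  case less
  show ?case
  proof (cases "2 \<in> set w")
    case True
    then obtain a b where ab: "w = a @ 2 # b" "2 \<notin> set a" by (meson split_list_first)
    then obtain ws where "blocks ws = b @ [2]" "\<forall>w\<in>set ws. set w \<subseteq> {1..n} - {2}"
      using less.hyps[of b] less.prems by auto
    then show ?thesis using ab less.prems by (intro exI[of _ "a # ws"]) auto
  next
    case False
    then show ?thesis using less.prems by (intro exI[of _ "[w]"]) auto
  qed
qed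

text \<open>As \<open>p \<in> J\<close>, the twist can be removed by comparison with the twist by
  zero. With c = u w and \<beta> = w u, the vector w z satisfies \<beta> (w z) = w c z = \<theta> w
  z, so \<open>pe w\<close> represents the generator belonging to \<beta>.\<close>

lemma S_twist_iso_rotation:
  assumes pz: "p \<in> A" "p \<in> J" and \<beta>: "\<beta> = rotate i c"
  shows "mod_isomorphic R (S_twist n f p c) (S_mod n f \<beta>)"
proof -
  define j where "j = i mod length c"
  define u w where "u = take j c" and "w = drop j c"
  have c_eq: "c = u @ w" and \<beta>_eq: "\<beta> = w @ u"
    using \<beta> by (simp_all add: u_def w_def j_def rotate_drop_take)
  have sets: "set u \<subseteq> {1..n}" "set w \<subseteq> {1..n}" using set_c c_eq by auto
  then have R: "pe u \<in> carrier R" "pe w \<in> carrier R" "pe \<beta> \<in> carrier R"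
    using \<beta>_eq by auto
  have C: "pe c = pe u \<otimes> pe w" and B: "pe \<beta> = pe w \<otimes> pe u"
    using sets unfolding c_eq \<beta>_eq by (simp_all add: path_append)
  have wf: "pe w \<otimes> E f = ev f (pe \<beta>) \<otimes> pe w"
    using R by (intro ev_intertwine) (auto simp: C B m_assoc)
  have uf: "pe u \<otimes> ev f (pe \<beta>) = E f \<otimes> pe u"
    using R by (intro ev_intertwine) (auto simp: C B m_assoc)
  obtain q where q: "f = pCons 1 (- q)" "\<theta> * peval q \<theta> = 1" using f_split by blast
  have 0: "\<zero> \<in> A" by (rule A_closed)
  have "p \<ominus> \<zero> = p" using A_carrier[OF pz(1)] by (simp add: minus_eq)
  then have "mod_isomorphic R (S_twist n f p c) (S_twist n f \<zero> c)"
    using S_twist_iso_iff[OF pz(1) 0 f v] pz(2) by (simp add: c_def)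
  moreover have "mod_isomorphic R (twist (sig \<zero>) (cyclic_module R (E f))) (cyclic_module R (ev f (pe \<beta>)))"
  proof (rule iso_cyclic[where y = "pe w"])
    fix r assume r: "r \<in> carrier R"
    have "r \<otimes> pe w \<in> J \<longleftrightarrow> r \<in> PIdl (ev f (pe \<beta>))"
    proof
      assume "r \<in> PIdl (ev f (pe \<beta>))"
      then obtain t where t: "t \<in> carrier R" "r = t \<otimes> ev f (pe \<beta>)" by (auto simp: PIdl_mem)
      then have "r \<otimes> pe w = t \<otimes> pe w \<otimes> E f"
        using R wf by (simp add: m_assoc)
      then show "r \<otimes> pe w \<in> J" using t R unfolding PIdl_mem by blast
    next
      assume "r \<otimes> pe w \<in> J"
      then obtain t where t: "t \<in> carrier R" "r \<otimes> pe w = t \<otimes> E f" by (auto simp: PIdl_mem)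
      \<comment> \<open>Right multiplication by \<open>pe u\<close> completes \<open>pe w\<close> to
        \<open>pe \<beta>\<close>, which is then cancelled: modulo \<open>ev f (pe \<beta>)\<close>
        its inverse is \<open>ev q (pe \<beta>)\<close>, by f = 1 - x q.\<close>
      have "r \<otimes> pe \<beta> = r \<otimes> pe w \<otimes> pe u" using R r B by (simp add: m_assoc)
      also have "\<dots> = t \<otimes> pe u \<otimes> ev f (pe \<beta>)" using t R uf by (simp add: m_assoc)
      finally have "r \<otimes> pe \<beta> = t \<otimes> pe u \<otimes> ev f (pe \<beta>)" .
      then have "r \<otimes> pe \<beta> \<otimes> ev q (pe \<beta>) = t \<otimes> pe u \<otimes> (ev f (pe \<beta>) \<otimes> ev q (pe \<beta>))"
        using R t by (simp add: m_assoc)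
      also have "\<dots> = t \<otimes> pe u \<otimes> (ev q (pe \<beta>) \<otimes> ev f (pe \<beta>))"
        using R ev_mult[of "pe \<beta>" f q] ev_mult[of "pe \<beta>" q f] by (simp add: mult.commute)
      finally have 1: "r \<otimes> pe \<beta> \<otimes> ev q (pe \<beta>) = t \<otimes> pe u \<otimes> ev q (pe \<beta>) \<otimes> ev f (pe \<beta>)"
        using R t by (simp add: m_assoc)
      have "1 = f + pCons 0 q" using q by (simp add: one_pCons)
      then have "ev f (pe \<beta>) \<oplus> pe \<beta> \<otimes> ev q (pe \<beta>) = ev 1 (pe \<beta>)"
        using R ev_add[of "pe \<beta>" f "pCons 0 q"] by (simp add: ev_pCons scal_zero)
      then have "r = r \<otimes> (ev f (pe \<beta>) \<oplus> pe \<beta> \<otimes> ev q (pe \<beta>))"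
        using R r by (simp add: ev_one)
      also have "\<dots> = (r \<oplus> t \<otimes> pe u \<otimes> ev q (pe \<beta>)) \<otimes> ev f (pe \<beta>)"
        using R r t 1 by (simp add: r_distr l_distr m_assoc)
      finally show "r \<in> PIdl (ev f (pe \<beta>))" using R r t unfolding PIdl_mem by blast
    qed
    then show "sig \<zero> r \<otimes> pe w \<in> J \<longleftrightarrow> r \<in> PIdl (ev f (pe \<beta>))"
      using r by (simp add: sig_zero)
  next
    \<comment> \<open>This multiplier returns w z to z, as q(c) u w z = q(c) c z = \<theta>
      q(\<theta>) z.\<close>
    have "E q \<otimes> pe u \<otimes> pe w = E q \<otimes> pe c" using R C by (simp add: m_assoc)
    then have "(E q \<otimes> pe u \<otimes> pe w \<ominus> \<one>) \<cdot> z = 0"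
      using q(2) by (simp add: ap_diff ap_mult ap_C_z ap_vsmult ap_ev_z vsmult_vsmult mult.commute)
    then have "E q \<otimes> pe u \<otimes> pe w \<ominus> \<one> \<in> J" using R by (simp add: J_eq_ann)
    then show "\<exists>t\<in>carrier R. t \<otimes> pe w \<ominus> \<one> \<in> J"
      using R by (intro bexI[of _ "E q \<otimes> pe u"]) auto
  qed (use R 0 sig_hom sig_bij in auto)
  then have "mod_isomorphic R (S_twist n f \<zero> c) (S_mod n f \<beta>)"
    by (simp add: S_twist_eq S_mod_eq)
  ultimately show ?thesis by (rule mod_isomorphic_trans)
qed

text \<open>\<beta> need not end in \<open>e 2\<close> and so need not be a product of blocks. The
  kernel vector is carried over to a rotation \<gamma> that is one, and \<open>eigenvector\<close>
  forces all its blocks to be \<open>v\<close>.\<close>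

lemma S_twist_iso_S_mod_imp:
  assumes p: "p \<in> A" and \<alpha>: "simple_closed_path n \<alpha>" and \<beta>: "\<beta> = rotate i \<alpha>"
    and iso: "mod_isomorphic R (S_twist n f p c) (S_mod n f \<beta>)"
  shows "(\<exists>j. c = rotate j \<alpha>) \<and> p \<in> J"
proof -
  have \<beta>n: "set \<beta> \<subseteq> {1..n}" "\<beta> \<noteq> []"
    using \<alpha> \<beta> by (auto simp: simple_closed_path_def closed_path_def)
  have B: "pe \<beta> \<in> carrier R" using path_closed[OF \<beta>n(1)] .
  have f0: "f \<noteq> 0" using f_0 by auto
  from iso have "mod_isomorphic R (twist (sig p) (cyclic_module R (E f))) (cyclic_module R (ev f (pe \<beta>)))"
    by (simp add: S_twist_eq S_mod_eq)
  from iso_cyclicD[OF _ _ sig_hom[OF p] one_notin_J this] B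
  obtain y where y: "y \<in> carrier R" "y \<notin> J" "sig p (ev f (pe \<beta>)) \<otimes> y \<in> J" by auto
  define D where "D = sig p (pe \<beta>)"
  have D: "D \<in> carrier R" using p B by (simp add: D_def)
  define x where "x = y \<cdot> z"
  have x: "x \<in> W" "x \<noteq> 0" using y ap_z_nonzero by (auto simp: x_def)
  have ker: "ev f D \<cdot> x = 0"
    using ap_J[OF y(3)] y(1) p B D by (simp add: x_def D_def sig_ev ap_mult)
  \<comment> \<open>A path avoiding \<open>e 2\<close> lies in \<open>A\<close>, hence is fixed by
    \<open>sig p\<close>, and \<open>no_eigenvector\<close> excludes it.\<close>
  have "2 \<in> set \<beta>"
  proof (rule ccontr)
    assume "2 \<notin> set \<beta>"
    then have b: "set \<beta> \<subseteq> {1..n} - {2}" using \<beta>n by auto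
    then have "D = pe \<beta>" unfolding D_def using sig_A[OF p path_in_A] by blast
    then show False using no_eigenvector[OF b \<beta>n(2) f_0 x(1)] ker x by simp
  qed
  \<comment> \<open>Cutting after the last \<open>e 2\<close>; moving the tail \<open>w\<close> to
    the front makes the path end in \<open>e 2\<close>.\<close>
  then obtain u w where uw: "\<beta> = u @ 2 # w" "2 \<notin> set w" by (meson split_list_last)
  define \<gamma> where "\<gamma> = w @ u @ [2]"
  have sets: "set w \<subseteq> {1..n}" "set (u @ [2]) \<subseteq> {1..n}" "set ((w @ u) @ [2]) \<subseteq> {1..n}"
    using \<beta>n uw by auto
  have R: "pe w \<in> carrier R" "pe (u @ [2]) \<in> carrier R"
    using path_closed[OF sets(1)] path_closed[OF sets(2)] .
  have \<beta>_eq: "pe \<beta> = pe (u @ [2]) \<otimes> pe w" and \<gamma>_eq: "pe \<gamma> = pe w \<otimes> pe (u @ [2])"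
    using path_append[OF sets(2,1)] path_append[OF sets(1,2)] uw by (simp_all add: \<gamma>_def)
  define x' where "x' = sig p (pe w) \<cdot> x"
  have sw: "sig p (pe w) \<in> carrier R" "sig p (pe (u @ [2])) \<in> carrier R" "sig p (pe \<gamma>) \<in> carrier R"
    using R p \<gamma>_eq by auto
  have x'W: "x' \<in> W" using x sw by (simp add: x'_def)
  have "sig p (pe w) \<otimes> ev f D = ev f (sig p (pe \<gamma>)) \<otimes> sig p (pe w)"
    using sw D R p by (intro ev_intertwine) (simp_all add: D_def \<beta>_eq \<gamma>_eq sig_mult m_assoc)
  then have "ev f (sig p (pe \<gamma>)) \<cdot> x' = sig p (pe w) \<cdot> ev f D \<cdot> x"
    using sw D x ap_mult[of "sig p (pe w)" "ev f D" x] ap_mult[of "ev f (sig p (pe \<gamma>))" "sig p (pe w)" x]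
    unfolding x'_def by simp
  then have ker': "ev f (sig p (pe \<gamma>)) \<cdot> x' = 0" using ker ap_zero_right by metis
  \<comment> \<open>If \<open>x'\<close> vanished, \<open>D\<close> would kill \<open>x\<close>, and
    f(D) would act on \<open>x\<close> as f(0) = 1.\<close>
  have "x' \<noteq> 0"
  proof
    assume "x' = 0"
    have "D \<cdot> x = sig p (pe (u @ [2])) \<cdot> x'"
      unfolding D_def \<beta>_eq x'_def using R p x sw by (simp add: sig_mult ap_mult)
    also have "\<dots> = 0 *v x" using \<open>x' = 0\<close> by (metis ap_zero_right vsmult_zero(2))
    finally have "ev f D \<cdot> x = peval f 0 *v x" by (rule ap_ev_eigen[OF D x(1)])
    moreover have "peval f 0 = 1"
      using f_0 by (simp add: poly_0_coeff_0 coeff_map_poly)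
    ultimately show False using ker x by simp
  qed
  obtain ws where ws: "ws \<noteq> []" "blocks ws = \<gamma>" "\<And>w. w \<in> set ws \<Longrightarrow> set w \<subseteq> {1..n} - {2}"
    using blocks_exist[OF sets(3)] unfolding \<gamma>_def append_assoc by blast
  have *: "\<forall>w\<in>set ws. w = v" "p \<cdot> z = 0"
    using eigenvector[OF p ws(3,1) x'W \<open>x' \<noteq> 0\<close> f0] ker' unfolding ws(2) by auto
  have "map (\<lambda>w. w @ [2]) ws = replicate (length ws) c"
    using *(1) by (induction ws) (auto simp: c_def)
  then have \<gamma>c: "\<gamma> = concat (replicate (length ws) c)" using ws(2) by simp
  have "\<gamma> = rotate (length (u @ [2])) \<beta>"
    using rotate_append[of "u @ [2]" w] uw by (simp add: \<gamma>_def)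
  then have \<gamma>\<alpha>: "\<gamma> = rotate (length (u @ [2]) + i) \<alpha>" using \<beta> by (simp add: rotate_rotate)
  \<comment> \<open>\<gamma> is a power of \<open>c\<close>, and the simple path \<alpha> is a
    rotation of \<gamma>, so the exponent is 1.\<close>
  then obtain j where j: "\<alpha> = rotate j \<gamma>" using rotate_inverse by blast
  then have "length ws = 1"
    using simple_closed_path_rotate_power[OF \<alpha>, of j "length ws" c] \<gamma>c ws(1)
    by (cases ws) auto
  then have "\<gamma> = c" using \<gamma>c by (simp add: One_nat_def)
  then have "\<exists>j. c = rotate j \<alpha>" using \<gamma>\<alpha> by blast
  then show ?thesis using * p A_carrier by (simp add: J_eq_ann)
qed

theorem S_twist_iso_S_mod_iff:
  assumes p: "p \<in> A" and \<alpha>: "simple_closed_path n \<alpha>" and \<beta>: "\<beta> \<in> rotations \<alpha>"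
  shows "mod_isomorphic R (S_twist n f p c) (S_mod n f \<beta>) \<longleftrightarrow> \<alpha> \<in> rotations c \<and> p \<in> J"
proof
  have ne: "\<alpha> \<noteq> []" "c \<noteq> []"
    using \<alpha> by (auto simp: simple_closed_path_def closed_path_def c_def)
  obtain i where i: "\<beta> = rotate i \<alpha>" using \<beta> ne rotations_iff by blast
  {
    assume "mod_isomorphic R (S_twist n f p c) (S_mod n f \<beta>)"
    from S_twist_iso_S_mod_imp[OF p \<alpha> i this] obtain j where "c = rotate j \<alpha>" "p \<in> J" by blast
    then show "\<alpha> \<in> rotations c \<and> p \<in> J"
      using rotate_inverse[of c j \<alpha>] rotations_iff[OF ne(2)] by simp
  }
  assume *: "\<alpha> \<in> rotations c \<and> p \<in> J"
  then obtain j where "\<alpha> = rotate j c" using rotations_iff[OF ne(2)] by blast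
  then have "\<beta> = rotate (i + j) c" using i by (simp add: rotate_rotate)
  then show "mod_isomorphic R (S_twist n f p c) (S_mod n f \<beta>)"
    using S_twist_iso_rotation p * by blast
qed

end

section \<open>Endomorphisms\<close>

lemma poly_alg_simps [simp]:
  "carrier poly_alg = UNIV" "x \<otimes>\<^bsub>poly_alg\<^esub> y = x * y" "\<one>\<^bsub>poly_alg\<^esub> = 1"
  "\<zero>\<^bsub>poly_alg\<^esub> = 0" "x \<oplus>\<^bsub>poly_alg\<^esub> y = x + y"
  by (simp_all add: poly_alg_def)

lemma cring_poly_alg: "cring (poly_alg :: 'k::field poly ring)"
proof (rule cringI)
  show "abelian_group (poly_alg :: 'k poly ring)"
  proof (rule abelian_groupI)
    show "\<exists>y\<in>carrier poly_alg. y \<oplus>\<^bsub>poly_alg\<^esub> x = \<zero>\<^bsub>poly_alg\<^esub>" for x :: "'k poly"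
      by (intro bexI[of _ "- x"]) auto
  qed (auto simp: algebra_simps)
  show "Group.comm_monoid (poly_alg :: 'k poly ring)"
    by (rule comm_monoidI) (auto simp: algebra_simps)
qed (auto simp: algebra_simps)

lemma poly_coset: "PIdl\<^bsub>poly_alg\<^esub> f +>\<^bsub>poly_alg\<^esub> q = {q'. f dvd q' - (q :: 'k::field poly)}"
proof (intro equalityI subsetI)
  fix q' assume "q' \<in> PIdl\<^bsub>poly_alg\<^esub> f +>\<^bsub>poly_alg\<^esub> q"
  then show "q' \<in> {q'. f dvd q' - q}"
    by (auto simp: a_r_coset_def' cgenideal_def)
next
  fix q' assume "q' \<in> {q'. f dvd q' - q}"
  then obtain r where "q' - q = f * r" by (auto simp: dvd_def)
  then have "q' = r * f + q" by (simp add: algebra_simps)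
  then show "q' \<in> PIdl\<^bsub>poly_alg\<^esub> f +>\<^bsub>poly_alg\<^esub> q"
    by (auto simp: a_r_coset_def' cgenideal_def)
qed

context leavitt_irr
begin

text \<open>The endomorphisms are the right multiplications by h(c), with h determined modulo f.
  Twisting by the bijection \<open>sig p\<close> does not change which maps commute with the action,
  and \<open>sig p\<close> fixes the scalars.\<close>

theorem End_S_twist:
  assumes p: "p \<in> A"
  shows "\<exists>h. h \<in> alg_iso (End_ring R (S_twist n f p c)) (End_scal n (S_twist n f p c))
    (poly_quot f) (poly_quot_scal f)"
proof -
  interpret C: cyclic R "E f" by (rule cyclicI) simp
  let ?T = "twist (sig p) C.M"
  let ?End = "End_ring R ?T"
  have T: "S_twist n f p c = ?T" by (rule S_twist_eq)
  \<comment> \<open>\<open>J\<close> is only a left ideal, but polynomials in c commute with f(c);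
    this makes right multiplication by \<open>E h\<close> well defined on the quotient.\<close>
  have J_right: "x \<otimes> E h \<in> J" if x: "x \<in> J" for x h
  proof -
    obtain r where r: "r \<in> carrier R" "x = r \<otimes> E f" using x by (auto simp: PIdl_mem)
    have "E f \<otimes> E h = E h \<otimes> E f"
      by (simp add: mult.commute flip: ev_mult)
    then have "x \<otimes> E h = (r \<otimes> E h) \<otimes> E f" using r by (simp add: m_assoc)
    then show ?thesis using r unfolding PIdl_mem by blast
  qed
  define \<Theta> where "\<Theta> h = (\<lambda>Y\<in>carrier C.M. \<Union>x\<in>Y. C.cls (x \<otimes> E h))" for h
  have \<Theta>: "\<Theta> h (C.cls x) = C.cls (x \<otimes> E h)" if x: "x \<in> carrier R" for x h
  proof -
    have "C.cls (x' \<otimes> E h) = C.cls (x \<otimes> E h)" if "x' \<in> carrier R" "x' \<ominus> x \<in> J" for x'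
      using that x J_right[OF that(2), of h] by (simp add: C.cls_eq mult_minus_distrib)
    then show ?thesis
      using C.UN_cls[OF x, of "\<lambda>x. C.cls (x \<otimes> E h)"] x by (simp add: \<Theta>_def)
  qed
  have ext_cls: "\<phi> = \<psi>"
    if "\<phi> \<in> extensional (carrier C.M)" "\<psi> \<in> extensional (carrier C.M)"
      "\<And>x. x \<in> carrier R \<Longrightarrow> \<phi> (C.cls x) = \<psi> (C.cls x)" for \<phi> \<psi> :: "'k lpa set \<Rightarrow> 'k lpa set"
    using that(1,2) by (rule extensionalityI) (use that(3) in \<open>auto simp: C.carrier_M\<close>)
  have \<Theta>_ext: "\<Theta> h \<in> extensional (carrier C.M)" for h by (simp add: \<Theta>_def)
  have \<Theta>_End: "\<Theta> h \<in> carrier ?End" for h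
  proof -
    have "\<Theta> h \<in> mod_hom R ?T ?T"
      using p by (auto simp: mod_hom_def C.carrier_M C.add_M C.smult_M \<Theta> l_distr m_assoc)
    then show ?thesis using \<Theta>_ext by (simp add: End_ring_def)
  qed
  have \<Theta>_eq: "\<Theta> h = \<Theta> h' \<longleftrightarrow> f dvd h - h'" for h h'
  proof -
    have E: "E h \<ominus> E h' \<in> J \<longleftrightarrow> f dvd h - h'"
    proof -
      have *: "E h \<ominus> E h' = E (h - h')"
        using ev_add[of "pe c" "h - h'" h'] by (simp add: minus_eq a_assoc r_neg)
      have "E (h - h') \<in> J \<longleftrightarrow> peval (h - h') \<theta> *v z = 0"
        by (simp add: J_eq_ann ap_ev_z)
      also have "\<dots> \<longleftrightarrow> peval (h - h') \<theta> = 0"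
      proof
        assume "peval (h - h') \<theta> *v z = 0"
        then have "(peval (h - h') \<theta> *v z) (\<lambda>_. v) = 0" by simp
        then show "peval (h - h') \<theta> = 0" by (simp add: vsmult_apply z_def)
      qed (metis vsmult_zero(2))
      finally show ?thesis using * irreducible_dvd_iff_root[OF f_irr root] by simp
    qed
    show ?thesis
    proof
      assume "\<Theta> h = \<Theta> h'"
      then have "\<Theta> h (C.cls \<one>) = \<Theta> h' (C.cls \<one>)" by simp
      then show "f dvd h - h'" using E by (simp add: \<Theta> C.cls_eq)
    next
      assume "f dvd h - h'"
      then have EJ: "E h \<ominus> E h' \<in> J" using E by simp
      show "\<Theta> h = \<Theta> h'"
      proof (rule ext_cls[OF \<Theta>_ext \<Theta>_ext])
        fix x assume x: "x \<in> carrier R"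
        have "x \<otimes> (E h \<ominus> E h') \<in> J" using J_closed(5)[OF x EJ] .
        then show "\<Theta> h (C.cls x) = \<Theta> h' (C.cls x)"
          using x by (simp add: \<Theta> C.cls_eq mult_minus_distrib)
      qed
    qed
  qed
  have \<Theta>_surj: "\<exists>h. \<phi> = \<Theta> h" if \<phi>: "\<phi> \<in> carrier ?End" for \<phi>
  proof -
    have hom: "\<phi> \<in> carrier C.M \<rightarrow> carrier C.M"
      "\<And>r Y. r \<in> carrier R \<Longrightarrow> Y \<in> carrier C.M \<Longrightarrow> \<phi> (sig p r \<odot>\<^bsub>C.M\<^esub> Y) = sig p r \<odot>\<^bsub>C.M\<^esub> \<phi> Y"
      "\<phi> \<in> extensional (carrier C.M)"
      using \<phi> by (auto simp: End_ring_def mod_hom_def)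
    have "\<phi> (C.cls \<one>) \<in> carrier C.M" using hom(1) by auto
    then obtain y where y: "y \<in> carrier R" "\<phi> (C.cls \<one>) = C.cls y" by (auto simp: C.carrier_M)
    have \<phi>_cls: "\<phi> (C.cls r) = C.cls (r \<otimes> y)" if r: "r \<in> carrier R" for r
    proof -
      obtain r' where r': "r' \<in> carrier R" "sig p r' = r"
        using sig_bij[OF p] r by (metis bij_betw_imp_surj_on imageE)
      have "\<phi> (r \<odot>\<^bsub>C.M\<^esub> C.cls \<one>) = r \<odot>\<^bsub>C.M\<^esub> C.cls y"
        using hom(2)[OF r'(1), of "C.cls \<one>"] r' y by simp
      then show ?thesis using r y by (simp add: C.smult_M)
    qed
    \<comment> \<open>\<phi> is right multiplication by y, so f(c) y lies in \<open>J\<close> and y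
      z is killed by f(c). The untwisted case of \<open>eigenvector\<close> makes y z a multiple of
      z, with a coefficient in K[\<theta>], hence equal to some h(c) z.\<close>
    have "E f \<in> J" by (rule E_J) simp
    then have "C.cls (E f) = C.cls \<zero>" by (simp add: C.cls_eq minus_eq)
    then have "C.cls (E f \<otimes> y) = C.cls \<zero>"
      using \<phi>_cls[of "E f"] \<phi>_cls[of \<zero>] y by simp
    then have "E f \<otimes> y \<in> J" using y by (simp add: C.cls_eq minus_eq)
    then have ker: "E f \<cdot> y \<cdot> z = 0" using ap_J y by (metis ap_mult z_W ev_closed C_closed)
    have "\<exists>h. y \<ominus> E h \<in> J"
    proof (cases "y \<in> J")
      case True
      then show ?thesis using y by (intro exI[of _ 0]) (simp add: minus_eq)
    next
      case False
      have "f \<noteq> 0" using f_0 by auto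
      moreover have "ev f (sig \<zero> (pe (blocks [v]))) \<cdot> y \<cdot> z = 0"
        using ker by (simp add: sig_zero flip: c_def)
      ultimately have "y \<cdot> z \<in> V 0"
        using eigenvector[of \<zero> "[v]" "y \<cdot> z" f] v y ap_z_nonzero[OF y(1) False]
        by (auto intro: A_closed)
      then have yz: "y \<cdot> z = (y \<cdot> z) (\<lambda>_. v) *v z" by (rule V_0_eq)
      obtain h where "(y \<cdot> z) (\<lambda>_. v) = peval h \<theta>" using ap_z_values[OF y(1)] by blast
      then have "y \<cdot> z = E h \<cdot> z" using yz by (simp add: ap_ev_z)
      then have "y \<ominus> E h \<in> J" using y by (simp add: J_eq_ann ap_diff)
      then show ?thesis by blast
    qed
    then obtain h where h: "y \<ominus> E h \<in> J" by blast
    have "\<phi> = \<Theta> h"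
    proof (rule ext_cls[OF hom(3) \<Theta>_ext])
      fix x assume x: "x \<in> carrier R"
      have "x \<otimes> (y \<ominus> E h) \<in> J" using J_closed(5)[OF x h] .
      then show "\<phi> (C.cls x) = \<Theta> h (C.cls x)"
        using x y by (simp add: \<Theta> \<phi>_cls C.cls_eq mult_minus_distrib)
    qed
    then show ?thesis by blast
  qed
  let ?I = "PIdl\<^bsub>poly_alg\<^esub> f"
  interpret P: cring "poly_alg :: 'k poly ring" by (rule cring_poly_alg)
  interpret I: ideal ?I poly_alg by (rule P.cgenideal_ideal) simp
  text \<open>The inverse of \<open>\<Theta>\<close>: the fibres of \<open>\<Theta>\<close> are the cosets modulo \<open>f\<close>.\<close>
  define H where "H \<phi> = {q. \<Theta> q = \<phi>}" for \<phi>
  have H: "H (\<Theta> q) = ?I +>\<^bsub>poly_alg\<^esub> q" for q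
    unfolding H_def poly_coset \<Theta>_eq ..
  have carr: "carrier (poly_quot f) = range (\<lambda>q. ?I +>\<^bsub>poly_alg\<^esub> q)"
    by (auto simp: poly_quot_def FactRing_def A_RCOSETS_def')
  \<comment> \<open>Right multiplications compose in reverse order, which does no harm as
    polynomials in c commute.\<close>
  have mult: "\<Theta> q \<otimes>\<^bsub>?End\<^esub> \<Theta> q' = \<Theta> (q * q')" for q q'
  proof (rule ext_cls[OF _ \<Theta>_ext])
    show "\<Theta> q \<otimes>\<^bsub>?End\<^esub> \<Theta> q' \<in> extensional (carrier C.M)" by (simp add: End_ring_def compose_def)
    show "(\<Theta> q \<otimes>\<^bsub>?End\<^esub> \<Theta> q') (C.cls x) = \<Theta> (q * q') (C.cls x)" if x: "x \<in> carrier R" for x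
      using x ev_mult[of "pe c" q' q] by (simp add: End_ring_def compose_eq \<Theta> m_assoc mult.commute)
  qed
  have add: "\<Theta> q \<oplus>\<^bsub>?End\<^esub> \<Theta> q' = \<Theta> (q + q')" for q q'
  proof (rule ext_cls[OF _ \<Theta>_ext])
    show "\<Theta> q \<oplus>\<^bsub>?End\<^esub> \<Theta> q' \<in> extensional (carrier C.M)" by (simp add: End_ring_def)
    show "(\<Theta> q \<oplus>\<^bsub>?End\<^esub> \<Theta> q') (C.cls x) = \<Theta> (q + q') (C.cls x)" if x: "x \<in> carrier R" for x
      using x by (simp add: End_ring_def \<Theta> C.add_M ev_add r_distr)
  qed
  have one: "\<one>\<^bsub>?End\<^esub> = \<Theta> 1"
  proof (rule ext_cls[OF _ \<Theta>_ext])
    show "\<one>\<^bsub>?End\<^esub> \<in> extensional (carrier C.M)" by (simp add: End_ring_def)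
    show "\<one>\<^bsub>?End\<^esub> (C.cls x) = \<Theta> 1 (C.cls x)" if x: "x \<in> carrier R" for x
      using x by (simp add: End_ring_def \<Theta> ev_one)
  qed
  have scal: "End_scal n ?T k = \<Theta> [:k:]" for k
  proof (rule ext_cls[OF _ \<Theta>_ext])
    show "End_scal n ?T k \<in> extensional (carrier C.M)" by (simp add: End_scal_def)
    show "End_scal n ?T k (C.cls x) = \<Theta> [:k:] (C.cls x)" if x: "x \<in> carrier R" for x
      using x p scal_commute[OF x, of k]
      by (simp add: End_scal_def \<Theta> ev_pCons sig_scal C.smult_M)
  qed
  have "H \<in> ring_hom ?End (poly_quot f)"
  proof (rule ring_hom_memI)
    fix \<phi> assume "\<phi> \<in> carrier ?End"
    then show "H \<phi> \<in> carrier (poly_quot f)" using \<Theta>_surj H carr by fastforce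
  next
    fix \<phi> \<psi> assume "\<phi> \<in> carrier ?End" "\<psi> \<in> carrier ?End"
    then obtain q q' where q: "\<phi> = \<Theta> q" "\<psi> = \<Theta> q'" using \<Theta>_surj by metis
    show "H (\<phi> \<otimes>\<^bsub>?End\<^esub> \<psi>) = H \<phi> \<otimes>\<^bsub>poly_quot f\<^esub> H \<psi>"
      unfolding q mult H using I.rcoset_mult_add[of q q'] by (simp add: poly_quot_def FactRing_def)
    show "H (\<phi> \<oplus>\<^bsub>?End\<^esub> \<psi>) = H \<phi> \<oplus>\<^bsub>poly_quot f\<^esub> H \<psi>"
      unfolding q add H using I.a_rcos_sum[of q q'] by (simp add: poly_quot_def FactRing_def)
  next
    show "H \<one>\<^bsub>?End\<^esub> = \<one>\<^bsub>poly_quot f\<^esub>"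
      unfolding one H by (simp add: poly_quot_def FactRing_def)
  qed
  moreover have "bij_betw H (carrier ?End) (carrier (poly_quot f))"
  proof (rule bij_betw_imageI)
    show "inj_on H (carrier ?End)"
    proof (rule inj_onI)
      fix \<phi> \<psi> assume "\<phi> \<in> carrier ?End" "H \<phi> = H \<psi>"
      then obtain q where "\<phi> = \<Theta> q" using \<Theta>_surj by blast
      then have "q \<in> H \<phi>" by (simp add: H_def)
      then have "q \<in> H \<psi>" using \<open>H \<phi> = H \<psi>\<close> by simp
      then show "\<phi> = \<psi>" using \<open>\<phi> = \<Theta> q\<close> by (simp add: H_def)
    qed
    show "H ` carrier ?End = carrier (poly_quot f)"
    proof
      show "H ` carrier ?End \<subseteq> carrier (poly_quot f)" using \<Theta>_surj H carr by fastforce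
      show "carrier (poly_quot f) \<subseteq> H ` carrier ?End"
        unfolding carr using \<Theta>_End by (auto simp flip: H)
    qed
  qed
  ultimately have "H \<in> ring_iso ?End (poly_quot f)" by (simp add: ring_iso_def)
  moreover have "H (End_scal n ?T k) = poly_quot_scal f k" for k
    unfolding scal H poly_quot_scal_def ..
  ultimately show ?thesis unfolding T alg_iso_def by blast
qed

end

lemma C_s_butlast:
  assumes "c \<in> C_s n" "2 \<le> n"
  shows "c = butlast c @ [2]" "set (butlast c) \<subseteq> {1..n} - {2}"
  using assms by (auto simp: C_s_def simple_closed_path_def closed_path_def)
    (metis append_butlast_last_id)+

theorem theorem3p6:
  fixes n :: nat and p q :: "'k::field lpa" and c d :: "nat list" and f g :: "'k poly"
  assumes "n \<ge> 2"
    and "p \<in> subalg_A n" and "q \<in> subalg_A n"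
    and "c \<in> C_s n" and "d \<in> C_s n"
    and "f \<in> Irr" and "g \<in> Irr"
  shows
    "simple_left_module (LPA n) (S_twist n f p c)
     \<and>
     (mod_isomorphic (LPA n) (S_twist n f p c) (S_twist n g q d) \<longleftrightarrow>
        f = g \<and> c = d \<and>
        (\<exists>r\<in>carrier (LPA n). p \<ominus>\<^bsub>LPA n\<^esub> q = r \<otimes>\<^bsub>LPA n\<^esub> lpa_eval n f (path_elem n c)))
     \<and>
     (\<forall>\<alpha>. simple_closed_path n \<alpha> \<longrightarrow>
        (\<forall>\<beta>\<in>rotations \<alpha>.
           mod_isomorphic (LPA n) (S_twist n f p c) (S_mod n f \<beta>) \<longleftrightarrow>
             \<alpha> \<in> rotations c \<and>
             (\<exists>r\<in>carrier (LPA n). p = r \<otimes>\<^bsub>LPA n\<^esub> lpa_eval n f (path_elem n c))))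
     \<and>
     (\<exists>h. h \<in> alg_iso (End_ring (LPA n) (S_twist n f p c)) (End_scal n (S_twist n f p c))
               (poly_quot f) (poly_quot_scal f))
     \<and>
     mod_isomorphic (LPA n) (S_twist n f p c)
       (cyclic_module (LPA n) (lpa_eval n f (sigma_inv n p (path_elem n c))))"
proof -
  obtain \<theta> where \<theta>: "peval f \<theta> = 0" "\<theta> \<noteq> 0" using Irr_root assms(6) by blast
  let ?v = "butlast c" and ?w = "butlast d"
  have cv: "c = ?v @ [2]" "set ?v \<subseteq> {1..n} - {2}" and dw: "d = ?w @ [2]" "set ?w \<subseteq> {1..n} - {2}"
    using C_s_butlast assms by blast+
  interpret leavitt_rose n "LPA n :: 'k lpa ring" by (rule leavitt_rose_LPA[OF assms(1)])
  \<comment> \<open>The representation is built from c and f alone; d, g, q and \<alpha> are tested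
    against it.\<close>
  interpret M: leavitt_irr n "LPA n :: 'k lpa ring" ?v \<theta> f
    by unfold_locales (use cv \<theta> assms in auto)
  have c: "M.c = c" using cv(1) M.c_def by simp
  have set_c: "set c \<subseteq> {1..n}" using M.set_c c by simp
  show ?thesis
    using M.simple_S_twist[OF assms(2)] M.S_twist_iso_iff[OF assms(2,3,7) dw(2)]
      M.S_twist_iso_S_mod_iff[OF assms(2)] M.End_S_twist[OF assms(2)]
      S_twist_iso_cyclic[OF assms(2) set_c, of f]
    unfolding c dw(1)[symmetric] PIdl_mem by blast
qed

end
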